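(* Let $n\in\{2,3,4\}$, let $a\ge 0$ be a constant, let $\Omega$ be a bounded domain in $\mathbb{R}^n$, and let $\Gamma_j$ denote the $j$-th eigenvalue of the Dirichlet problem $$\Delta^2u-a\Delta u=\Gamma u\ \text{ on }\Omega,\qquad u|_{\partial\Omega}=\frac{\partial u}{\partial\nu}\Big|_{\partial\Omega}=0 .$$ Then for every integer $k\ge 1$ $$\frac1k\sum_{j=1}^k\Gamma_j\ \ge\ \frac{n}{n+4}\,\frac{(2\pi)^4}{(\omega_nV(\Omega))^{\frac4n}}\,k^{\frac4n}+\left(\frac{n}{24}\,\alpha_n\,\frac{V(\Omega)}{I(\Omega)}+\frac{na}{n+2}\right)\frac{(2\pi)^2}{(\omega_nV(\Omega))^{\frac2n}}\,k^{\frac2n}+\frac{na}{48}\,\beta_n\,\frac{V(\Omega)}{I(\Omega)},$$ where $\alpha_2=\frac{12095}{12096}$, $\beta_2=\frac{119}{120}$, $\alpha_3=0.991$, $\beta_3=0.986$, $\alpha_4=0.985$ and $\beta_4=0.983$.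
   Context: $\omega_n$ is the volume of the unit ball in $\mathbb{R}^n$; $V(\Omega)$ is the volume of $\Omega$; $I(\Omega)=\min_{c\in\mathbb{R}^n}\int_\Omega |x-c|^2\,dx$ is the moment of inertia of $\Omega$. $\Delta$ is the Laplacian and $\nu$ is the outward unit normal vector field of $\partial\Omega$. The eigenvalues $\Gamma_1\le\Gamma_2\le\cdots\to\infty$ are real and discrete, each repeated according to its multiplicity. (For a general bounded domain the eigenvalue problem is understood in the usual weak sense, in the Sobolev space $H_0^2(\Omega)$.) *)

theory Defs
  imports "HOL-Analysis.Analysis"
begin

section \<open>Test functions\<close>

definition partial :: "'a::euclidean_space \<Rightarrow> ('a \<Rightarrow> real) \<Rightarrow> 'a \<Rightarrow> real" where
  "partial b f = (\<lambda>x. frechet_derivative f (at x) b)"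

text \<open>If every iterated partial derivative is differentiable, then all of them are
  continuous, so this is the usual class of infinitely differentiable functions.\<close>

definition smooth :: "('a::euclidean_space \<Rightarrow> real) \<Rightarrow> bool" where
  "smooth f \<longleftrightarrow> (\<forall>bs\<in>lists Basis. foldr partial bs f differentiable_on UNIV)"

definition test_functions :: "'a::euclidean_space set \<Rightarrow> ('a \<Rightarrow> real) set" where
  "test_functions \<Omega> = {\<phi>. smooth \<phi> \<and> compact (closure {x. \<phi> x \<noteq> 0}) \<and> closure {x. \<phi> x \<noteq> 0} \<subseteq> \<Omega>}"


section \<open>Sobolev spaces\<close>

text \<open>Elements of the function spaces below are functions, not almost-everywhere classes.
  Their values outside \<open>\<Omega>\<close> are irrelevant: all measurability and integrals refer to
  \<open>lebesgue_on \<Omega>\<close>.\<close>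

definition L2 :: "'a::euclidean_space set \<Rightarrow> ('a \<Rightarrow> real) set" where
  "L2 \<Omega> = {u \<in> borel_measurable (lebesgue_on \<Omega>). integrable (lebesgue_on \<Omega>) (\<lambda>x. (u x)\<^sup>2)}"

definition L2_inner :: "'a::euclidean_space set \<Rightarrow> ('a \<Rightarrow> real) \<Rightarrow> ('a \<Rightarrow> real) \<Rightarrow> real" where
  "L2_inner \<Omega> u v = (LINT x|lebesgue_on \<Omega>. u x * v x)"

definition is_weak_partial ::
  "'a::euclidean_space set \<Rightarrow> 'a \<Rightarrow> ('a \<Rightarrow> real) \<Rightarrow> ('a \<Rightarrow> real) \<Rightarrow> bool" where
  "is_weak_partial \<Omega> b u g \<longleftrightarrow>
     g \<in> L2 \<Omega> \<and> (\<forall>\<phi>\<in>test_functions \<Omega>. L2_inner \<Omega> u (partial b \<phi>) = - L2_inner \<Omega> g \<phi>)"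

text \<open>A weak derivative is unique up to a null set; the choice of representative does not
  affect any of the notions below.\<close>

definition weak_partial :: "'a::euclidean_space set \<Rightarrow> 'a \<Rightarrow> ('a \<Rightarrow> real) \<Rightarrow> 'a \<Rightarrow> real" where
  "weak_partial \<Omega> b u = (SOME g. is_weak_partial \<Omega> b u g)"

definition H2 :: "'a::euclidean_space set \<Rightarrow> ('a \<Rightarrow> real) set" where
  "H2 \<Omega> = {u \<in> L2 \<Omega>. \<forall>b\<in>Basis. (\<exists>g. is_weak_partial \<Omega> b u g) \<and>
             (\<forall>c\<in>Basis. \<exists>h. is_weak_partial \<Omega> c (weak_partial \<Omega> b u) h)}"

definition H2_norm :: "'a::euclidean_space set \<Rightarrow> ('a \<Rightarrow> real) \<Rightarrow> real" where
  "H2_norm \<Omega> u = sqrt (L2_inner \<Omega> u u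
     + (\<Sum>b\<in>Basis. L2_inner \<Omega> (weak_partial \<Omega> b u) (weak_partial \<Omega> b u))
     + (\<Sum>b\<in>Basis. \<Sum>c\<in>Basis. L2_inner \<Omega> (weak_partial \<Omega> c (weak_partial \<Omega> b u))
                                         (weak_partial \<Omega> c (weak_partial \<Omega> b u))))"

definition H2_0 :: "'a::euclidean_space set \<Rightarrow> ('a \<Rightarrow> real) set" where
  "H2_0 \<Omega> = {u \<in> H2 \<Omega>. \<exists>\<phi>. (\<forall>m. \<phi> m \<in> test_functions \<Omega>) \<and>
                (\<lambda>m. H2_norm \<Omega> (\<lambda>x. \<phi> m x - u x)) \<longlonglongrightarrow> 0}"


section \<open>The Dirichlet eigenvalue problem\<close>

definition weak_laplacian :: "'a::euclidean_space set \<Rightarrow> ('a \<Rightarrow> real) \<Rightarrow> 'a \<Rightarrow> real" where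
  "weak_laplacian \<Omega> u = (\<lambda>x. \<Sum>b\<in>Basis. weak_partial \<Omega> b (weak_partial \<Omega> b u) x)"

text \<open>The result of multiplying \<open>\<Delta>\<^sup>2 u - a \<Delta> u\<close> by \<open>v \<in> H2_0 \<Omega>\<close> and integrating by parts.\<close>

definition plate_form ::
  "'a::euclidean_space set \<Rightarrow> real \<Rightarrow> ('a \<Rightarrow> real) \<Rightarrow> ('a \<Rightarrow> real) \<Rightarrow> real" where
  "plate_form \<Omega> a u v = L2_inner \<Omega> (weak_laplacian \<Omega> u) (weak_laplacian \<Omega> v)
     + a * (\<Sum>b\<in>Basis. L2_inner \<Omega> (weak_partial \<Omega> b u) (weak_partial \<Omega> b v))"

definition eigenspace :: "'a::euclidean_space set \<Rightarrow> real \<Rightarrow> real \<Rightarrow> ('a \<Rightarrow> real) set" where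
  "eigenspace \<Omega> a \<mu> = {u \<in> H2_0 \<Omega>. \<forall>v\<in>H2_0 \<Omega>. plate_form \<Omega> a u v = \<mu> * L2_inner \<Omega> u v}"

text \<open>\<open>E\<close>, taken modulo equality almost everywhere, has a basis of \<open>m\<close> elements.\<close>

definition has_ae_dim :: "'a measure \<Rightarrow> ('a \<Rightarrow> real) set \<Rightarrow> nat \<Rightarrow> bool" where
  "has_ae_dim M E m \<longleftrightarrow> (\<exists>e. (\<forall>i<m. e i \<in> E) \<and>
     (\<forall>c::nat \<Rightarrow> real. (AE x in M. (\<Sum>i<m. c i * e i x) = 0) \<longrightarrow> (\<forall>i<m. c i = 0)) \<and>
     (\<forall>u\<in>E. \<exists>c::nat \<Rightarrow> real. AE x in M. u x = (\<Sum>i<m. c i * e i x)))"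

text \<open>\<open>\<Gamma> 1 \<le> \<Gamma> 2 \<le> \<dots> \<rightarrow> \<infinity>\<close> lists the eigenvalues, each repeated according to its
  multiplicity; \<open>\<Gamma> 0\<close> is not used. The divergence makes the index set finite, and a number
  that is not an eigenvalue has eigenspace of dimension \<open>0\<close>, so it does not occur.\<close>

definition eigenvalue_sequence :: "'a::euclidean_space set \<Rightarrow> real \<Rightarrow> (nat \<Rightarrow> real) \<Rightarrow> bool" where
  "eigenvalue_sequence \<Omega> a \<Gamma> \<longleftrightarrow>
     (\<forall>i j. 1 \<le> i \<and> i \<le> j \<longrightarrow> \<Gamma> i \<le> \<Gamma> j) \<and> filterlim \<Gamma> at_top sequentially \<and>
     (\<forall>\<mu>. has_ae_dim (lebesgue_on \<Omega>) (eigenspace \<Omega> a \<mu>) (card {j. 1 \<le> j \<and> \<Gamma> j = \<mu>}))"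


section \<open>Geometric quantities and constants\<close>

abbreviation volume :: "'a::euclidean_space set \<Rightarrow> real" where
  "volume \<Omega> \<equiv> measure lebesgue \<Omega>"

text \<open>For bounded \<open>\<Omega>\<close> the infimum is attained, at the centroid.\<close>

definition moment_of_inertia :: "'a::euclidean_space set \<Rightarrow> real" where
  "moment_of_inertia \<Omega> = (INF c. LINT x|lebesgue_on \<Omega>. (norm (x - c))\<^sup>2)"

definition alpha :: "nat \<Rightarrow> real" where
  "alpha n = (if n = 2 then 12095/12096 else if n = 3 then 0.991
              else if n = 4 then 0.985 else undefined)"

definition beta :: "nat \<Rightarrow> real" where
  "beta n = (if n = 2 then 119/120 else if n = 3 then 0.986
             else if n = 4 then 0.983 else undefined)"

end

theory Submission
  imports Defs "HOL-Probability.Probability"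
begin

text \<open>
  Let \<open>u\<^sub>1, \<dots>, u\<^sub>k\<close> be orthonormal eigenfunctions and \<open>F\<close> the sum of the squared moduli of
  their Fourier transforms. Up to powers of \<open>2 * pi\<close>, Plancherel's theorem turns the mass, second and fourth moments of
  \<open>F\<close> into \<open>k\<close>, the Dirichlet energies and the energies of the Laplacians, so that the sum of the
  eigenvalues is a moment of \<open>F\<close>. Bessel's inequality gives \<open>F \<le> V\<close> and the Lipschitz constant
  \<open>2 * sqrt (V * I)\<close> (Li and Yau, Melas). Among functions with these two bounds and given mass, the
  truncated cone \<open>min V (max 0 (\<rho> * (B - norm \<xi>)))\<close> has the least moments. No rearrangement is
  needed for this: the comparison is made along rays, against a radius chosen from the slope region of
  the cone. The moments of the cone are moments of a uniform distribution on the interval of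
  length \<open>w = sqrt (V / I) / 2\<close>, and the constants \<open>\<alpha>\<^sub>n\<close> and \<open>\<beta>\<^sub>n\<close> come from a lower
  bound for \<open>r / w\<close>, where \<open>r = 2 * pi * (k / (\<omega> * V)) powr (1 / n)\<close>: \<open>I\<close> is at least the
  inertia of a ball of volume \<open>V\<close>, and \<open>k \<ge> 1\<close>.
\<close>

section \<open>Smooth functions and the closure properties of the test functions\<close>

section \<open>Test functions\<close>

text \<open>The slope of the cone is the Lipschitz constant \<open>2 * sqrt (V * I) = V / w\<close>,
  so the cone falls from \<open>V\<close> to 0 over a width of exactly \<open>w\<close>. It is the
  average of \<open>V\<close> times the indicators of the balls of radius \<open>t\<close>, with
  \<open>t\<close> uniform on an interval of length \<open>w\<close>; hence its \<open>p\<close>-th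
  moment is \<open>n * \<omega> * V / (n + p)\<close> times the mean of \<open>t ^ (n + p)\<close>,
  and equality of masses says that the mean of \<open>t ^ n\<close> is \<open>r ^ n\<close>.
  Eliminating the midpoint to second order, where the variance is \<open>w\<^sup>2 / 12\<close>, the
  mean of \<open>t ^ q\<close> becomes
  \<open>r ^ q + q * (q - n) / 24 * w\<^sup>2 * r ^ (q - 2)\<close> plus smaller terms. For
  \<open>q = n + 4\<close> and \<open>q = n + 2\<close> these are the terms of the theorem with
  \<alpha> and \<beta> replaced by 1; their deficit from 1 absorbs the smaller terms when
  \<open>r / w\<close> is as small as it can be. The same cone serves for both moments, so the term
  with \<open>a\<close> is simply added. Neither the boundary nor the eigenfunctions are known to be
  regular, so every Fourier identity is proved for test functions and carried to \<open>H2_0\<close>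
  by \<open>L2\<close> limits.\<close>

lemma foldr_partial_append: "foldr partial bs (partial b f) = foldr partial (bs @ [b]) f"
  by simp

lemma smooth_differentiable: "smooth f \<Longrightarrow> f differentiable (at x)"
  unfolding smooth_def differentiable_on_def by (metis UNIV_I foldr_Nil id_apply lists.Nil)

lemma smooth_partial: "smooth f \<Longrightarrow> b \<in> Basis \<Longrightarrow> smooth (partial b f)"
  unfolding smooth_def by (auto simp del: foldr_append simp: foldr_partial_append)

lemma smooth_continuous: "smooth f \<Longrightarrow> continuous_on S f"
  by (meson continuous_at_imp_continuous_on differentiable_imp_continuous_within smooth_differentiable)

lemma partial_eqI: "(f has_derivative f') (at x) \<Longrightarrow> partial b f x = f' b"
  unfolding partial_def by (metis frechet_derivative_at)

lemma has_derivative_frechet: "f differentiable (at x) \<Longrightarrow> (f has_derivative frechet_derivative f (at x)) (at x)"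
  by (simp add: frechet_derivative_works)

lemma has_real_derivative_partial:
  assumes "f differentiable (at (x + t *\<^sub>R b))"
  shows "((\<lambda>t. f (x + t *\<^sub>R b)) has_real_derivative partial b f (x + t *\<^sub>R b)) (at t)"
proof -
  have "((\<lambda>t. x + t *\<^sub>R b) has_derivative (\<lambda>s. s *\<^sub>R b)) (at t)"
    by (auto intro!: derivative_eq_intros)
  from has_derivative_compose[OF this has_derivative_frechet[OF assms]]
  have *: "((\<lambda>t. f (x + t *\<^sub>R b)) has_derivative (\<lambda>s. frechet_derivative f (at (x + t *\<^sub>R b)) (s *\<^sub>R b))) (at t)" .
  have "linear (frechet_derivative f (at (x + t *\<^sub>R b)))"
    using assms by (rule linear_frechet_derivative)
  then have "(\<lambda>s. frechet_derivative f (at (x + t *\<^sub>R b)) (s *\<^sub>R b)) = (*) (partial b f (x + t *\<^sub>R b))"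
    by (auto simp: partial_def linear_cmul)
  with * show ?thesis by (simp add: has_field_derivative_def)
qed

text \<open>Formulas for all iterated derivatives are avoided: it is enough to find a class of
  differentiable functions that contains \<open>f\<close> and is closed under
  \<open>partial\<close>.\<close>

lemma smooth_coinduct:
  assumes "f \<in> S" and d: "\<And>g x. g \<in> S \<Longrightarrow> g differentiable (at x)"
    and p: "\<And>g b. g \<in> S \<Longrightarrow> b \<in> Basis \<Longrightarrow> partial b g \<in> S"
  shows "smooth f"
proof -
  have "foldr partial bs f \<in> S" if "bs \<in> lists Basis" for bs
    using that by (induction bs) (auto simp: assms)
  then show ?thesis
    unfolding smooth_def differentiable_on_def by (auto intro: differentiable_at_withinI d)
qed

lemma partial_add: "f differentiable (at x) \<Longrightarrow> g differentiable (at x) \<Longrightarrow>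
    partial b (\<lambda>x. f x + g x) x = partial b f x + partial b g x"
  by (rule partial_eqI[THEN trans, OF has_derivative_add[OF has_derivative_frechet has_derivative_frechet]])
     (auto simp: partial_def)

lemma partial_mult: "f differentiable (at x) \<Longrightarrow> g differentiable (at x) \<Longrightarrow>
    partial b (\<lambda>x. f x * g x) x = f x * partial b g x + partial b f x * g x"
  by (rule partial_eqI[THEN trans, OF has_derivative_mult[OF has_derivative_frechet has_derivative_frechet]])
     (auto simp: partial_def)

lemma partial_const [simp]: "partial b (\<lambda>x. c) = (\<lambda>x. 0)"
  by (rule ext) (rule partial_eqI, auto intro!: derivative_eq_intros)

lemma smooth_add: assumes "smooth f" "smooth g" shows "smooth (\<lambda>x. f x + g x)"
proof (rule smooth_coinduct[where S = "{h. \<exists>f g. smooth f \<and> smooth g \<and> h = (\<lambda>x. f x + g x)}"])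
  show "(\<lambda>x. f x + g x) \<in> {h. \<exists>f g. smooth f \<and> smooth g \<and> h = (\<lambda>x. f x + g x)}"
    using assms by auto
  fix h :: "'a \<Rightarrow> real" assume "h \<in> {h. \<exists>f g. smooth f \<and> smooth g \<and> h = (\<lambda>x. f x + g x)}"
  then obtain f g where h: "smooth f" "smooth g" "h = (\<lambda>x. f x + g x)" by auto
  then show "h differentiable (at x)" for x
    by (auto intro: differentiable_add smooth_differentiable)
  fix b :: 'a assume "b \<in> Basis"
  moreover have "partial b h = (\<lambda>x. partial b f x + partial b g x)"
    using h by (auto simp: partial_add smooth_differentiable)
  ultimately show "partial b h \<in> {h. \<exists>f g. smooth f \<and> smooth g \<and> h = (\<lambda>x. f x + g x)}"
    using h smooth_partial by blast
qed

lemma partial_cmult: "f differentiable (at x) \<Longrightarrow> partial b (\<lambda>x. c * f x) x = c * partial b f x"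
  by (subst partial_mult) auto

lemma smooth_cmult: assumes "smooth f" shows "smooth (\<lambda>x. c * f x)"
proof (rule smooth_coinduct[where S = "{h. \<exists>f. smooth f \<and> h = (\<lambda>x. c * f x)}"])
  show "(\<lambda>x. c * f x) \<in> {h. \<exists>f. smooth f \<and> h = (\<lambda>x. c * f x)}"
    using assms by auto
  fix h :: "'a \<Rightarrow> real" assume "h \<in> {h. \<exists>f. smooth f \<and> h = (\<lambda>x. c * f x)}"
  then obtain f where h: "smooth f" "h = (\<lambda>x. c * f x)" by auto
  then show "h differentiable (at x)" for x
    by (auto intro: differentiable_mult smooth_differentiable)
  fix b :: 'a assume "b \<in> Basis"
  moreover have "partial b h = (\<lambda>x. c * partial b f x)"
    using h by (auto simp: partial_cmult smooth_differentiable)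
  ultimately show "partial b h \<in> {h. \<exists>f. smooth f \<and> h = (\<lambda>x. c * f x)}"
    using h smooth_partial by blast
qed

lemma test_functionsI:
  assumes "smooth f" "compact K" "K \<subseteq> \<Omega>" "\<And>x. x \<notin> K \<Longrightarrow> f x = 0"
  shows "f \<in> test_functions \<Omega>"
proof -
  have sub: "closure {x. f x \<noteq> 0} \<subseteq> K"
    using assms by (intro closure_minimal) (auto intro: compact_imp_closed)
  then have "compact (closure {x. f x \<noteq> 0})"
    by (metis assms(2) closed_closure compact_Int_closed inf.absorb2)
  then show ?thesis
    using assms(1,3) sub unfolding test_functions_def by blast
qed

text \<open>\<open>K\<close> is the closed support. Its complement is open and \<open>f\<close>
  vanishes there, so the derivatives vanish off \<open>K\<close> too.\<close>

lemma test_functionsE: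
  assumes "f \<in> test_functions \<Omega>"
  obtains K where "smooth f" "compact K" "K \<subseteq> \<Omega>" "\<And>x. x \<notin> K \<Longrightarrow> f x = 0"
    "\<And>x b. x \<notin> K \<Longrightarrow> partial b f x = 0"
proof
  let ?K = "closure {x. f x \<noteq> 0}"
  show "smooth f" "compact ?K" "?K \<subseteq> \<Omega>" using assms by (auto simp: test_functions_def)
  show *: "f x = 0" if "x \<notin> ?K" for x
    using that closure_subset[of "{x. f x \<noteq> 0}"] by blast
  show "partial b f x = 0" if "x \<notin> ?K" for x b
  proof -
    have "open (- ?K)" "x \<in> - ?K" "\<And>y. y \<in> - ?K \<Longrightarrow> 0 = f y"
      using that *[symmetric] by blast+
    then have "(f has_derivative (\<lambda>_. 0)) (at x)"
      by (rule has_derivative_transform_within_open[OF has_derivative_const])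
    then show ?thesis by (rule partial_eqI)
  qed
qed

lemma test_functions_add:
  assumes "f \<in> test_functions \<Omega>" "g \<in> test_functions \<Omega>"
  shows "(\<lambda>x. f x + g x) \<in> test_functions \<Omega>"
proof -
  obtain K where K: "smooth f" "compact K" "K \<subseteq> \<Omega>" "\<And>x. x \<notin> K \<Longrightarrow> f x = 0"
    using test_functionsE[OF assms(1)] by metis
  obtain L where L: "smooth g" "compact L" "L \<subseteq> \<Omega>" "\<And>x. x \<notin> L \<Longrightarrow> g x = 0"
    using test_functionsE[OF assms(2)] by metis
  show ?thesis
    by (rule test_functionsI[of _ "K \<union> L"]) (use K L in \<open>auto intro: smooth_add\<close>)
qed

lemma test_functions_cmult:
  assumes "f \<in> test_functions \<Omega>" shows "(\<lambda>x. c * f x) \<in> test_functions \<Omega>"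
proof -
  obtain K where K: "smooth f" "compact K" "K \<subseteq> \<Omega>" "\<And>x. x \<notin> K \<Longrightarrow> f x = 0"
    using test_functionsE[OF assms(1)] by metis
  show ?thesis
    by (rule test_functionsI[of _ K]) (use K in \<open>auto intro: smooth_cmult\<close>)
qed

lemma test_functions_partial:
  assumes "f \<in> test_functions \<Omega>" "b \<in> Basis" shows "partial b f \<in> test_functions \<Omega>"
proof -
  obtain K where K: "smooth f" "compact K" "K \<subseteq> \<Omega>" "\<And>x b. x \<notin> K \<Longrightarrow> partial b f x = 0"
    using test_functionsE[OF assms(1)] by metis
  show ?thesis
    by (rule test_functionsI[of _ K]) (use K assms in \<open>auto intro: smooth_partial\<close>)
qed

lemma test_functions_zero: "(\<lambda>x. 0) \<in> test_functions \<Omega>"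
proof (rule test_functionsI[of _ "{}"])
  show "smooth (\<lambda>x::'a. 0 :: real)"
    by (rule smooth_coinduct[where S = "{\<lambda>x. 0}"]) auto
qed auto

lemma test_functions_sum:
  "finite J \<Longrightarrow> (\<And>i. i \<in> J \<Longrightarrow> f i \<in> test_functions \<Omega>) \<Longrightarrow> (\<lambda>x. \<Sum>i\<in>J. f i x) \<in> test_functions \<Omega>"
  by (induction J rule: finite_induct) (auto intro: test_functions_zero test_functions_add)

section \<open>Compactly supported smooth functions built from \<open>exp (- 1 / t)\<close>\<close>

section \<open>Bump functions\<close>

text \<open>Differentiating \<open>exp (- 1 / t)\<close> repeatedly yields polynomials in
  \<open>1 / t\<close> times \<open>exp (- 1 / t)\<close>. Indexing by the polynomial makes the
  family closed under differentiation; \<open>p = 1\<close> is the usual function that is flat at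
  0.\<close>

definition flat_exp :: "real poly \<Rightarrow> real \<Rightarrow> real" where
  "flat_exp p t = (if t \<le> 0 then 0 else poly p (1 / t) * exp (- 1 / t))"

lemma tendsto_poly_exp_at_top:
  "((\<lambda>s::real. poly p s * exp (- s)) \<longlongrightarrow> 0) at_top"
proof -
  have *: "((\<lambda>s::real. s ^ k * exp (- s)) \<longlongrightarrow> 0) at_top" for k
    using tendsto_power_div_exp_0[of k] by (simp add: exp_minus field_simps)
  have "(\<lambda>s. poly p s * exp (- s)) = (\<lambda>s. \<Sum>i\<le>degree p. coeff p i * (s ^ i * exp (- s)))"
    by (auto simp: poly_altdef sum_distrib_right mult.assoc)
  then show ?thesis
    using * by (auto intro!: tendsto_null_sum tendsto_mult_right_zero)
qed

text \<open>For \<open>t > 0\<close> the chain rule produces \<open>p - pderiv p\<close> at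
  \<open>1 / t\<close> and the factor \<open>1 / t\<^sup>2\<close>, encoded as
  \<open>monom 1 2\<close>. At 0 only the limit from the right needs an argument, and there the
  exponential beats every polynomial in \<open>1 / t\<close>.\<close>

lemma flat_exp_has_derivative:
  "(flat_exp p has_real_derivative flat_exp (monom 1 2 * (p - pderiv p)) t) (at t)"
proof -
  consider "t < 0" | "t = 0" | "t > 0" by linarith
  then show ?thesis
  proof cases
    case 1
    have "(flat_exp p has_real_derivative 0) (at t)"
      by (rule has_field_derivative_transform_within_open[of "\<lambda>_. 0" _ _ "{..<0}"])
         (use 1 in \<open>auto simp: flat_exp_def\<close>)
    with 1 show ?thesis by (simp add: flat_exp_def)
  next
    case 3
    have "((\<lambda>t. poly p (1 / t) * exp (- 1 / t)) has_real_derivative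
         flat_exp (monom 1 2 * (p - pderiv p)) t) (at t)"
      using 3 by (auto intro!: derivative_eq_intros DERIV_chain2[OF poly_DERIV]
          simp: flat_exp_def poly_monom power2_eq_square field_simps)
    then show ?thesis
      by (rule has_field_derivative_transform_within_open[of _ _ _ "{0<..}"])
         (use 3 in \<open>auto simp: flat_exp_def\<close>)
  next
    case 2
    have "((\<lambda>h. flat_exp p h / h) \<longlongrightarrow> 0) (at 0)"
    proof (rule filterlim_split_at_real)
      show "((\<lambda>h. flat_exp p h / h) \<longlongrightarrow> 0) (at_left 0)"
        by (rule tendsto_eventually) (auto simp: eventually_at_left_field flat_exp_def intro!: exI[of _ "-1"])
      \<comment> \<open>Division by \<open>h\<close> raises the polynomial in \<open>1 / h\<close>
        by one degree, which is what \<open>pCons 0 p\<close> expresses.\<close>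
      have "((\<lambda>h. poly (pCons 0 p) (inverse h) * exp (- inverse h)) \<longlongrightarrow> 0) (at_right (0::real))"
        by (rule filterlim_compose[OF tendsto_poly_exp_at_top filterlim_inverse_at_top_right])
      then show "((\<lambda>h. flat_exp p h / h) \<longlongrightarrow> 0) (at_right 0)"
        by (rule Lim_transform_eventually)
           (auto simp: eventually_at_right_field flat_exp_def field_simps intro!: exI[of _ 1])
    qed
    then show ?thesis
      using 2 by (simp add: DERIV_def flat_exp_def)
  qed
qed

text \<open>The point of this algebra is that partial derivatives do not lead out of it.\<close>

inductive_set bump_algebra :: "('a::euclidean_space \<Rightarrow> real) set" where
  flat: "(\<lambda>x. flat_exp p (x \<bullet> v + c)) \<in> bump_algebra"
| const: "(\<lambda>x. c) \<in> bump_algebra"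
| add: "f \<in> bump_algebra \<Longrightarrow> g \<in> bump_algebra \<Longrightarrow> (\<lambda>x. f x + g x) \<in> bump_algebra"
| mult: "f \<in> bump_algebra \<Longrightarrow> g \<in> bump_algebra \<Longrightarrow> (\<lambda>x. f x * g x) \<in> bump_algebra"

lemma flat_exp_inner_has_derivative:
  "((\<lambda>x. flat_exp p (x \<bullet> v + c)) has_derivative
     (\<lambda>h. flat_exp (monom 1 2 * (p - pderiv p)) (x \<bullet> v + c) * (h \<bullet> v))) (at x)"
proof -
  have "((\<lambda>x. x \<bullet> v + c) has_derivative (\<lambda>h. h \<bullet> v)) (at x)"
    by (auto intro!: derivative_eq_intros)
  from has_derivative_compose[OF this flat_exp_has_derivative[of p "x \<bullet> v + c", unfolded has_field_derivative_def]]
  show ?thesis .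
qed

lemma bump_algebra_smooth: assumes "f \<in> bump_algebra" shows "smooth f"
proof (rule smooth_coinduct[OF assms])
  show d: "g differentiable (at x)" if "g \<in> bump_algebra" for g :: "'a \<Rightarrow> real" and x
    using that
  proof induction
    case (flat p v c)
    then show ?case using flat_exp_inner_has_derivative differentiableI by blast
  qed auto
  show "partial b g \<in> bump_algebra" if "g \<in> bump_algebra" for g :: "'a \<Rightarrow> real" and b
    using that
  proof induction
    case (flat p v c)
    have "partial b (\<lambda>x. flat_exp p (x \<bullet> v + c)) =
        (\<lambda>x. flat_exp (monom 1 2 * (p - pderiv p)) (x \<bullet> v + c) * (b \<bullet> v))"
      using partial_eqI[OF flat_exp_inner_has_derivative] by blast
    then show ?case by (auto intro: bump_algebra.intros)
  next
    case (add f g)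
    then have "partial b (\<lambda>x. f x + g x) = (\<lambda>x. partial b f x + partial b g x)"
      using d by (auto simp: partial_add)
    then show ?case using add by (auto intro: bump_algebra.intros)
  next
    case (mult f g)
    then have "partial b (\<lambda>x. f x * g x) = (\<lambda>x. f x * partial b g x + partial b f x * g x)"
      using d by (auto simp: partial_mult)
    then show ?case using mult by (auto intro: bump_algebra.intros)
  qed (auto intro: bump_algebra.intros)
qed

lemma bump_algebra_prod:
  "finite J \<Longrightarrow> (\<And>i. i \<in> J \<Longrightarrow> f i \<in> bump_algebra) \<Longrightarrow> (\<lambda>x. \<Prod>i\<in>J. f i x) \<in> bump_algebra"
  by (induction J rule: finite_induct) (auto intro: bump_algebra.intros)

lemma bump_algebra_one_minus: "f \<in> bump_algebra \<Longrightarrow> (\<lambda>x. 1 - f x) \<in> bump_algebra"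
  using bump_algebra.add[OF bump_algebra.const[of 1] bump_algebra.mult[OF bump_algebra.const[of "-1"]], of f]
  by simp

lemma bump_algebra_power: "f \<in> bump_algebra \<Longrightarrow> (\<lambda>x. f x ^ N) \<in> bump_algebra"
  by (induction N) (auto intro: bump_algebra.intros)

text \<open>Each coordinate contributes one factor per face of the box, positive exactly on the
  inner side of that face; the factors are at most 1 because
  \<open>exp (- 1 / t) \<le> 1\<close>.\<close>

lemma box_bump:
  fixes a b :: "'a::euclidean_space"
  obtains f where "f \<in> bump_algebra" "\<And>x. x \<in> box a b \<Longrightarrow> 0 < f x \<and> f x \<le> 1" "\<And>x. x \<notin> box a b \<Longrightarrow> f x = 0"
proof
  let ?f = "\<lambda>x. \<Prod>i\<in>Basis. flat_exp 1 (x \<bullet> i + - (a \<bullet> i)) * flat_exp 1 (x \<bullet> (- i) + b \<bullet> i)"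
  show "?f \<in> bump_algebra"
    by (intro bump_algebra_prod bump_algebra.mult bump_algebra.flat) auto
  show "0 < ?f x \<and> ?f x \<le> 1" if "x \<in> box a b" for x
    using that by (auto simp: flat_exp_def mem_box intro!: prod_pos prod_le_1 mult_le_one)
  show "?f x = 0" if "x \<notin> box a b" for x
    using that by (auto simp: flat_exp_def mem_box not_less)
qed

section \<open>Square integrable functions: Cauchy-Schwarz, convergence, Bessel,
  Gram-Schmidt\<close>

section \<open>The Hilbert space of square integrable functions\<close>

lemma L2_measurable: "u \<in> L2 \<Omega> \<Longrightarrow> u \<in> borel_measurable (lebesgue_on \<Omega>)"
  and L2_square_integrable: "u \<in> L2 \<Omega> \<Longrightarrow> integrable (lebesgue_on \<Omega>) (\<lambda>x. (u x)\<^sup>2)"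
  by (auto simp: L2_def)

lemma L2_mult_integrable:
  assumes "u \<in> L2 \<Omega>" "v \<in> L2 \<Omega>" shows "integrable (lebesgue_on \<Omega>) (\<lambda>x. u x * v x)"
proof (rule Bochner_Integration.integrable_bound)
  show "integrable (lebesgue_on \<Omega>) (\<lambda>x. (u x)\<^sup>2 + (v x)\<^sup>2)"
    using assms by (intro Bochner_Integration.integrable_add L2_square_integrable)
  show "(\<lambda>x. u x * v x) \<in> borel_measurable (lebesgue_on \<Omega>)"
    using assms by (intro borel_measurable_times L2_measurable)
  have "\<bar>a * b\<bar> \<le> a\<^sup>2 + b\<^sup>2" for a b :: real
  proof -
    have "2 * (\<bar>a\<bar> * \<bar>b\<bar>) \<le> a\<^sup>2 + b\<^sup>2"
      using zero_le_power2[of "\<bar>a\<bar> - \<bar>b\<bar>"] by (simp add: power2_diff)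
    moreover have "0 \<le> \<bar>a\<bar> * \<bar>b\<bar>" by simp
    ultimately show ?thesis unfolding abs_mult by linarith
  qed
  then show "AE x in lebesgue_on \<Omega>. norm (u x * v x) \<le> norm ((u x)\<^sup>2 + (v x)\<^sup>2)"
    by simp
qed

lemma L2_add: assumes "u \<in> L2 \<Omega>" "v \<in> L2 \<Omega>" shows "(\<lambda>x. u x + v x) \<in> L2 \<Omega>"
proof -
  have "integrable (lebesgue_on \<Omega>) (\<lambda>x. ((u x)\<^sup>2 + (v x)\<^sup>2) + 2 * (u x * v x))"
    using assms by (intro Bochner_Integration.integrable_add L2_square_integrable
        integrable_mult_right L2_mult_integrable)
  then show ?thesis
    using assms by (auto simp: L2_def power2_sum mult.assoc intro: borel_measurable_add)
qed

lemma L2_cmult: "u \<in> L2 \<Omega> \<Longrightarrow> (\<lambda>x. c * u x) \<in> L2 \<Omega>"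
  by (auto simp: L2_def power_mult_distrib)

lemma L2_diff: "u \<in> L2 \<Omega> \<Longrightarrow> v \<in> L2 \<Omega> \<Longrightarrow> (\<lambda>x. u x - v x) \<in> L2 \<Omega>"
  using L2_add[OF _ L2_cmult[of v \<Omega> "-1"], of u] by simp

lemma L2_zero: "(\<lambda>x. 0) \<in> L2 \<Omega>"
  by (simp add: L2_def)

lemma L2_sum: "finite J \<Longrightarrow> (\<And>i. i \<in> J \<Longrightarrow> f i \<in> L2 \<Omega>) \<Longrightarrow> (\<lambda>x. \<Sum>i\<in>J. f i x) \<in> L2 \<Omega>"
  by (induction J rule: finite_induct) (auto intro: L2_zero L2_add)

abbreviation L2_sq :: "'a::euclidean_space set \<Rightarrow> ('a \<Rightarrow> real) \<Rightarrow> real" where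
  "L2_sq \<Omega> u \<equiv> L2_inner \<Omega> u u"

lemma L2_inner_commute: "L2_inner \<Omega> u v = L2_inner \<Omega> v u"
  by (simp add: L2_inner_def mult.commute)

lemma L2_inner_add_left:
  "u \<in> L2 \<Omega> \<Longrightarrow> v \<in> L2 \<Omega> \<Longrightarrow> w \<in> L2 \<Omega> \<Longrightarrow>
   L2_inner \<Omega> (\<lambda>x. u x + v x) w = L2_inner \<Omega> u w + L2_inner \<Omega> v w"
  by (simp add: L2_inner_def distrib_right L2_mult_integrable)

lemma L2_inner_diff_left:
  "u \<in> L2 \<Omega> \<Longrightarrow> v \<in> L2 \<Omega> \<Longrightarrow> w \<in> L2 \<Omega> \<Longrightarrow>
   L2_inner \<Omega> (\<lambda>x. u x - v x) w = L2_inner \<Omega> u w - L2_inner \<Omega> v w"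
  by (simp add: L2_inner_def left_diff_distrib L2_mult_integrable)

lemma L2_inner_cmult_left: "L2_inner \<Omega> (\<lambda>x. c * u x) v = c * L2_inner \<Omega> u v"
  by (simp add: L2_inner_def mult.assoc)

lemma L2_inner_add_right:
  "u \<in> L2 \<Omega> \<Longrightarrow> v \<in> L2 \<Omega> \<Longrightarrow> w \<in> L2 \<Omega> \<Longrightarrow>
   L2_inner \<Omega> w (\<lambda>x. u x + v x) = L2_inner \<Omega> w u + L2_inner \<Omega> w v"
  by (simp add: L2_inner_def distrib_left L2_mult_integrable)

lemma L2_inner_diff_right:
  "u \<in> L2 \<Omega> \<Longrightarrow> v \<in> L2 \<Omega> \<Longrightarrow> w \<in> L2 \<Omega> \<Longrightarrow>
   L2_inner \<Omega> w (\<lambda>x. u x - v x) = L2_inner \<Omega> w u - L2_inner \<Omega> w v"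
  by (simp add: L2_inner_def right_diff_distrib L2_mult_integrable)

lemma L2_inner_cmult_right: "L2_inner \<Omega> v (\<lambda>x. c * u x) = c * L2_inner \<Omega> v u"
  by (simp add: L2_inner_def mult.left_commute)

lemma L2_inner_zero_left: "L2_inner \<Omega> (\<lambda>x. 0) v = 0"
  by (simp add: L2_inner_def)

lemma L2_inner_sum_left:
  "finite J \<Longrightarrow> (\<And>i. i \<in> J \<Longrightarrow> f i \<in> L2 \<Omega>) \<Longrightarrow> v \<in> L2 \<Omega> \<Longrightarrow>
   L2_inner \<Omega> (\<lambda>x. \<Sum>i\<in>J. f i x) v = (\<Sum>i\<in>J. L2_inner \<Omega> (f i) v)"
  by (induction J rule: finite_induct) (auto simp: L2_inner_zero_left L2_inner_add_left L2_sum)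

lemma L2_inner_cong_AE:
  assumes "AE x in lebesgue_on \<Omega>. u x = u' x" "AE x in lebesgue_on \<Omega>. v x = v' x"
    "u \<in> L2 \<Omega>" "u' \<in> L2 \<Omega>" "v \<in> L2 \<Omega>" "v' \<in> L2 \<Omega>"
  shows "L2_inner \<Omega> u v = L2_inner \<Omega> u' v'"
  unfolding L2_inner_def
proof (rule integral_cong_AE)
  show "AE x in lebesgue_on \<Omega>. u x * v x = u' x * v' x" using assms(1,2) by eventually_elim simp
qed (intro borel_measurable_times L2_measurable assms)+

lemma L2_inner_self_nonneg: "0 \<le> L2_sq \<Omega> u"
  unfolding L2_inner_def by (rule Bochner_Integration.integral_nonneg) simp

lemma L2_inner_self_eq_0:
  assumes "u \<in> L2 \<Omega>" shows "L2_sq \<Omega> u = 0 \<longleftrightarrow> (AE x in lebesgue_on \<Omega>. u x = 0)"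
proof -
  have "(LINT x|lebesgue_on \<Omega>. (u x)\<^sup>2) = 0 \<longleftrightarrow> (AE x in lebesgue_on \<Omega>. (u x)\<^sup>2 = 0)"
    by (rule integral_nonneg_eq_0_iff_AE[OF L2_square_integrable[OF assms]]) auto
  then show ?thesis by (simp add: L2_inner_def power2_eq_square)
qed

lemma L2_inner_self_cmult: "L2_sq \<Omega> (\<lambda>x. c * u x) = c\<^sup>2 * L2_sq \<Omega> u"
  by (simp add: L2_inner_cmult_left L2_inner_cmult_right power2_eq_square)

lemma L2_inner_self_add:
  assumes "u \<in> L2 \<Omega>" "v \<in> L2 \<Omega>"
  shows "L2_sq \<Omega> (\<lambda>x. u x + v x) = L2_sq \<Omega> u + 2 * L2_inner \<Omega> u v + L2_sq \<Omega> v"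
  using assms by (simp add: L2_inner_add_left L2_inner_add_right L2_add L2_inner_commute[of _ v u])

lemma L2_Cauchy_Schwarz:
  assumes "u \<in> L2 \<Omega>" "v \<in> L2 \<Omega>"
  shows "(L2_inner \<Omega> u v)\<^sup>2 \<le> L2_sq \<Omega> u * L2_sq \<Omega> v"
proof (cases "L2_sq \<Omega> v = 0")
  case True
  then have "AE x in lebesgue_on \<Omega>. v x = 0" using assms L2_inner_self_eq_0 by blast
  then have "L2_inner \<Omega> u v = L2_inner \<Omega> u (\<lambda>x. 0)"
    using assms L2_zero by (intro L2_inner_cong_AE) auto
  then show ?thesis by (simp add: True L2_inner_def)
next
  case False
  \<comment> \<open>This \<open>?t\<close> minimises the squared norm of
    \<open>u + t * v\<close>.\<close>
  let ?t = "- L2_inner \<Omega> u v / L2_sq \<Omega> v"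
  have pos: "0 < L2_sq \<Omega> v" using False L2_inner_self_nonneg[of \<Omega> v] by simp
  have "0 \<le> L2_sq \<Omega> (\<lambda>x. u x + ?t * v x)"
    by (rule L2_inner_self_nonneg)
  also have "\<dots> = L2_sq \<Omega> u + 2 * (?t * L2_inner \<Omega> u v) + ?t\<^sup>2 * L2_sq \<Omega> v"
    using assms by (simp only: L2_inner_self_add L2_cmult L2_inner_self_cmult L2_inner_cmult_right)
  also have "\<dots> = L2_sq \<Omega> u - (L2_inner \<Omega> u v)\<^sup>2 / L2_sq \<Omega> v"
    using False by (simp add: field_simps power2_eq_square)
  finally show ?thesis using pos by (simp add: field_simps)
qed

lemma L2_inner_self_add_le:
  assumes "u \<in> L2 \<Omega>" "v \<in> L2 \<Omega>"
  shows "L2_sq \<Omega> (\<lambda>x. u x + v x) \<le> 2 * L2_sq \<Omega> u + 2 * L2_sq \<Omega> v"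
proof -
  have "0 \<le> L2_sq \<Omega> (\<lambda>x. u x + (-1) * v x)"
    by (rule L2_inner_self_nonneg)
  also have "\<dots> = L2_sq \<Omega> u - 2 * L2_inner \<Omega> u v + L2_sq \<Omega> v"
    using assms
    by (simp only: L2_inner_self_add L2_cmult L2_inner_self_cmult L2_inner_cmult_right) simp
  finally show ?thesis using assms by (simp add: L2_inner_self_add)
qed

text \<open>Membership in \<open>L2\<close> is part of the notion, since an inner product of
  functions outside \<open>L2\<close> may be an integral with the default value 0.\<close>

definition L2_tendsto :: "'a::euclidean_space set \<Rightarrow> (nat \<Rightarrow> 'a \<Rightarrow> real) \<Rightarrow> ('a \<Rightarrow> real) \<Rightarrow> bool" where
  "L2_tendsto \<Omega> f g \<longleftrightarrow> (\<forall>m. f m \<in> L2 \<Omega>) \<and> g \<in> L2 \<Omega> \<and>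
     (\<lambda>m. L2_sq \<Omega> (\<lambda>x. f m x - g x)) \<longlonglongrightarrow> 0"

lemma L2_tendsto_add:
  assumes "L2_tendsto \<Omega> f f'" "L2_tendsto \<Omega> g g'"
  shows "L2_tendsto \<Omega> (\<lambda>m x. f m x + g m x) (\<lambda>x. f' x + g' x)"
proof -
  have L: "f m \<in> L2 \<Omega>" "g m \<in> L2 \<Omega>" "f' \<in> L2 \<Omega>" "g' \<in> L2 \<Omega>" for m
    using assms by (auto simp: L2_tendsto_def)
  have eq: "f m x + g m x - (f' x + g' x) = (f m x - f' x) + (g m x - g' x)" for m x by simp
  have "(\<lambda>m. 2 * L2_sq \<Omega> (\<lambda>x. f m x - f' x)
      + 2 * L2_sq \<Omega> (\<lambda>x. g m x - g' x)) \<longlonglongrightarrow> 0"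
    using assms by (auto simp: L2_tendsto_def intro!: tendsto_add_zero tendsto_mult_right_zero)
  then have "(\<lambda>m. L2_sq \<Omega> (\<lambda>x. f m x + g m x - (f' x + g' x))) \<longlonglongrightarrow> 0"
    unfolding eq
    by (rule tendsto_sandwich[OF _ _ tendsto_const, rotated 2])
      (intro always_eventually allI L2_inner_self_nonneg L2_inner_self_add_le L2_diff L)+
  then show ?thesis using L by (auto simp: L2_tendsto_def intro: L2_add)
qed

lemma L2_tendsto_cmult:
  assumes "L2_tendsto \<Omega> f f'" shows "L2_tendsto \<Omega> (\<lambda>m x. c * f m x) (\<lambda>x. c * f' x)"
proof -
  have eq: "c * a - c * b = c * (a - b)" for a b :: real by (simp add: algebra_simps)
  show ?thesis
    using assms unfolding L2_tendsto_def eq L2_inner_self_cmult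
    by (auto intro: L2_cmult tendsto_mult_right_zero)
qed

lemma L2_tendsto_const: "f \<in> L2 \<Omega> \<Longrightarrow> L2_tendsto \<Omega> (\<lambda>m. f) f"
  by (simp add: L2_tendsto_def L2_inner_zero_left)

lemma L2_tendsto_sum:
  "finite J \<Longrightarrow> (\<And>i. i \<in> J \<Longrightarrow> L2_tendsto \<Omega> (f i) (g i)) \<Longrightarrow>
   L2_tendsto \<Omega> (\<lambda>m x. \<Sum>i\<in>J. f i m x) (\<lambda>x. \<Sum>i\<in>J. g i x)"
  by (induction J rule: finite_induct) (auto intro: L2_tendsto_const[OF L2_zero] L2_tendsto_add)

lemma L2_tendsto_inner:
  assumes "L2_tendsto \<Omega> f g" "v \<in> L2 \<Omega>"
  shows "(\<lambda>m. L2_inner \<Omega> (f m) v) \<longlonglongrightarrow> L2_inner \<Omega> g v"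
proof -
  have L: "f m \<in> L2 \<Omega>" "g \<in> L2 \<Omega>" for m using assms by (auto simp: L2_tendsto_def)
  let ?b = "\<lambda>m. sqrt (L2_sq \<Omega> (\<lambda>x. f m x - g x) * L2_sq \<Omega> v)"
  have "?b \<longlonglongrightarrow> sqrt (0 * L2_sq \<Omega> v)"
    using assms by (intro tendsto_real_sqrt tendsto_mult_right) (auto simp: L2_tendsto_def)
  then have b: "?b \<longlonglongrightarrow> 0" by simp
  have "norm (L2_inner \<Omega> (f m) v - L2_inner \<Omega> g v) \<le> ?b m" for m
    using L2_Cauchy_Schwarz[OF L2_diff[OF L] assms(2), of m]
    unfolding L2_inner_diff_left[OF L assms(2)] real_norm_def by (metis power2_abs real_le_rsqrt)
  then have "(\<lambda>m. L2_inner \<Omega> (f m) v - L2_inner \<Omega> g v) \<longlonglongrightarrow> 0"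
    by (rule Lim_null_comparison[OF always_eventually[OF allI] b])
  then show ?thesis by (simp add: LIM_zero_iff)
qed

lemma L2_tendsto_norm:
  assumes "L2_tendsto \<Omega> f g"
  shows "(\<lambda>m. L2_sq \<Omega> (f m)) \<longlonglongrightarrow> L2_sq \<Omega> g"
proof -
  have L: "f m \<in> L2 \<Omega>" "g \<in> L2 \<Omega>" for m using assms by (auto simp: L2_tendsto_def)
  let ?d = "\<lambda>m x. f m x - g x"
  have "L2_sq \<Omega> (\<lambda>x. ?d m x + g x)
      = L2_sq \<Omega> (?d m) + 2 * L2_inner \<Omega> (?d m) g + L2_sq \<Omega> g" for m
    by (rule L2_inner_self_add) (use L in \<open>auto intro: L2_diff\<close>)
  then have eq: "L2_sq \<Omega> (f m)
      = L2_sq \<Omega> (?d m) + 2 * (L2_inner \<Omega> (f m) g - L2_sq \<Omega> g) + L2_sq \<Omega> g" for m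
    using L by (simp add: L2_inner_diff_left)
  have "(\<lambda>m. L2_sq \<Omega> (?d m) + 2 * (L2_inner \<Omega> (f m) g - L2_sq \<Omega> g) + L2_sq \<Omega> g)
    \<longlonglongrightarrow> 0 + 2 * (L2_sq \<Omega> g - L2_sq \<Omega> g) + L2_sq \<Omega> g"
    using assms L2_tendsto_inner[OF assms L(2)] by (intro tendsto_intros) (auto simp: L2_tendsto_def)
  then show ?thesis unfolding eq by simp
qed

definition L2_orthonormal :: "'a::euclidean_space set \<Rightarrow> (nat \<Rightarrow> 'a \<Rightarrow> real) \<Rightarrow> nat set \<Rightarrow> bool" where
  "L2_orthonormal \<Omega> e J \<longleftrightarrow> (\<forall>i\<in>J. e i \<in> L2 \<Omega>) \<and>
     (\<forall>i\<in>J. \<forall>j\<in>J. L2_inner \<Omega> (e i) (e j) = (if i = j then 1 else 0))"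

text \<open>The squared distance from \<open>f\<close> to its orthogonal projection \<open>p\<close>
  is nonnegative, and it expands to the difference of the two sides.\<close>

lemma L2_Bessel:
  assumes e: "L2_orthonormal \<Omega> e J" and "finite J" and f: "f \<in> L2 \<Omega>"
  shows "(\<Sum>i\<in>J. (L2_inner \<Omega> (e i) f)\<^sup>2) \<le> L2_sq \<Omega> f"
proof -
  define c where "c = (\<lambda>i. L2_inner \<Omega> (e i) f)"
  have eL: "e i \<in> L2 \<Omega>" if "i \<in> J" for i using e that by (simp add: L2_orthonormal_def)
  define p where "p = (\<lambda>x. \<Sum>i\<in>J. c i * e i x)"
  have pL: "p \<in> L2 \<Omega>" unfolding p_def using \<open>finite J\<close> eL by (intro L2_sum L2_cmult)
  have in_p: "L2_inner \<Omega> p v = (\<Sum>i\<in>J. c i * L2_inner \<Omega> (e i) v)" if "v \<in> L2 \<Omega>" for v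
    unfolding p_def using \<open>finite J\<close> eL that by (subst L2_inner_sum_left) (auto intro: L2_cmult simp: L2_inner_cmult_left)
  have pf: "L2_inner \<Omega> p f = (\<Sum>i\<in>J. (c i)\<^sup>2)"
    using f by (simp add: in_p c_def power2_eq_square)
  have "L2_inner \<Omega> (e i) p = c i" if "i \<in> J" for i
  proof -
    have "L2_inner \<Omega> (e i) p = (\<Sum>j\<in>J. c j * L2_inner \<Omega> (e j) (e i))"
      using in_p[OF eL[OF that]] by (simp add: L2_inner_commute)
    also have "\<dots> = (\<Sum>j\<in>J. if j = i then c j else 0)"
      using e that by (intro sum.cong) (auto simp: L2_orthonormal_def)
    finally show ?thesis using \<open>finite J\<close> that by simp
  qed
  then have pp: "L2_sq \<Omega> p = (\<Sum>i\<in>J. (c i)\<^sup>2)"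
    using pL by (simp add: in_p power2_eq_square)
  have "0 \<le> L2_sq \<Omega> (\<lambda>x. f x - p x)" by (rule L2_inner_self_nonneg)
  also have "\<dots> = L2_sq \<Omega> f - 2 * L2_inner \<Omega> p f + L2_sq \<Omega> p"
    using f pL by (simp add: L2_inner_diff_left L2_inner_diff_right L2_diff L2_inner_commute[of _ p f])
  finally show ?thesis by (simp add: pp pf c_def)
qed

text \<open>The coefficients \<open>C\<close> express each vector in terms of the original ones, so that the
  next remainder cannot vanish.\<close>

lemma L2_Gram_Schmidt:
  assumes eL: "\<And>i. i < m \<Longrightarrow> e i \<in> L2 \<Omega>"
    and ind: "\<And>c::nat \<Rightarrow> real. (AE x in lebesgue_on \<Omega>. (\<Sum>i<m. c i * e i x) = 0) \<Longrightarrow> \<forall>i<m. c i = 0"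
  shows "\<exists>C. L2_orthonormal \<Omega> (\<lambda>i x. \<Sum>l<m. C i l * e l x) {..<m}"
proof -
  have "\<exists>C. (\<forall>i<k. \<forall>l. k \<le> l \<longrightarrow> C i l = 0) \<and> L2_orthonormal \<Omega> (\<lambda>i x. \<Sum>l<m. C i l * e l x) {..<k}"
    if "k \<le> m" for k
    using that
  proof (induction k)
    case 0
    then show ?case by (auto simp: L2_orthonormal_def)
  next
    case (Suc k)
    then obtain C where C0: "\<forall>i<k. \<forall>l. k \<le> l \<longrightarrow> C i l = 0"
      and on: "L2_orthonormal \<Omega> (\<lambda>i x. \<Sum>l<m. C i l * e l x) {..<k}"
      using Suc_leD by blast
    have C: "C i l = 0" if "i < k" "k \<le> l" for i l using C0 that by blast
    define f where "f = (\<lambda>i x. \<Sum>l<m. C i l * e l x)"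
    have km: "k < m" using Suc.prems by simp
    have fL: "f i \<in> L2 \<Omega>" for i
      unfolding f_def by (intro L2_sum L2_cmult) (auto intro: eL)
    have ff: "L2_inner \<Omega> (f i) (f j) = (if i = j then 1 else 0)" if "i < k" "j < k" for i j
      using on that by (auto simp: L2_orthonormal_def f_def)
    define d where "d = (\<lambda>i. L2_inner \<Omega> (e k) (f i))"
    define D where "D = (\<lambda>l. (if l = k then 1 else 0) - (\<Sum>i<k. d i * C i l))"
    define r where "r = (\<lambda>x. \<Sum>l<m. D l * e l x)"
    have rL: "r \<in> L2 \<Omega>" unfolding r_def by (intro L2_sum L2_cmult) (auto intro: eL)
    have r: "r = (\<lambda>x. e k x - (\<Sum>i<k. d i * f i x))"
    proof
      fix x
      have "r x = (\<Sum>l<m. (if l = k then e l x else 0)) - (\<Sum>l<m. \<Sum>i<k. d i * C i l * e l x)"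
        unfolding r_def D_def sum_subtractf[symmetric]
        by (rule sum.cong) (auto simp: left_diff_distrib sum_distrib_right)
      also have "(\<Sum>l<m. \<Sum>i<k. d i * C i l * e l x) = (\<Sum>i<k. d i * f i x)"
        unfolding f_def by (subst sum.swap) (simp add: sum_distrib_left mult.assoc)
      finally show "r x = e k x - (\<Sum>i<k. d i * f i x)" using km by simp
    qed
    have rf: "L2_inner \<Omega> r (f j) = 0" if "j < k" for j
    proof -
      have "L2_inner \<Omega> r (f j) = L2_inner \<Omega> (e k) (f j) - L2_inner \<Omega> (\<lambda>x. \<Sum>i<k. d i * f i x) (f j)"
        unfolding r using eL[OF km] fL by (intro L2_inner_diff_left L2_sum L2_cmult) auto
      also have "L2_inner \<Omega> (\<lambda>x. \<Sum>i<k. d i * f i x) (f j) = (\<Sum>i<k. d i * L2_inner \<Omega> (f i) (f j))"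
        using fL by (subst L2_inner_sum_left) (auto intro: L2_cmult simp: L2_inner_cmult_left)
      also have "\<dots> = (\<Sum>i<k. if i = j then d i else 0)"
        using that by (intro sum.cong) (auto simp: ff)
      finally show ?thesis using that by (simp add: d_def)
    qed
    have fr: "L2_inner \<Omega> (f j) r = 0" if "j < k" for j
      using rf[OF that] by (subst L2_inner_commute)
    \<comment> \<open>The earlier vectors do not involve \<open>e k\<close>, so \<open>e k\<close>
      keeps coefficient 1 in the remainder; a remainder vanishing almost everywhere would contradict
      the independence.\<close>
    have "D k = 1" using C by (simp add: D_def)
    then have "\<not> (AE x in lebesgue_on \<Omega>. r x = 0)"
      using ind[of D] km unfolding r_def by fastforce
    then have rr: "0 < L2_sq \<Omega> r"
      using L2_inner_self_eq_0[OF rL] L2_inner_self_nonneg[of \<Omega> r] by linarith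
    define s where "s = 1 / sqrt (L2_sq \<Omega> r)"
    define C' where "C' = (\<lambda>i l. if i = k then s * D l else C i l)"
    have f': "(\<lambda>i x. \<Sum>l<m. C' i l * e l x) = (\<lambda>i. if i = k then (\<lambda>x. s * r x) else f i)"
      by (auto simp: fun_eq_iff C'_def r_def f_def sum_distrib_left mult.assoc)
    have "L2_sq \<Omega> (\<lambda>x. s * r x) = 1"
      unfolding L2_inner_self_cmult using rr by (simp add: s_def power_divide)
    then have "L2_orthonormal \<Omega> (\<lambda>i x. \<Sum>l<m. C' i l * e l x) {..<Suc k}"
      unfolding f' L2_orthonormal_def
      using fL rL ff rf fr by (auto simp: L2_cmult L2_inner_cmult_left L2_inner_cmult_right less_Suc_eq)
    moreover have "\<forall>i<Suc k. \<forall>l. Suc k \<le> l \<longrightarrow> C' i l = 0"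
      using C by (auto simp: C'_def D_def less_Suc_eq)
    ultimately show ?case by blast
  qed
  then show ?thesis by blast
qed

section \<open>Integration by parts on the whole space\<close>

section \<open>Integration by parts\<close>

lemma integrable_lborel_compact_support:
  fixes f :: "'a::euclidean_space \<Rightarrow> 'b::{banach, second_countable_topology}"
  assumes "continuous_on UNIV f" "compact K" "\<And>x. x \<notin> K \<Longrightarrow> f x = 0"
  shows "integrable lborel f"
proof -
  have "integrable lborel (\<lambda>x. indicator K x *\<^sub>R f x)"
    using assms(2) continuous_on_subset[OF assms(1) subset_UNIV] by (rule borel_integrable_compact)
  moreover have "(\<lambda>x. indicator K x *\<^sub>R f x) = f"
    using assms(3) by (auto simp: fun_eq_iff indicator_def)
  ultimately show ?thesis by simp
qed

lemma bounded_compact_support: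
  fixes f :: "'a::euclidean_space \<Rightarrow> 'b::real_normed_vector"
  assumes "continuous_on UNIV f" "compact K" "\<And>x. x \<notin> K \<Longrightarrow> f x = 0"
  obtains B where "0 \<le> B" "\<And>x. norm (f x) \<le> B"
proof -
  have "bounded (f ` K)"
    using assms by (intro compact_imp_bounded compact_continuous_image) (auto intro: continuous_on_subset)
  then obtain B where B: "\<And>x. x \<in> K \<Longrightarrow> norm (f x) \<le> B" by (auto simp: bounded_iff)
  have "norm (f x) \<le> max B 0" for x
    using B[of x] assms(3)[of x] by (cases "x \<in> K") auto
  then show ?thesis by (intro that[of "max B 0"]) auto
qed

text \<open>Bridge between the completed measure on \<Omega>, in which the problem is stated, and
  \<open>lborel\<close>, on which translation, scaling and Fubini are applied.\<close>

lemma lebesgue_on_lborel: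
  fixes f :: "'a::euclidean_space \<Rightarrow> 'b::{banach, second_countable_topology}"
  assumes "\<Omega> \<in> sets borel" "f \<in> borel_measurable borel" "\<And>x. x \<notin> \<Omega> \<Longrightarrow> f x = 0"
  shows "integral\<^sup>L (lebesgue_on \<Omega>) f = integral\<^sup>L lborel f"
    and "integrable (lebesgue_on \<Omega>) f \<longleftrightarrow> integrable lborel f"
proof -
  have eq: "(\<lambda>x. indicator \<Omega> x *\<^sub>R f x) = f"
    using assms(3) by (auto simp: fun_eq_iff indicator_def)
  have \<Omega>: "\<Omega> \<inter> space lebesgue \<in> sets lebesgue" using assms(1) by simp
  show "integral\<^sup>L (lebesgue_on \<Omega>) f = integral\<^sup>L lborel f"
    unfolding integral_restrict_space[OF \<Omega>] eq using assms(2) by (simp add: integral_completion)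
  show "integrable (lebesgue_on \<Omega>) f \<longleftrightarrow> integrable lborel f"
    unfolding integrable_restrict_space[OF \<Omega>] eq using assms(2) by (simp add: integrable_completion)
qed

lemma lborel_integral_translate:
  fixes f :: "'a::euclidean_space \<Rightarrow> 'b::{banach, second_countable_topology}"
  assumes "f \<in> borel_measurable borel"
  shows "(LINT x|lborel. f (c + x)) = (LINT x|lborel. f x)"
    and "integrable lborel (\<lambda>x. f (c + x)) \<longleftrightarrow> integrable lborel f"
proof -
  have "integral\<^sup>L (distr lborel borel ((+) c)) f = (LINT x|lborel. f (c + x))"
    by (rule integral_distr) (use assms in auto)
  then show "(LINT x|lborel. f (c + x)) = (LINT x|lborel. f x)" by (simp add: lborel_distr_plus)
  have "integrable (distr lborel borel ((+) c)) f \<longleftrightarrow> integrable lborel (\<lambda>x. f (c + x))"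
    by (rule integrable_distr_eq) (use assms in auto)
  then show "integrable lborel (\<lambda>x. f (c + x)) \<longleftrightarrow> integrable lborel f" by (simp add: lborel_distr_plus)
qed

text \<open>By translation invariance all difference quotients have integral zero.\<close>

lemma integral_partial_eq_0:
  fixes f :: "'a::euclidean_space \<Rightarrow> real"
  assumes d: "\<And>x. f differentiable (at x)" and c: "continuous_on UNIV (partial b f)"
    and K: "compact K" "\<And>x. x \<notin> K \<Longrightarrow> f x = 0" "\<And>x. x \<notin> K \<Longrightarrow> partial b f x = 0"
  shows "(LINT x|lborel. partial b f x) = 0"
proof -
  have cf: "continuous_on UNIV f"
    by (meson continuous_at_imp_continuous_on differentiable_imp_continuous_within d)
  have [measurable]: "f \<in> borel_measurable borel" "partial b f \<in> borel_measurable borel"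
    using cf c by (auto intro: borel_measurable_continuous_onI)
  obtain B where B: "0 \<le> B" "\<And>x. norm (partial b f x) \<le> B"
    using bounded_compact_support[OF c K(1,3)] by blast
  have fint: "integrable lborel f" by (rule integrable_lborel_compact_support[OF cf K(1,2)])
  define t :: "nat \<Rightarrow> real" where "t = (\<lambda>m. inverse (real (Suc m)))"
  have t: "0 < t m" "t m \<le> 1" for m by (auto simp: t_def divide_simps)
  define q where "q = (\<lambda>m x. (f (t m *\<^sub>R b + x) - f x) / t m)"
  \<comment> \<open>The difference quotients with steps at most 1 all vanish off this enlargement of
    \<open>K\<close>, so a constant on \<open>K'\<close> dominates them integrably.\<close>
  define K' where "K' = (\<Union>x\<in>K. \<Union>y\<in>cball 0 (norm b). {x + y})"
  have K': "compact K'" unfolding K'_def by (rule compact_sums'[OF K(1)]) simp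
  have inK': "x \<in> K'" if "s *\<^sub>R b + x \<in> K" "0 \<le> s" "s \<le> 1" for s x
  proof -
    have "norm (- (s *\<^sub>R b)) \<le> norm b" using that by (simp add: mult_left_le_one_le)
    then have "- (s *\<^sub>R b) \<in> cball 0 (norm b)" by simp
    then have "(s *\<^sub>R b + x) + - (s *\<^sub>R b) \<in> K'" unfolding K'_def using that(1) by blast
    then show ?thesis by simp
  qed
  have q_bound: "norm (q m x) \<le> indicator K' x *\<^sub>R B" for m x
  proof (cases "x \<in> K'")
    case True
    have "\<exists>z. z > 0 \<and> z < t m \<and> f (x + t m *\<^sub>R b) - f (x + 0 *\<^sub>R b) = (t m - 0) * partial b f (x + z *\<^sub>R b)"
      by (rule MVT2[OF t(1)]) (rule has_real_derivative_partial[OF d])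
    then obtain z where "f (x + t m *\<^sub>R b) - f x = t m * partial b f (x + z *\<^sub>R b)" by auto
    then have "q m x = partial b f (x + z *\<^sub>R b)"
      using t[of m] by (simp add: q_def add.commute)
    then show ?thesis using True B by simp
  next
    case False
    then have "t m *\<^sub>R b + x \<notin> K" "x \<notin> K"
      using inK'[of "t m" x] inK'[of 0 x] t[of m] by auto
    then show ?thesis using False by (simp add: q_def K)
  qed
  have "(\<lambda>m. LINT x|lborel. q m x) \<longlonglongrightarrow> (LINT x|lborel. partial b f x)"
  proof (rule integral_dominated_convergence)
    show "integrable lborel (\<lambda>x. indicator K' x *\<^sub>R B)"
      using K' by (intro borel_integrable_compact) auto
    show "AE x in lborel. (\<lambda>m. q m x) \<longlonglongrightarrow> partial b f x"
    proof (rule AE_I2)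
      fix x
      have "((\<lambda>s. f (x + s *\<^sub>R b)) has_real_derivative partial b f x) (at 0)"
        using has_real_derivative_partial[of f x 0 b] d by simp
      then have "((\<lambda>h. (f (x + h *\<^sub>R b) - f x) / h) \<longlongrightarrow> partial b f x) (at 0)"
        by (simp add: DERIV_def)
      moreover have "filterlim t (at 0) sequentially"
        using LIMSEQ_inverse_real_of_nat t(1) unfolding filterlim_at t_def
        by (auto intro!: always_eventually)
      ultimately have "(\<lambda>m. (f (x + t m *\<^sub>R b) - f x) / t m) \<longlonglongrightarrow> partial b f x"
        by (rule filterlim_compose)
      then show "(\<lambda>m. q m x) \<longlonglongrightarrow> partial b f x" by (simp add: q_def add.commute)
    qed
    show "AE x in lborel. norm (q m x) \<le> indicator K' x *\<^sub>R B" for m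
      using q_bound by simp
  qed (auto simp: q_def)
  moreover have "(LINT x|lborel. q m x) = 0" for m
    using fint by (simp add: q_def lborel_integral_translate)
  ultimately show ?thesis by (simp add: LIMSEQ_const_iff)
qed

text \<open>The derivative of the product \<open>\<phi> * \<psi>\<close> integrates to zero. Compact
  support is asked of only one factor, so that \<open>\<psi>\<close> may be a cosine or a
  sine.\<close>

lemma integration_by_parts_test:
  fixes \<phi> \<psi> :: "'a::euclidean_space \<Rightarrow> real"
  assumes \<phi>: "\<phi> \<in> test_functions \<Omega>" and "b \<in> Basis"
    and \<psi>: "\<And>x. \<psi> differentiable (at x)" "continuous_on UNIV (partial b \<psi>)"
  shows "(LINT x|lborel. partial b \<phi> x * \<psi> x) = - (LINT x|lborel. \<phi> x * partial b \<psi> x)"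
proof -
  obtain K where K: "smooth \<phi>" "compact K" "K \<subseteq> \<Omega>" "\<And>x. x \<notin> K \<Longrightarrow> \<phi> x = 0"
      "\<And>x b. x \<notin> K \<Longrightarrow> partial b \<phi> x = 0"
    using test_functionsE[OF \<phi>] by metis
  have c: "continuous_on UNIV \<psi>"
    by (meson continuous_at_imp_continuous_on differentiable_imp_continuous_within \<psi>(1))
  have c\<phi>: "continuous_on UNIV \<phi>" "continuous_on UNIV (partial b \<phi>)"
    using K(1) \<open>b \<in> Basis\<close> by (auto intro: smooth_continuous smooth_partial)
  have p: "partial b (\<lambda>x. \<phi> x * \<psi> x) = (\<lambda>x. \<phi> x * partial b \<psi> x + partial b \<phi> x * \<psi> x)"
    using K(1) \<psi> by (intro ext partial_mult) (auto intro: smooth_differentiable)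
  have "(LINT x|lborel. partial b (\<lambda>x. \<phi> x * \<psi> x) x) = 0"
  proof (rule integral_partial_eq_0)
    show "(\<lambda>x. \<phi> x * \<psi> x) differentiable at x" for x
      using K(1) \<psi> by (intro differentiable_mult) (auto intro: smooth_differentiable)
    show "continuous_on UNIV (partial b (\<lambda>x. \<phi> x * \<psi> x))"
      unfolding p using c c\<phi> \<psi>(2) by (intro continuous_intros)
    show "compact K" by fact
    show "\<phi> x * \<psi> x = 0" "partial b (\<lambda>x. \<phi> x * \<psi> x) x = 0" if "x \<notin> K" for x
      using that by (auto simp: p K)
  qed
  moreover have "integrable lborel (\<lambda>x. \<phi> x * partial b \<psi> x)"
    by (rule integrable_lborel_compact_support[OF _ K(2)])
      (use c\<phi> \<psi>(2) K in \<open>auto intro!: continuous_intros\<close>)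
  moreover have "integrable lborel (\<lambda>x. partial b \<phi> x * \<psi> x)"
    by (rule integrable_lborel_compact_support[OF _ K(2)])
      (use c\<phi> c K in \<open>auto intro!: continuous_intros\<close>)
  ultimately show ?thesis by (simp add: p)
qed

section \<open>Indicators as limits of test functions; the fundamental lemma of the calculus of
  variations\<close>

section \<open>Density of the test functions\<close>

lemma test_functions_borel: "\<phi> \<in> test_functions \<Omega> \<Longrightarrow> \<phi> \<in> borel_measurable borel"
  by (auto simp: test_functions_def intro: borel_measurable_continuous_onI smooth_continuous)

lemma test_functions_outside: "\<phi> \<in> test_functions \<Omega> \<Longrightarrow> x \<notin> \<Omega> \<Longrightarrow> \<phi> x = 0"
  using closure_subset[of "{x. \<phi> x \<noteq> 0}"] by (auto simp: test_functions_def)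

lemma test_functions_L2:
  fixes \<Omega> :: "'a::euclidean_space set"
  assumes "\<Omega> \<in> sets borel" "\<phi> \<in> test_functions \<Omega>" shows "\<phi> \<in> L2 \<Omega>"
proof -
  obtain K where K: "smooth \<phi>" "compact K" "\<And>x. x \<notin> K \<Longrightarrow> \<phi> x = 0"
    using test_functionsE[OF assms(2)] by metis
  have "integrable lborel (\<lambda>x. (\<phi> x)\<^sup>2)"
    by (rule integrable_lborel_compact_support[OF _ K(2)])
      (use K smooth_continuous[OF K(1)] in \<open>auto intro!: continuous_on_power\<close>)
  moreover have "\<phi> \<in> borel_measurable (lebesgue_on \<Omega>)"
    using test_functions_borel[OF assms(2)]
    by (intro measurable_restrict_space1 measurable_completion) simp
  ultimately show ?thesis
    using assms test_functions_borel[OF assms(2)] test_functions_outside[OF assms(2)]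
    by (auto simp: L2_def lebesgue_on_lborel)
qed

text \<open>By Lindelof, \<open>U\<close> is a countable union of boxes with closures inside
  \<open>U\<close>, each carrying a bump \<open>f i\<close>. If \<open>f j\<close> is positive at a
  point, the factor \<open>(1 - f j x) ^ N\<close> tends to 0 and forces the whole product to 0; off
  \<open>U\<close> all factors are 1. Raising to the power \<open>N\<close> lets the same index
  control the number of boxes and the rate.\<close>

lemma open_bump_sequence:
  fixes U :: "'a::euclidean_space set"
  assumes "open U"
  obtains \<Psi> where "\<And>N. \<Psi> N \<in> test_functions U" "\<And>N x. 0 \<le> \<Psi> N x \<and> \<Psi> N x \<le> 1"
    "\<And>x. (\<lambda>N. \<Psi> N x) \<longlonglongrightarrow> indicator U x"
proof -
  define F where "F = {box a b | a b. cbox a b \<subseteq> U}"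
  have UF: "\<Union>F = U"
  proof
    show "\<Union>F \<subseteq> U" using box_subset_cbox by (force simp: F_def)
    show "U \<subseteq> \<Union>F"
    proof
      fix x assume "x \<in> U"
      then obtain a b where "cbox a b \<subseteq> U" "x \<in> box a b" using open_contains_cbox[OF assms] by metis
      then show "x \<in> \<Union>F" by (auto simp: F_def)
    qed
  qed
  obtain F' where F': "F' \<subseteq> F" "countable F'" "\<Union>F' = \<Union>F"
    by (rule Lindelof[of F]) (auto simp: F_def)
  \<comment> \<open>The added empty set keeps the family nonempty, so that it can be enumerated even
    when \<open>U\<close> is empty.\<close>
  define S where "S = from_nat_into (insert {} F')"
  have S: "range S = insert {} F'"
    unfolding S_def by (rule range_from_nat_into) (use F'(2) in simp_all)
  have SU: "(\<Union>i. S i) = U" using S F' UF by auto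
  have "\<exists>f K. f \<in> bump_algebra \<and> compact K \<and> K \<subseteq> U \<and> (\<forall>x\<in>S i. 0 < f x \<and> f x \<le> 1) \<and>
      (\<forall>x. x \<notin> S i \<longrightarrow> f x = 0) \<and> S i \<subseteq> K" for i
  proof (cases "S i = {}")
    case True
    then show ?thesis by (intro exI[of _ "\<lambda>x. 0"] exI[of _ "{}"]) (auto intro: bump_algebra.const)
  next
    case False
    then have "S i \<in> F" using S F'(1) by blast
    then obtain a b where ab: "S i = box a b" "cbox a b \<subseteq> U" by (auto simp: F_def)
    obtain f where "f \<in> bump_algebra" "\<And>x. x \<in> box a b \<Longrightarrow> 0 < f x \<and> f x \<le> 1" "\<And>x. x \<notin> box a b \<Longrightarrow> f x = 0"
      using box_bump[of a b] by metis
    with ab show ?thesis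
      by (intro exI[of _ f] exI[of _ "cbox a b"]) (auto simp: box_subset_cbox)
  qed
  then obtain f K where f: "\<And>i. f i \<in> bump_algebra" and K: "\<And>i. compact (K i)" "\<And>i. K i \<subseteq> U"
    and fp: "\<And>i x. x \<in> S i \<Longrightarrow> 0 < f i x \<and> f i x \<le> 1" and f0: "\<And>i x. x \<notin> S i \<Longrightarrow> f i x = 0"
    and SK: "\<And>i. S i \<subseteq> K i"
    by metis
  have f01: "0 \<le> f i x \<and> f i x \<le> 1" for i x
    using fp[of x i] f0[of x i] by (cases "x \<in> S i") auto
  define \<Psi> where "\<Psi> = (\<lambda>N x. 1 - (\<Prod>i<N. (1 - f i x) ^ N))"
  have P01: "0 \<le> (\<Prod>i<N. (1 - f i x) ^ N)" "(\<Prod>i<N. (1 - f i x) ^ N) \<le> 1" for N x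
    using f01 by (auto intro!: prod_nonneg prod_le_1 power_le_one)
  show ?thesis
  proof
    show "\<Psi> N \<in> test_functions U" for N
    proof (rule test_functionsI)
      show "smooth (\<Psi> N)" unfolding \<Psi>_def
        by (intro bump_algebra_smooth bump_algebra_one_minus bump_algebra_prod bump_algebra_power f) auto
      show "compact (\<Union>i<N. K i)" "(\<Union>i<N. K i) \<subseteq> U" using K by auto
      fix x assume "x \<notin> (\<Union>i<N. K i)"
      then have "f i x = 0" if "i < N" for i using that SK f0 by blast
      then show "\<Psi> N x = 0" by (simp add: \<Psi>_def)
    qed
    show "0 \<le> \<Psi> N x \<and> \<Psi> N x \<le> 1" for N x using P01 by (simp add: \<Psi>_def)
    show "(\<lambda>N. \<Psi> N x) \<longlonglongrightarrow> indicator U x" for x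
    proof (cases "x \<in> U")
      case False
      then have "f i x = 0" for i using f0[of x i] SU by blast
      then show ?thesis using False by (simp add: \<Psi>_def)
    next
      case True
      then obtain j where j: "x \<in> S j" using SU by blast
      have lim: "(\<lambda>N. (1 - f j x) ^ N) \<longlonglongrightarrow> 0"
        using fp[OF j] by (intro LIMSEQ_realpow_zero) auto
      have ub: "\<forall>\<^sub>F N in sequentially. (\<Prod>i<N. (1 - f i x) ^ N) \<le> (1 - f j x) ^ N"
        using eventually_gt_at_top[of j]
      proof eventually_elim
        case (elim N)
        have "(\<Prod>i<N. (1 - f i x) ^ N) = (1 - f j x) ^ N * (\<Prod>i\<in>{..<N} - {j}. (1 - f i x) ^ N)"
          using elim by (intro prod.remove) auto
        also have "\<dots> \<le> (1 - f j x) ^ N * 1"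
          using f01 by (intro mult_left_mono prod_le_1) (auto intro!: power_le_one)
        finally show ?case by simp
      qed
      have "(\<lambda>N. \<Prod>i<N. (1 - f i x) ^ N) \<longlonglongrightarrow> 0"
        by (rule tendsto_sandwich[OF _ ub tendsto_const lim]) (intro always_eventually allI P01)
      then have "(\<lambda>N. \<Psi> N x) \<longlonglongrightarrow> 1 - 0" unfolding \<Psi>_def by (intro tendsto_intros)
      then show ?thesis using True by simp
    qed
  qed
qed

text \<open>Dominated convergence carries the vanishing integrals from test functions to indicators
  of open sets, and then to decreasing intersections of open sets. Every measurable set is such an
  intersection up to a null set, so \<open>g\<close> has integral zero over all measurable
  sets.\<close>

lemma AE_eq_0_if_test_integrals_0:
  fixes g :: "'a::euclidean_space \<Rightarrow> real"
  assumes "open \<Omega>" and g: "integrable (lebesgue_on \<Omega>) g"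
    and 0: "\<And>\<psi>. \<psi> \<in> test_functions \<Omega> \<Longrightarrow> L2_inner \<Omega> g \<psi> = 0"
  shows "AE x in lebesgue_on \<Omega>. g x = 0"
proof -
  let ?M = "lebesgue_on \<Omega>"
  have gm: "g \<in> borel_measurable ?M" using g by (rule borel_measurable_integrable)
  have \<Omega>: "\<Omega> \<in> sets lebesgue" "\<Omega> \<in> sets borel" using \<open>open \<Omega>\<close> by auto
  define J where "J = (\<lambda>A. LINT x|?M. indicator A x * g x)"
  have ind_meas: "(indicator A :: 'a \<Rightarrow> real) \<in> borel_measurable ?M" if "A \<in> sets borel" for A
    using that by (intro measurable_restrict_space1 measurable_completion) auto
  have J_open: "J U = 0" if "open U" for U
  proof -
    obtain \<Psi> where \<Psi>: "\<And>N. \<Psi> N \<in> test_functions (U \<inter> \<Omega>)" "\<And>N x. 0 \<le> \<Psi> N x \<and> \<Psi> N x \<le> 1"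
      "\<And>x. (\<lambda>N. \<Psi> N x) \<longlonglongrightarrow> indicator (U \<inter> \<Omega>) x"
      using open_bump_sequence[of "U \<inter> \<Omega>"] open_Int[OF \<open>open U\<close> \<open>open \<Omega>\<close>] by blast
    have \<Psi>t: "\<Psi> N \<in> test_functions \<Omega>" for N using \<Psi>(1)[of N] unfolding test_functions_def by blast
    have "(\<lambda>N. LINT x|?M. g x * \<Psi> N x) \<longlonglongrightarrow> (LINT x|?M. indicator U x * g x)"
    proof (rule integral_dominated_convergence)
      show "integrable ?M (\<lambda>x. norm (g x))" using g by simp
      show "AE x in ?M. (\<lambda>N. g x * \<Psi> N x) \<longlonglongrightarrow> indicator U x * g x"
      proof (rule AE_I2)
        fix x assume "x \<in> space ?M"
        then have "x \<in> \<Omega>" by (simp add: space_restrict_space)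
        then have "(indicator (U \<inter> \<Omega>) x :: real) = indicator U x" by (simp add: indicator_def)
        then have "(\<lambda>N. \<Psi> N x) \<longlonglongrightarrow> indicator U x" using \<Psi>(3)[of x] by simp
        then show "(\<lambda>N. g x * \<Psi> N x) \<longlonglongrightarrow> indicator U x * g x"
          by (subst mult.commute) (intro tendsto_intros)
      qed
      show "AE x in ?M. norm (g x * \<Psi> N x) \<le> norm (g x)" for N
        using \<Psi>(2) by (auto simp: abs_mult intro!: mult_left_le)
      show "(\<lambda>x. indicator U x * g x) \<in> borel_measurable ?M"
        using that by (intro borel_measurable_times ind_meas gm) auto
      show "(\<lambda>x. g x * \<Psi> N x) \<in> borel_measurable ?M" for N
        by (intro borel_measurable_times L2_measurable[OF test_functions_L2[OF \<Omega>(2) \<Psi>t]] gm)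
    qed
    moreover have "(LINT x|?M. g x * \<Psi> N x) = 0" for N
      using 0[OF \<Psi>t] by (simp add: L2_inner_def)
    ultimately show ?thesis by (simp add: J_def LIMSEQ_const_iff)
  qed
  show ?thesis
  proof (rule density_unique_real[OF g])
    fix A assume A: "A \<in> sets ?M"
    then have "A \<in> sets lebesgue" using \<Omega> by (auto simp: sets_restrict_space_iff)
    \<comment> \<open>\<open>A\<close> and the G-delta set \<open>C\<close> differ only by the null
      set \<open>T\<close>, so the integrals of \<open>g\<close> over them agree.\<close>
    then obtain C T where C: "gdelta C" and T: "T \<in> null_sets lebesgue" "A \<union> T = C" "disjnt A T"
      by (rule lebesgue_set_almost_gdelta)
    from C obtain U :: "nat \<Rightarrow> 'a set" where U: "\<And>i. open (U i)" "C = (\<Inter>i. U i)"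
      by (auto elim!: gdelta.cases)
    have Cb: "C \<in> sets borel" using U by auto
    have "(\<lambda>N. J (\<Inter>i\<le>N. U i)) \<longlonglongrightarrow> J C"
      unfolding J_def
    proof (rule integral_dominated_convergence)
      show "integrable ?M (\<lambda>x. norm (g x))" using g by simp
      show "AE x in ?M. (\<lambda>N. indicator (\<Inter>i\<le>N. U i) x * g x) \<longlonglongrightarrow> indicator C x * g x"
      proof (intro AE_I2 tendsto_intros)
        show "(\<lambda>N. indicator (\<Inter>i\<le>N. U i) x :: real) \<longlonglongrightarrow> indicator C x" for x
        proof (cases "x \<in> C")
          case True
          then show ?thesis using U(2) by (simp add: indicator_def)
        next
          case False
          then obtain j where j: "x \<notin> U j" using U(2) by blast
          have "\<forall>\<^sub>F N in sequentially. indicator (\<Inter>i\<le>N. U i) x = (0 :: real)"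
            using eventually_ge_at_top[of j] by eventually_elim (use j in \<open>auto simp: indicator_def\<close>)
          then show ?thesis using False by (simp add: tendsto_eventually)
        qed
      qed
      show "AE x in ?M. norm (indicator (\<Inter>i\<le>N. U i) x * g x) \<le> norm (g x)" for N
        by (intro AE_I2) (simp add: indicator_def)
      show "(\<lambda>x. indicator (\<Inter>i\<le>N. U i) x * g x) \<in> borel_measurable ?M" for N
        using U(1) by (intro borel_measurable_times ind_meas gm) auto
      show "(\<lambda>x. indicator C x * g x) \<in> borel_measurable ?M"
        by (intro borel_measurable_times ind_meas gm Cb)
    qed
    moreover have "J (\<Inter>i\<le>N. U i) = 0" for N using U(1) by (intro J_open open_INT) auto
    ultimately have JC: "J C = 0" by (simp add: LIMSEQ_const_iff)
    have "AE x in lebesgue. x \<notin> T" using T(1) by (rule AE_not_in)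
    then have ae: "AE x in ?M. x \<notin> T"
      using \<Omega>(1) by (auto simp: AE_restrict_space_iff elim!: eventually_mono)
    have "(\<integral>x\<in>A. g x \<partial>?M) = J C"
      unfolding set_lebesgue_integral_def J_def real_scaleR_def
    proof (rule integral_cong_AE)
      show "(\<lambda>x. indicator A x * g x) \<in> borel_measurable ?M"
        by (intro borel_measurable_times borel_measurable_indicator gm A)
      show "(\<lambda>x. indicator C x * g x) \<in> borel_measurable ?M"
        by (intro borel_measurable_times ind_meas gm Cb)
      show "AE x in ?M. indicator A x * g x = indicator C x * g x"
        using ae by eventually_elim (use T(2) in \<open>auto simp: indicator_def\<close>)
    qed
    then show "(\<integral>x\<in>A. g x \<partial>?M) = (\<integral>x\<in>A. 0 \<partial>?M)"
      using JC by (simp add: set_lebesgue_integral_def)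
  qed simp
qed

section \<open>Calculus of weak derivatives: uniqueness, agreement with classical ones,
  closedness\<close>

section \<open>Weak derivatives\<close>

locale bounded_open =
  fixes \<Omega> :: "'a::euclidean_space set"
  assumes open_\<Omega>: "open \<Omega>" and bounded_\<Omega>: "bounded \<Omega>"
begin

lemma \<Omega>_borel: "\<Omega> \<in> sets borel"
  using open_\<Omega> by simp

lemma finite_measure_\<Omega>: "finite_measure (lebesgue_on \<Omega>)"
proof
  have "emeasure lebesgue \<Omega> < \<infinity>"
    using emeasure_bounded_finite[OF bounded_\<Omega>] by (simp add: \<Omega>_borel)
  then show "emeasure (lebesgue_on \<Omega>) (space (lebesgue_on \<Omega>)) \<noteq> \<infinity>"
    using \<Omega>_borel by (simp add: emeasure_restrict_space space_restrict_space)
qed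

lemma L2_bounded:
  assumes "f \<in> borel_measurable (lebesgue_on \<Omega>)" "\<And>x. x \<in> \<Omega> \<Longrightarrow> \<bar>f x\<bar> \<le> B"
  shows "f \<in> L2 \<Omega>"
proof -
  interpret finite_measure "lebesgue_on \<Omega>" by (rule finite_measure_\<Omega>)
  have "integrable (lebesgue_on \<Omega>) (\<lambda>x. (f x)\<^sup>2)"
  proof (rule integrable_const_bound)
    show "AE x in lebesgue_on \<Omega>. norm ((f x)\<^sup>2) \<le> B\<^sup>2"
    proof (rule AE_I2)
      fix x assume "x \<in> space (lebesgue_on \<Omega>)"
      then have "\<bar>f x\<bar> \<le> B" using assms(2) by (simp add: space_restrict_space)
      then have "\<bar>f x\<bar>\<^sup>2 \<le> B\<^sup>2" by (intro power_mono) auto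
      then show "norm ((f x)\<^sup>2) \<le> B\<^sup>2" by simp
    qed
    show "(\<lambda>x. (f x)\<^sup>2) \<in> borel_measurable (lebesgue_on \<Omega>)"
      by (intro borel_measurable_power assms)
  qed
  with assms(1) show ?thesis by (simp add: L2_def)
qed

lemma L2_integrable:
  assumes "f \<in> L2 \<Omega>" shows "integrable (lebesgue_on \<Omega>) f"
proof -
  have "(\<lambda>x. 1) \<in> L2 \<Omega>" by (rule L2_bounded[of _ 1]) auto
  from L2_mult_integrable[OF assms this] show ?thesis by simp
qed

lemma test_L2: "\<phi> \<in> test_functions \<Omega> \<Longrightarrow> \<phi> \<in> L2 \<Omega>"
  by (rule test_functions_L2[OF \<Omega>_borel])

lemma weak_partial_unique:
  assumes "is_weak_partial \<Omega> b u g" "is_weak_partial \<Omega> b u g'"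
  shows "AE x in lebesgue_on \<Omega>. g x = g' x"
proof -
  have L: "g \<in> L2 \<Omega>" "g' \<in> L2 \<Omega>" using assms by (auto simp: is_weak_partial_def)
  have "AE x in lebesgue_on \<Omega>. g x - g' x = 0"
  proof (rule AE_eq_0_if_test_integrals_0[OF open_\<Omega>])
    show "integrable (lebesgue_on \<Omega>) (\<lambda>x. g x - g' x)" using L by (intro L2_integrable L2_diff)
    fix \<psi> assume "\<psi> \<in> test_functions \<Omega>"
    then show "L2_inner \<Omega> (\<lambda>x. g x - g' x) \<psi> = 0"
      using assms L by (simp add: L2_inner_diff_left test_L2 is_weak_partial_def)
  qed
  then show ?thesis by simp
qed

lemma is_weak_partial_weak_partial: "is_weak_partial \<Omega> b u g \<Longrightarrow> is_weak_partial \<Omega> b u (weak_partial \<Omega> b u)"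
  unfolding weak_partial_def by (rule someI[where P = "is_weak_partial \<Omega> b u"])

lemma weak_partial_eq_AE:
  "is_weak_partial \<Omega> b u g \<Longrightarrow> AE x in lebesgue_on \<Omega>. weak_partial \<Omega> b u x = g x"
  using weak_partial_unique is_weak_partial_weak_partial by blast

text \<open>Second weak derivatives are formed from the chosen representative
  \<open>weak_partial \<Omega> b u\<close>; this lemma allows any other representative of the first
  derivative to be differentiated instead.\<close>

lemma is_weak_partial_cong_AE:
  assumes "is_weak_partial \<Omega> b u g" "AE x in lebesgue_on \<Omega>. u' x = u x" "u \<in> L2 \<Omega>" "u' \<in> L2 \<Omega>" "b \<in> Basis"
  shows "is_weak_partial \<Omega> b u' g"
  unfolding is_weak_partial_def
proof (intro conjI ballI)
  show "g \<in> L2 \<Omega>" using assms by (simp add: is_weak_partial_def)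
  fix \<psi> assume \<psi>: "\<psi> \<in> test_functions \<Omega>"
  have "L2_inner \<Omega> u' (partial b \<psi>) = L2_inner \<Omega> u (partial b \<psi>)"
    by (rule L2_inner_cong_AE) (use assms(2-5) \<psi> in \<open>auto intro: test_L2 test_functions_partial\<close>)
  then show "L2_inner \<Omega> u' (partial b \<psi>) = - L2_inner \<Omega> g \<psi>"
    using assms(1) \<psi> by (simp add: is_weak_partial_def)
qed

lemma is_weak_partial_test:
  assumes "\<phi> \<in> test_functions \<Omega>" "b \<in> Basis"
  shows "is_weak_partial \<Omega> b \<phi> (partial b \<phi>)"
  unfolding is_weak_partial_def
proof (intro conjI ballI)
  show "partial b \<phi> \<in> L2 \<Omega>" using assms by (intro test_L2 test_functions_partial)
  fix \<psi> assume \<psi>: "\<psi> \<in> test_functions \<Omega>"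
  then have sm: "smooth \<psi>" by (simp add: test_functions_def)
  have "L2_inner \<Omega> (partial b \<phi>) \<psi> = (LINT x|lborel. partial b \<phi> x * \<psi> x)"
    unfolding L2_inner_def using \<psi> test_functions_partial[OF assms] test_functions_borel
    by (intro lebesgue_on_lborel \<Omega>_borel borel_measurable_times) (auto simp: test_functions_outside)
  also have "\<dots> = - (LINT x|lborel. \<phi> x * partial b \<psi> x)"
    using sm assms by (intro integration_by_parts_test)
      (auto intro: smooth_differentiable smooth_continuous smooth_partial)
  also have "(LINT x|lborel. \<phi> x * partial b \<psi> x) = L2_inner \<Omega> \<phi> (partial b \<psi>)"
    unfolding L2_inner_def using assms(1) test_functions_partial[OF \<psi> assms(2)] test_functions_borel
    by (intro lebesgue_on_lborel[symmetric] \<Omega>_borel borel_measurable_times) (auto simp: test_functions_outside)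
  finally show "L2_inner \<Omega> \<phi> (partial b \<psi>) = - L2_inner \<Omega> (partial b \<phi>) \<psi>" by simp
qed

lemma is_weak_partial_diff:
  assumes "is_weak_partial \<Omega> b u g" "is_weak_partial \<Omega> b v h" "u \<in> L2 \<Omega>" "v \<in> L2 \<Omega>" "b \<in> Basis"
  shows "is_weak_partial \<Omega> b (\<lambda>x. u x - v x) (\<lambda>x. g x - h x)"
  using assms unfolding is_weak_partial_def
  by (auto intro: L2_diff simp: L2_inner_diff_left test_L2 test_functions_partial)

text \<open>The defining identity pairs \<open>u\<close> and \<open>g\<close> with fixed functions
  in \<open>L2\<close>, so both sides are continuous: weak differentiation is a closed
  operator.\<close>

lemma is_weak_partial_limit:
  assumes "\<And>m. is_weak_partial \<Omega> b (u m) (g m)" "L2_tendsto \<Omega> u u'" "L2_tendsto \<Omega> g g'" "b \<in> Basis"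
  shows "is_weak_partial \<Omega> b u' g'"
  unfolding is_weak_partial_def
proof (intro conjI ballI)
  show "g' \<in> L2 \<Omega>" using assms by (simp add: L2_tendsto_def)
  fix \<psi> assume \<psi>: "\<psi> \<in> test_functions \<Omega>"
  have "(\<lambda>m. L2_inner \<Omega> (u m) (partial b \<psi>)) \<longlonglongrightarrow> L2_inner \<Omega> u' (partial b \<psi>)"
    using \<psi> assms by (intro L2_tendsto_inner test_L2 test_functions_partial)
  moreover have "(\<lambda>m. - L2_inner \<Omega> (g m) \<psi>) \<longlonglongrightarrow> - L2_inner \<Omega> g' \<psi>"
    using \<psi> assms by (intro tendsto_minus L2_tendsto_inner test_L2)
  moreover have "L2_inner \<Omega> (u m) (partial b \<psi>) = - L2_inner \<Omega> (g m) \<psi>" for m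
    using assms(1)[of m] \<psi> by (simp add: is_weak_partial_def)
  ultimately show "L2_inner \<Omega> u' (partial b \<psi>) = - L2_inner \<Omega> g' \<psi>"
    using LIMSEQ_unique by force
qed

section \<open>The space \<open>H2_0\<close> in terms of approximating sequences\<close>

section \<open>Functions with vanishing boundary data\<close>

lemma H2I:
  assumes u: "u \<in> L2 \<Omega>" and g: "\<And>b. b \<in> Basis \<Longrightarrow> is_weak_partial \<Omega> b u (g b)"
    and h: "\<And>b c. b \<in> Basis \<Longrightarrow> c \<in> Basis \<Longrightarrow> is_weak_partial \<Omega> c (g b) (h b c)"
  shows "u \<in> H2 \<Omega>"
    and "b \<in> Basis \<Longrightarrow> AE x in lebesgue_on \<Omega>. weak_partial \<Omega> b u x = g b x"
    and "b \<in> Basis \<Longrightarrow> c \<in> Basis \<Longrightarrow> AE x in lebesgue_on \<Omega>. weak_partial \<Omega> c (weak_partial \<Omega> b u) x = h b c x"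
    and "b \<in> Basis \<Longrightarrow> weak_partial \<Omega> b u \<in> L2 \<Omega>"
    and "b \<in> Basis \<Longrightarrow> c \<in> Basis \<Longrightarrow> weak_partial \<Omega> c (weak_partial \<Omega> b u) \<in> L2 \<Omega>"
proof -
  show ae: "AE x in lebesgue_on \<Omega>. weak_partial \<Omega> b u x = g b x" if "b \<in> Basis" for b
    using g that weak_partial_eq_AE by blast
  show L: "weak_partial \<Omega> b u \<in> L2 \<Omega>" if "b \<in> Basis" for b
    using is_weak_partial_weak_partial[OF g[OF that]] by (simp add: is_weak_partial_def)
  have wh: "is_weak_partial \<Omega> c (weak_partial \<Omega> b u) (h b c)" if "b \<in> Basis" "c \<in> Basis" for b c
  proof (rule is_weak_partial_cong_AE[OF h[OF that]])
    show "g b \<in> L2 \<Omega>" using g[OF that(1)] by (simp add: is_weak_partial_def)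
  qed (use that ae L in auto)
  show "AE x in lebesgue_on \<Omega>. weak_partial \<Omega> c (weak_partial \<Omega> b u) x = h b c x"
    if "b \<in> Basis" "c \<in> Basis" for b c
    using wh[OF that] by (rule weak_partial_eq_AE)
  show "weak_partial \<Omega> c (weak_partial \<Omega> b u) \<in> L2 \<Omega>" if "b \<in> Basis" "c \<in> Basis" for b c
    using is_weak_partial_weak_partial[OF wh[OF that]] by (simp add: is_weak_partial_def)
  show "u \<in> H2 \<Omega>" unfolding H2_def using u g wh by blast
qed

lemma H2D:
  assumes "u \<in> H2 \<Omega>"
  shows "u \<in> L2 \<Omega>" "b \<in> Basis \<Longrightarrow> is_weak_partial \<Omega> b u (weak_partial \<Omega> b u)"
    "b \<in> Basis \<Longrightarrow> c \<in> Basis \<Longrightarrow>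
     is_weak_partial \<Omega> c (weak_partial \<Omega> b u) (weak_partial \<Omega> c (weak_partial \<Omega> b u))"
  using assms is_weak_partial_weak_partial unfolding H2_def by blast+

text \<open>\<open>H2_norm\<close> contains the derivatives chosen for the difference. They agree
  almost everywhere with differences of known derivatives, so the norm can be read off from the
  classical derivatives of \<open>\<phi>\<close>.\<close>

lemma H2_norm_test_diff:
  assumes \<phi>: "\<phi> \<in> test_functions \<Omega>" and u: "u \<in> L2 \<Omega>"
    and g: "\<And>b. b \<in> Basis \<Longrightarrow> is_weak_partial \<Omega> b u (g b)"
    and h: "\<And>b c. b \<in> Basis \<Longrightarrow> c \<in> Basis \<Longrightarrow> is_weak_partial \<Omega> c (g b) (h b c)"
  shows "H2_norm \<Omega> (\<lambda>x. \<phi> x - u x) = sqrt (L2_sq \<Omega> (\<lambda>x. \<phi> x - u x)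
     + (\<Sum>b\<in>Basis. L2_sq \<Omega> (\<lambda>x. partial b \<phi> x - g b x))
     + (\<Sum>b\<in>Basis. \<Sum>c\<in>Basis. L2_sq \<Omega> (\<lambda>x. partial c (partial b \<phi>) x - h b c x)))"
proof -
  let ?d = "\<lambda>x. \<phi> x - u x"
  have gL: "g b \<in> L2 \<Omega>" if "b \<in> Basis" for b using g[OF that] by (simp add: is_weak_partial_def)
  have hL: "h b c \<in> L2 \<Omega>" if "b \<in> Basis" "c \<in> Basis" for b c
    using h[OF that] by (simp add: is_weak_partial_def)
  have \<phi>L: "\<phi> \<in> L2 \<Omega>" "b \<in> Basis \<Longrightarrow> partial b \<phi> \<in> L2 \<Omega>"
    "b \<in> Basis \<Longrightarrow> c \<in> Basis \<Longrightarrow> partial c (partial b \<phi>) \<in> L2 \<Omega>" for b c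
    using \<phi> by (auto intro: test_L2 test_functions_partial)
  have d: "?d \<in> L2 \<Omega>" using \<phi>L u by (intro L2_diff)
  have gd: "is_weak_partial \<Omega> b ?d (\<lambda>x. partial b \<phi> x - g b x)" if "b \<in> Basis" for b
    using that \<phi> u \<phi>L g by (intro is_weak_partial_diff is_weak_partial_test)
  have hd: "is_weak_partial \<Omega> c (\<lambda>x. partial b \<phi> x - g b x) (\<lambda>x. partial c (partial b \<phi>) x - h b c x)"
    if "b \<in> Basis" "c \<in> Basis" for b c
    using that \<phi> \<phi>L gL h by (intro is_weak_partial_diff is_weak_partial_test test_functions_partial)
  note H = H2I[of ?d "\<lambda>b x. partial b \<phi> x - g b x" "\<lambda>b c x. partial c (partial b \<phi>) x - h b c x", OF d gd hd]
  have "L2_sq \<Omega> (weak_partial \<Omega> b ?d)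
      = L2_sq \<Omega> (\<lambda>x. partial b \<phi> x - g b x)" if "b \<in> Basis" for b
    using that H(2,4) \<phi>L gL by (intro L2_inner_cong_AE) (auto intro: L2_diff)
  moreover have "L2_sq \<Omega> (weak_partial \<Omega> c (weak_partial \<Omega> b ?d))
      = L2_sq \<Omega> (\<lambda>x. partial c (partial b \<phi>) x - h b c x)"
    if "b \<in> Basis" "c \<in> Basis" for b c
    using that H(3,5) \<phi>L hL by (intro L2_inner_cong_AE) (auto intro: L2_diff)
  ultimately show ?thesis unfolding H2_norm_def by simp
qed

text \<open>Convergence in the \<open>H2\<close> norm taken apart into \<open>L2\<close> convergence
  of the function and of each derivative, with the limits given explicitly rather than by
  choice.\<close>

definition H2_approximation where
  "H2_approximation \<phi> u g h \<longleftrightarrow> (\<forall>m. \<phi> m \<in> test_functions \<Omega>) \<and> L2_tendsto \<Omega> \<phi> u \<and>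
     (\<forall>b\<in>Basis. L2_tendsto \<Omega> (\<lambda>m. partial b (\<phi> m)) (g b)) \<and>
     (\<forall>b\<in>Basis. \<forall>c\<in>Basis. L2_tendsto \<Omega> (\<lambda>m. partial c (partial b (\<phi> m))) (h b c))"

text \<open>The squared norm is a finite sum of nonnegative terms, so each of them tends to 0 with
  it.\<close>

lemma H2_0_approximation:
  assumes "u \<in> H2_0 \<Omega>"
  shows "\<exists>\<phi>. H2_approximation \<phi> u (\<lambda>b. weak_partial \<Omega> b u) (\<lambda>b c. weak_partial \<Omega> c (weak_partial \<Omega> b u))"
proof -
  obtain \<phi> where \<phi>: "\<And>m. \<phi> m \<in> test_functions \<Omega>" and lim: "(\<lambda>m. H2_norm \<Omega> (\<lambda>x. \<phi> m x - u x)) \<longlonglongrightarrow> 0"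
    and "u \<in> H2 \<Omega>"
    using assms unfolding H2_0_def by blast
  note u = H2D[OF \<open>u \<in> H2 \<Omega>\<close>]
  define N0 where "N0 = (\<lambda>m. L2_sq \<Omega> (\<lambda>x. \<phi> m x - u x))"
  define N1 where "N1 = (\<lambda>m b. L2_sq \<Omega> (\<lambda>x. partial b (\<phi> m) x - weak_partial \<Omega> b u x))"
  define N2 where "N2 = (\<lambda>m b c. L2_inner \<Omega>
      (\<lambda>x. partial c (partial b (\<phi> m)) x - weak_partial \<Omega> c (weak_partial \<Omega> b u) x)
      (\<lambda>x. partial c (partial b (\<phi> m)) x - weak_partial \<Omega> c (weak_partial \<Omega> b u) x))"
  define T where "T = (\<lambda>m. N0 m + (\<Sum>b\<in>Basis. N1 m b) + (\<Sum>b\<in>Basis. \<Sum>c\<in>Basis. N2 m b c))"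
  have pos: "0 \<le> N0 m" "0 \<le> N1 m b" "0 \<le> N2 m b c" for m b c
    by (auto simp: N0_def N1_def N2_def L2_inner_self_nonneg)
  have pos': "0 \<le> (\<Sum>b\<in>Basis. N1 m b)" "0 \<le> (\<Sum>b\<in>Basis. \<Sum>c\<in>Basis. N2 m b c)" for m
    using pos by (auto intro!: sum_nonneg)
  have "H2_norm \<Omega> (\<lambda>x. \<phi> m x - u x) = sqrt (T m)" for m
    unfolding T_def N0_def N1_def N2_def by (rule H2_norm_test_diff) (use \<phi> u in auto)
  then have "(\<lambda>m. (sqrt (T m))\<^sup>2) \<longlonglongrightarrow> 0\<^sup>2" using lim by (intro tendsto_power) simp
  moreover have T0: "0 \<le> T m" for m using pos pos' by (simp add: T_def)
  ultimately have T: "T \<longlonglongrightarrow> 0" by simp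
  have "N0 m \<le> T m" for m using pos'[of m] by (simp add: T_def)
  then have 0: "N0 \<longlonglongrightarrow> 0" using tendsto_sandwich[OF _ _ tendsto_const T] pos by (simp add: always_eventually)
  have "N1 m b \<le> T m" if "b \<in> Basis" for m b
  proof -
    have "N1 m b \<le> (\<Sum>b\<in>Basis. N1 m b)" using that pos by (intro member_le_sum) auto
    then show ?thesis using pos(1)[of m] pos'[of m] by (simp add: T_def)
  qed
  then have 1: "(\<lambda>m. N1 m b) \<longlonglongrightarrow> 0" if "b \<in> Basis" for b
    using tendsto_sandwich[OF _ _ tendsto_const T, of "\<lambda>m. N1 m b"] that pos by (simp add: always_eventually)
  have "N2 m b c \<le> T m" if "b \<in> Basis" "c \<in> Basis" for m b c
  proof -
    have "N2 m b c \<le> (\<Sum>c\<in>Basis. N2 m b c)"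
      using that pos by (intro member_le_sum) auto
    also have "\<dots> \<le> (\<Sum>b\<in>Basis. \<Sum>c\<in>Basis. N2 m b c)"
      using that pos by (intro member_le_sum[where f = "\<lambda>b. \<Sum>c\<in>Basis. N2 m b c"]) (auto intro!: sum_nonneg)
    finally show ?thesis using pos pos'[of m] by (simp add: T_def add_increasing)
  qed
  then have 2: "(\<lambda>m. N2 m b c) \<longlonglongrightarrow> 0" if "b \<in> Basis" "c \<in> Basis" for b c
    using tendsto_sandwich[OF _ _ tendsto_const T, of "\<lambda>m. N2 m b c"] that pos by (simp add: always_eventually)
  have L: "\<phi> m \<in> L2 \<Omega>" "b \<in> Basis \<Longrightarrow> partial b (\<phi> m) \<in> L2 \<Omega>"
    "b \<in> Basis \<Longrightarrow> c \<in> Basis \<Longrightarrow> partial c (partial b (\<phi> m)) \<in> L2 \<Omega>" for m b c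
    using \<phi> by (auto intro: test_L2 test_functions_partial)
  show ?thesis
    unfolding H2_approximation_def L2_tendsto_def
    using \<phi> u L 0 1 2 unfolding is_weak_partial_def N0_def N1_def N2_def
    by (intro exI[of _ \<phi>] conjI allI ballI) auto
qed

text \<open>Membership in \<open>H2\<close> comes for free: closedness turns the limits
  \<open>g\<close> and \<open>h\<close> into the first and second weak derivatives of
  \<open>u\<close>.\<close>

lemma H2_0I:
  assumes "H2_approximation \<phi> u g h"
  shows "u \<in> H2_0 \<Omega>"
    and "b \<in> Basis \<Longrightarrow> AE x in lebesgue_on \<Omega>. weak_partial \<Omega> b u x = g b x"
    and "b \<in> Basis \<Longrightarrow> c \<in> Basis \<Longrightarrow> AE x in lebesgue_on \<Omega>. weak_partial \<Omega> c (weak_partial \<Omega> b u) x = h b c x"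
proof -
  have \<phi>: "\<And>m. \<phi> m \<in> test_functions \<Omega>" and l0: "L2_tendsto \<Omega> \<phi> u"
    and l1: "\<And>b. b \<in> Basis \<Longrightarrow> L2_tendsto \<Omega> (\<lambda>m. partial b (\<phi> m)) (g b)"
    and l2: "\<And>b c. b \<in> Basis \<Longrightarrow> c \<in> Basis \<Longrightarrow> L2_tendsto \<Omega> (\<lambda>m. partial c (partial b (\<phi> m))) (h b c)"
    using assms by (auto simp: H2_approximation_def)
  have u: "u \<in> L2 \<Omega>" using l0 by (simp add: L2_tendsto_def)
  have g: "is_weak_partial \<Omega> b u (g b)" if "b \<in> Basis" for b
    using l0 l1[OF that] that by (rule is_weak_partial_limit[rotated]) (auto intro: is_weak_partial_test \<phi> that)
  have h: "is_weak_partial \<Omega> c (g b) (h b c)" if "b \<in> Basis" "c \<in> Basis" for b c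
    using l1[OF that(1)] l2[OF that] that(2)
    by (rule is_weak_partial_limit[rotated]) (auto intro: is_weak_partial_test test_functions_partial \<phi> that)
  note H = H2I[OF u g h]
  show "AE x in lebesgue_on \<Omega>. weak_partial \<Omega> b u x = g b x" if "b \<in> Basis" for b
    using H(2) that by blast
  show "AE x in lebesgue_on \<Omega>. weak_partial \<Omega> c (weak_partial \<Omega> b u) x = h b c x"
    if "b \<in> Basis" "c \<in> Basis" for b c
    using H(3) that by blast
  have "(\<lambda>m. sqrt (L2_sq \<Omega> (\<lambda>x. \<phi> m x - u x)
     + (\<Sum>b\<in>Basis. L2_sq \<Omega> (\<lambda>x. partial b (\<phi> m) x - g b x))
     + (\<Sum>b\<in>Basis. \<Sum>c\<in>Basis. L2_sq \<Omega> (\<lambda>x. partial c (partial b (\<phi> m)) x - h b c x))))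
    \<longlonglongrightarrow> sqrt (0 + 0 + 0)"
    using l0 l1 l2 unfolding L2_tendsto_def
    by (intro tendsto_real_sqrt tendsto_add tendsto_null_sum) auto
  moreover have "H2_norm \<Omega> (\<lambda>x. \<phi> m x - u x) = sqrt (L2_sq \<Omega> (\<lambda>x. \<phi> m x - u x)
     + (\<Sum>b\<in>Basis. L2_sq \<Omega> (\<lambda>x. partial b (\<phi> m) x - g b x))
     + (\<Sum>b\<in>Basis. \<Sum>c\<in>Basis. L2_sq \<Omega> (\<lambda>x. partial c (partial b (\<phi> m)) x - h b c x)))" for m
    by (rule H2_norm_test_diff) (use \<phi> u g h in auto)
  ultimately have "(\<lambda>m. H2_norm \<Omega> (\<lambda>x. \<phi> m x - u x)) \<longlonglongrightarrow> 0" by simp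
  then show "u \<in> H2_0 \<Omega>" using H(1) \<phi> by (auto simp: H2_0_def)
qed

lemma H2_0_L2:
  assumes "u \<in> H2_0 \<Omega>"
  shows "u \<in> L2 \<Omega>" "b \<in> Basis \<Longrightarrow> weak_partial \<Omega> b u \<in> L2 \<Omega>"
    "b \<in> Basis \<Longrightarrow> c \<in> Basis \<Longrightarrow> weak_partial \<Omega> c (weak_partial \<Omega> b u) \<in> L2 \<Omega>"
    "weak_laplacian \<Omega> u \<in> L2 \<Omega>"
proof -
  note u = H2D[of u]
  have uH: "u \<in> H2 \<Omega>" using assms by (simp add: H2_0_def)
  show "u \<in> L2 \<Omega>" "b \<in> Basis \<Longrightarrow> weak_partial \<Omega> b u \<in> L2 \<Omega>"
    using u[OF uH] by (auto simp: is_weak_partial_def)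
  show *: "weak_partial \<Omega> c (weak_partial \<Omega> b u) \<in> L2 \<Omega>" if "b \<in> Basis" "c \<in> Basis" for b c
    using u(3)[OF uH] that by (auto simp: is_weak_partial_def)
  show "weak_laplacian \<Omega> u \<in> L2 \<Omega>"
    unfolding weak_laplacian_def by (intro L2_sum *) auto
qed

lemma partial_lincomb:
  assumes "\<phi> \<in> test_functions \<Omega>" "\<psi> \<in> test_functions \<Omega>"
  shows "partial b (\<lambda>x. c * \<phi> x + d * \<psi> x) = (\<lambda>x. c * partial b \<phi> x + d * partial b \<psi> x)"
proof
  fix x
  have "\<phi> differentiable (at x)" "\<psi> differentiable (at x)"
    using assms by (auto simp: test_functions_def intro: smooth_differentiable)
  then show "partial b (\<lambda>x. c * \<phi> x + d * \<psi> x) x = c * partial b \<phi> x + d * partial b \<psi> x"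
    by (subst partial_add) (auto simp: partial_cmult)
qed

text \<open>The corresponding combinations of two approximating sequences approximate the
  combination. Linearity of \<open>weak_partial\<close> holds only almost everywhere, because its
  representative is chosen.\<close>

lemma H2_0_lincomb:
  assumes "u \<in> H2_0 \<Omega>" "v \<in> H2_0 \<Omega>"
  shows "(\<lambda>x. c * u x + d * v x) \<in> H2_0 \<Omega>"
    and "b \<in> Basis \<Longrightarrow> AE x in lebesgue_on \<Omega>.
      weak_partial \<Omega> b (\<lambda>x. c * u x + d * v x) x = c * weak_partial \<Omega> b u x + d * weak_partial \<Omega> b v x"
    and "AE x in lebesgue_on \<Omega>.
      weak_laplacian \<Omega> (\<lambda>x. c * u x + d * v x) x = c * weak_laplacian \<Omega> u x + d * weak_laplacian \<Omega> v x"
proof -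
  obtain \<phi> where \<phi>: "H2_approximation \<phi> u (\<lambda>b. weak_partial \<Omega> b u) (\<lambda>b c. weak_partial \<Omega> c (weak_partial \<Omega> b u))"
    using H2_0_approximation[OF assms(1)] by blast
  obtain \<psi> where \<psi>: "H2_approximation \<psi> v (\<lambda>b. weak_partial \<Omega> b v) (\<lambda>b c. weak_partial \<Omega> c (weak_partial \<Omega> b v))"
    using H2_0_approximation[OF assms(2)] by blast
  have t: "\<phi> m \<in> test_functions \<Omega>" "\<psi> m \<in> test_functions \<Omega>" for m
    using \<phi> \<psi> by (auto simp: H2_approximation_def)
  have "H2_approximation (\<lambda>m x. c * \<phi> m x + d * \<psi> m x) (\<lambda>x. c * u x + d * v x)
     (\<lambda>b x. c * weak_partial \<Omega> b u x + d * weak_partial \<Omega> b v x)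
     (\<lambda>b e x. c * weak_partial \<Omega> e (weak_partial \<Omega> b u) x + d * weak_partial \<Omega> e (weak_partial \<Omega> b v) x)"
    unfolding H2_approximation_def
  proof (intro conjI allI ballI)
    show "(\<lambda>x. c * \<phi> m x + d * \<psi> m x) \<in> test_functions \<Omega>" for m
      by (intro test_functions_add test_functions_cmult t)
    show "L2_tendsto \<Omega> (\<lambda>m x. c * \<phi> m x + d * \<psi> m x) (\<lambda>x. c * u x + d * v x)"
      using \<phi> \<psi> by (intro L2_tendsto_add L2_tendsto_cmult) (auto simp: H2_approximation_def)
    fix b :: 'a assume b: "b \<in> Basis"
    have eq: "partial b (\<lambda>x. c * \<phi> m x + d * \<psi> m x) = (\<lambda>x. c * partial b (\<phi> m) x + d * partial b (\<psi> m) x)" for m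
      by (rule partial_lincomb[OF t])
    show "L2_tendsto \<Omega> (\<lambda>m. partial b (\<lambda>x. c * \<phi> m x + d * \<psi> m x))
        (\<lambda>x. c * weak_partial \<Omega> b u x + d * weak_partial \<Omega> b v x)"
      unfolding eq using b \<phi> \<psi> by (intro L2_tendsto_add L2_tendsto_cmult) (auto simp: H2_approximation_def)
    fix e :: 'a assume e: "e \<in> Basis"
    have eq2: "partial e (\<lambda>x. c * partial b (\<phi> m) x + d * partial b (\<psi> m) x)
       = (\<lambda>x. c * partial e (partial b (\<phi> m)) x + d * partial e (partial b (\<psi> m)) x)" for m
      by (rule partial_lincomb) (auto intro: test_functions_partial t b)
    show "L2_tendsto \<Omega> (\<lambda>m. partial e (partial b (\<lambda>x. c * \<phi> m x + d * \<psi> m x)))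
        (\<lambda>x. c * weak_partial \<Omega> e (weak_partial \<Omega> b u) x + d * weak_partial \<Omega> e (weak_partial \<Omega> b v) x)"
      unfolding eq eq2 using b e \<phi> \<psi>
      by (intro L2_tendsto_add L2_tendsto_cmult) (auto simp: H2_approximation_def)
  qed
  note H = H2_0I[OF this]
  show "(\<lambda>x. c * u x + d * v x) \<in> H2_0 \<Omega>" by (rule H)
  show "b \<in> Basis \<Longrightarrow> AE x in lebesgue_on \<Omega>.
      weak_partial \<Omega> b (\<lambda>x. c * u x + d * v x) x = c * weak_partial \<Omega> b u x + d * weak_partial \<Omega> b v x" for b
    by (rule H)
  have "AE x in lebesgue_on \<Omega>. \<forall>b\<in>Basis. weak_partial \<Omega> b (weak_partial \<Omega> b (\<lambda>x. c * u x + d * v x)) x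
      = c * weak_partial \<Omega> b (weak_partial \<Omega> b u) x + d * weak_partial \<Omega> b (weak_partial \<Omega> b v) x"
    by (intro AE_finite_allI finite_Basis H)
  then show "AE x in lebesgue_on \<Omega>.
      weak_laplacian \<Omega> (\<lambda>x. c * u x + d * v x) x = c * weak_laplacian \<Omega> u x + d * weak_laplacian \<Omega> v x"
    by eventually_elim (simp add: weak_laplacian_def sum_distrib_left sum.distrib)
qed

lemma H2_0_zero: "(\<lambda>x. 0) \<in> H2_0 \<Omega>"
  by (rule H2_0I(1)[of "\<lambda>m x. 0" _ "\<lambda>b x. 0" "\<lambda>b c x. 0"])
    (auto simp: H2_approximation_def test_functions_zero L2_tendsto_const L2_zero)

section \<open>Orthonormal eigenfunctions obtained from the multiplicities\<close>

section \<open>Eigenfunctions\<close>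

lemma plate_form_commute: "plate_form \<Omega> a u v = plate_form \<Omega> a v u"
  by (simp add: plate_form_def L2_inner_commute)

lemma plate_form_lincomb:
  assumes "u \<in> H2_0 \<Omega>" "v \<in> H2_0 \<Omega>" "w \<in> H2_0 \<Omega>"
  shows "plate_form \<Omega> a (\<lambda>x. c * u x + d * v x) w = c * plate_form \<Omega> a u w + d * plate_form \<Omega> a v w"
proof -
  note uv = H2_0_lincomb[OF assms(1,2), where c = c and d = d]
  have inner: "L2_inner \<Omega> (\<lambda>x. c * f x + d * g x) h = c * L2_inner \<Omega> f h + d * L2_inner \<Omega> g h"
    if "f \<in> L2 \<Omega>" "g \<in> L2 \<Omega>" "h \<in> L2 \<Omega>" for f g h
    using that by (simp add: L2_inner_add_left L2_cmult L2_inner_cmult_left)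
  have "L2_inner \<Omega> (weak_partial \<Omega> b (\<lambda>x. c * u x + d * v x)) (weak_partial \<Omega> b w)
      = c * L2_inner \<Omega> (weak_partial \<Omega> b u) (weak_partial \<Omega> b w)
      + d * L2_inner \<Omega> (weak_partial \<Omega> b v) (weak_partial \<Omega> b w)" if b: "b \<in> Basis" for b
    using assms b H2_0_L2(2)[OF uv(1)]
    by (subst L2_inner_cong_AE[OF uv(2)[OF b] AE_I2[OF refl]])
       (auto intro!: inner L2_add L2_cmult intro: H2_0_L2(2,4))
  moreover have "L2_inner \<Omega> (weak_laplacian \<Omega> (\<lambda>x. c * u x + d * v x)) (weak_laplacian \<Omega> w)
      = c * L2_inner \<Omega> (weak_laplacian \<Omega> u) (weak_laplacian \<Omega> w)
      + d * L2_inner \<Omega> (weak_laplacian \<Omega> v) (weak_laplacian \<Omega> w)"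
    using assms H2_0_L2(4)[OF uv(1)]
    by (subst L2_inner_cong_AE[OF uv(3) AE_I2[OF refl]])
       (auto intro!: inner L2_add L2_cmult intro: H2_0_L2(2,4))
  ultimately show ?thesis
    by (simp add: plate_form_def sum.distrib sum_distrib_left algebra_simps)
qed

lemma eigenspace_lincomb:
  assumes "u \<in> eigenspace \<Omega> a \<mu>" "v \<in> eigenspace \<Omega> a \<mu>"
  shows "(\<lambda>x. c * u x + d * v x) \<in> eigenspace \<Omega> a \<mu>"
  using assms unfolding eigenspace_def
  by (auto simp: plate_form_lincomb H2_0_lincomb(1) L2_inner_add_left L2_cmult L2_inner_cmult_left
      H2_0_L2(1) algebra_simps)

lemma eigenspace_sum:
  assumes "finite J" "\<And>i. i \<in> J \<Longrightarrow> e i \<in> eigenspace \<Omega> a \<mu>"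
  shows "(\<lambda>x. \<Sum>i\<in>J. c i * e i x) \<in> eigenspace \<Omega> a \<mu>"
  using assms
proof (induction J rule: finite_induct)
  case empty
  \<comment> \<open>With both coefficients 0, linearity shows that the form vanishes on the zero
    function, whose chosen weak derivatives are zero only almost everywhere.\<close>
  show ?case using plate_form_lincomb[OF H2_0_zero H2_0_zero, of _ a 0 0]
    by (simp add: eigenspace_def H2_0_zero L2_inner_zero_left)
next
  case (insert j J)
  then show ?case using eigenspace_lincomb[of "e j" a \<mu> "\<lambda>x. \<Sum>i\<in>J. c i * e i x" "c j" 1] by simp
qed

lemma eigenspaces_orthogonal:
  assumes "u \<in> eigenspace \<Omega> a \<mu>" "v \<in> eigenspace \<Omega> a \<nu>" "\<mu> \<noteq> \<nu>"
  shows "L2_inner \<Omega> u v = 0"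
proof -
  have "\<mu> * L2_inner \<Omega> u v = plate_form \<Omega> a u v" using assms by (simp add: eigenspace_def)
  also have "\<dots> = plate_form \<Omega> a v u" by (rule plate_form_commute)
  also have "\<dots> = \<nu> * L2_inner \<Omega> v u" using assms by (simp add: eigenspace_def)
  finally show ?thesis using assms(3) by (simp add: L2_inner_commute)
qed

text \<open>The number of indices with \<open>\<Gamma> j = \<mu>\<close> is the dimension of the
  eigenspace of \<open>\<mu>\<close>, so Gram-Schmidt supplies exactly one vector per index.
  Different eigenspaces are orthogonal by symmetry of the form.\<close>

lemma orthonormal_eigenfunctions:
  assumes "eigenvalue_sequence \<Omega> a \<Gamma>"
  obtains u where "L2_orthonormal \<Omega> u {1..}" "\<And>j. 1 \<le> j \<Longrightarrow> u j \<in> eigenspace \<Omega> a (\<Gamma> j)"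
proof -
  define J where "J = (\<lambda>\<mu>. {j. 1 \<le> j \<and> \<Gamma> j = \<mu>})"
  \<comment> \<open>An infinite index set would have \<open>card\<close> 0 and so claim a trivial
    eigenspace; the divergence of \<open>\<Gamma>\<close> excludes this.\<close>
  have fin: "finite (J \<mu>)" for \<mu>
  proof -
    have "filterlim \<Gamma> at_top sequentially" using assms by (simp add: eigenvalue_sequence_def)
    then have "\<forall>\<^sub>F j in sequentially. \<mu> + 1 \<le> \<Gamma> j" by (simp add: filterlim_at_top)
    then obtain N where "\<And>j. N \<le> j \<Longrightarrow> \<mu> + 1 \<le> \<Gamma> j" by (auto simp: eventually_sequentially)
    then have "j < N" if "\<Gamma> j = \<mu>" for j
      using that by (metis add_le_same_cancel1 not_less not_one_le_zero)
    then have "J \<mu> \<subseteq> {..<N}" unfolding J_def by blast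
    then show ?thesis by (rule finite_subset) simp
  qed
  have "\<exists>f. L2_orthonormal \<Omega> f {..<card (J \<mu>)} \<and> (\<forall>i. f i \<in> eigenspace \<Omega> a \<mu>)" for \<mu>
  proof -
    have "has_ae_dim (lebesgue_on \<Omega>) (eigenspace \<Omega> a \<mu>) (card (J \<mu>))"
      using assms by (simp add: eigenvalue_sequence_def J_def)
    then obtain e where e: "\<And>i. i < card (J \<mu>) \<Longrightarrow> e i \<in> eigenspace \<Omega> a \<mu>"
      and ind: "\<And>c::nat \<Rightarrow> real. (AE x in lebesgue_on \<Omega>. (\<Sum>i<card (J \<mu>). c i * e i x) = 0) \<Longrightarrow>
          \<forall>i<card (J \<mu>). c i = 0"
      unfolding has_ae_dim_def by blast
    have "e i \<in> L2 \<Omega>" if "i < card (J \<mu>)" for i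
      using e[OF that] H2_0_L2(1) by (simp add: eigenspace_def)
    then obtain C where "L2_orthonormal \<Omega> (\<lambda>i x. \<Sum>l<card (J \<mu>). C i l * e l x) {..<card (J \<mu>)}"
      using L2_Gram_Schmidt[of "card (J \<mu>)" e \<Omega>] ind by blast
    moreover have "(\<lambda>x. \<Sum>l<card (J \<mu>). C i l * e l x) \<in> eigenspace \<Omega> a \<mu>" for i
      by (rule eigenspace_sum) (auto intro: e)
    ultimately show ?thesis by blast
  qed
  then obtain f where on: "\<And>\<mu>. L2_orthonormal \<Omega> (f \<mu>) {..<card (J \<mu>)}"
    and fe: "\<And>\<mu> i. f \<mu> i \<in> eigenspace \<Omega> a \<mu>"
    by metis
  have "\<exists>h. bij_betw h (J \<mu>) {..<card (J \<mu>)}" for \<mu>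
    using ex_bij_betw_finite_nat[OF fin[of \<mu>]] by (simp add: atLeast0LessThan)
  then obtain h where h: "\<And>\<mu>. bij_betw (h \<mu>) (J \<mu>) {..<card (J \<mu>)}" by metis
  \<comment> \<open>\<open>h (\<Gamma> j)\<close> numbers the indices that share the eigenvalue
    \<open>\<Gamma> j\<close>, so equal eigenvalues receive different members of one orthonormal
    family.\<close>
  define u where "u = (\<lambda>j. f (\<Gamma> j) (h (\<Gamma> j) j))"
  have ue: "u j \<in> eigenspace \<Omega> a (\<Gamma> j)" for j unfolding u_def by (rule fe)
  have uL: "u j \<in> L2 \<Omega>" for j using ue[of j] H2_0_L2(1) by (simp add: eigenspace_def)
  have "L2_inner \<Omega> (u i) (u j) = (if i = j then 1 else 0)" if "1 \<le> i" "1 \<le> j" for i j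
  proof (cases "\<Gamma> i = \<Gamma> j")
    case False
    then show ?thesis using eigenspaces_orthogonal[OF ue[of i] ue[of j]] by auto
  next
    case True
    have J: "i \<in> J (\<Gamma> j)" "j \<in> J (\<Gamma> j)" using that True by (auto simp: J_def)
    then have "h (\<Gamma> j) i < card (J (\<Gamma> j))" "h (\<Gamma> j) j < card (J (\<Gamma> j))"
      using h[of "\<Gamma> j"] by (auto simp: bij_betw_def)
    moreover have "h (\<Gamma> j) i = h (\<Gamma> j) j \<longleftrightarrow> i = j"
      using J h[of "\<Gamma> j"] by (auto simp: bij_betw_def inj_on_def)
    ultimately show ?thesis
      using on[of "\<Gamma> j"] unfolding u_def True L2_orthonormal_def by auto
  qed
  then have "L2_orthonormal \<Omega> u {1..}" using uL by (auto simp: L2_orthonormal_def)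
  with ue show ?thesis by (intro that)
qed

end

section \<open>Plancherel's theorem for continuous functions of compact support\<close>

section \<open>Plancherel's theorem\<close>

lemma lborel_integral_affine:
  fixes f :: "'a::euclidean_space \<Rightarrow> 'b::{banach, second_countable_topology}" and c :: real
  assumes [measurable]: "f \<in> borel_measurable borel" and c: "c \<noteq> 0"
  shows "(LINT x|lborel. f x) = \<bar>c\<bar> ^ DIM('a) *\<^sub>R (LINT x|lborel. f (t + c *\<^sub>R x))"
proof -
  have "(LINT x|lborel. f x) = integral\<^sup>L (density (distr lborel borel (\<lambda>x. t + c *\<^sub>R x)) (\<lambda>_. \<bar>c\<bar>^DIM('a))) f"
    using lborel_affine[OF c, of t] by (metis (no_types, lifting))
  also have "\<dots> = integral\<^sup>L (distr lborel borel (\<lambda>x. t + c *\<^sub>R x)) (\<lambda>x. \<bar>c\<bar>^DIM('a) *\<^sub>R f x)"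
    by (rule integral_density) auto
  also have "\<dots> = (LINT x|lborel. \<bar>c\<bar>^DIM('a) *\<^sub>R f (t + c *\<^sub>R x))"
    by (rule integral_distr) auto
  finally show ?thesis by simp
qed

lemma
  fixes f :: "'a::euclidean_space \<Rightarrow> real \<Rightarrow> 'b::{real_normed_field, banach, second_countable_topology}"
  assumes f: "\<And>b. b \<in> Basis \<Longrightarrow> integrable lborel (f b)"
  shows lborel_integrable_prod: "integrable lborel (\<lambda>x. \<Prod>b\<in>Basis. f b (x \<bullet> b))"
    and lborel_integral_prod: "(LINT x|lborel. (\<Prod>b\<in>Basis. f b (x \<bullet> b))) = (\<Prod>b\<in>Basis. LINT x|lborel. f b x)"
proof -
  interpret product_sigma_finite "\<lambda>_::'a. lborel :: real measure"
    by standard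
  have [measurable]: "f b \<in> borel_measurable borel" if "b \<in> Basis" for b
    using borel_measurable_integrable[OF f[OF that]] by simp
  have meas: "(\<lambda>x. \<Prod>b\<in>Basis. f b (x \<bullet> b)) \<in> borel_measurable borel" by measurable
  have T: "(\<lambda>f. \<Sum>b\<in>Basis. f b *\<^sub>R b) \<in> (\<Pi>\<^sub>M b\<in>Basis. lborel) \<rightarrow>\<^sub>M (borel :: 'a measure)" by measurable
  have eq: "(\<Prod>b\<in>Basis. f b ((\<Sum>c\<in>Basis. x c *\<^sub>R c) \<bullet> b)) = (\<Prod>b\<in>Basis. f b (x b))" for x :: "'a \<Rightarrow> real"
    by (intro prod.cong refl) simp
  show "integrable lborel (\<lambda>x. \<Prod>b\<in>Basis. f b (x \<bullet> b))"
    by (subst lborel_eq, subst integrable_distr_eq[OF T meas])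
      (simp add: eq product_integrable_prod f)
  show "(LINT x|lborel. (\<Prod>b\<in>Basis. f b (x \<bullet> b))) = (\<Prod>b\<in>Basis. LINT x|lborel. f b x)"
    by (subst lborel_eq, subst integral_distr[OF T meas])
      (simp add: eq product_integral_prod f)
qed

definition gaussian :: "'a::euclidean_space \<Rightarrow> real" where
  "gaussian x = exp (- (norm x)\<^sup>2 / 2)"

lemma gaussian_measurable [measurable]: "gaussian \<in> borel_measurable borel"
  unfolding gaussian_def[abs_def] by measurable

lemma gaussian_nonneg [simp]: "0 \<le> gaussian x" and abs_gaussian [simp]: "\<bar>gaussian x\<bar> = gaussian x"
  by (simp_all add: gaussian_def)

lemma gaussian_prod: "gaussian x = (\<Prod>b\<in>Basis. exp (- (x \<bullet> b)\<^sup>2 / 2))"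
proof -
  have "- (norm x)\<^sup>2 / 2 = (\<Sum>b\<in>Basis. - (x \<bullet> b)\<^sup>2 / 2)"
    unfolding power2_norm_eq_inner euclidean_inner[of x x]
    by (simp add: sum_negf sum_divide_distrib power2_eq_square)
  then show ?thesis by (simp add: gaussian_def exp_sum)
qed

text \<open>Up to the factor \<open>sqrt (2 * pi)\<close>, the second integral is the characteristic
  function of the standard normal distribution.\<close>

lemma
  shows integrable_gaussian_real: "integrable lborel (\<lambda>x::real. exp (- x\<^sup>2 / 2))"
    and integral_gaussian_cis_real: "(LINT x|lborel. of_real (exp (- x\<^sup>2 / 2)) * cis (t * x))
      = of_real (sqrt (2 * pi) * exp (- t\<^sup>2 / 2))"
proof -
  have d: "exp (- x\<^sup>2 / 2) = sqrt (2 * pi) * std_normal_density x" for x :: real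
    by (simp add: normal_density_def)
  show "integrable lborel (\<lambda>x::real. exp (- x\<^sup>2 / 2))"
    unfolding d by (intro integrable_mult_right) simp
  have "complex_of_real (exp (- (t\<^sup>2) / 2)) = char std_normal_distribution t"
    by (simp add: char_std_normal_distribution)
  also have "\<dots> = (LINT x|lborel. std_normal_density x *\<^sub>R cis (t * x))"
    unfolding char_def by (subst integral_density) (auto simp: cis_conv_exp)
  finally have "(LINT x|lborel. std_normal_density x *\<^sub>R cis (t * x)) = exp (- t\<^sup>2 / 2)" by simp
  then show "(LINT x|lborel. of_real (exp (- x\<^sup>2 / 2)) * cis (t * x)) = of_real (sqrt (2 * pi) * exp (- t\<^sup>2 / 2))"
    unfolding d by (simp add: scaleR_conv_of_real mult.assoc)
qed

lemma integrable_gaussian: "integrable lborel (gaussian :: 'a::euclidean_space \<Rightarrow> real)"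
  unfolding gaussian_prod[abs_def]
  by (rule lborel_integrable_prod) (rule integrable_gaussian_real)

lemma cis_sum: "finite J \<Longrightarrow> cis (\<Sum>i\<in>J. f i) = (\<Prod>i\<in>J. cis (f i))"
  by (induction J rule: finite_induct) (auto simp: cis_mult[symmetric])

lemma cis_measurable [measurable]: "cis \<in> borel_measurable borel"
  by (intro borel_measurable_continuous_onI continuous_intros)

lemma integral_gaussian_cis:
  "(LINT x|lborel. of_real (gaussian x) * cis (z \<bullet> x))
    = of_real (sqrt (2 * pi) ^ DIM('a) * gaussian (z :: 'a::euclidean_space))"
proof -
  have "of_real (gaussian x) * cis (z \<bullet> x)
      = (\<Prod>b\<in>Basis. of_real (exp (- (x \<bullet> b)\<^sup>2 / 2)) * cis ((z \<bullet> b) * (x \<bullet> b)))" for x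
    unfolding gaussian_prod euclidean_inner[of z x] by (simp add: cis_sum prod.distrib)
  then have "(LINT x|lborel. of_real (gaussian x) * cis (z \<bullet> x))
      = (LINT x|lborel. (\<Prod>b\<in>Basis. of_real (exp (- (x \<bullet> b)\<^sup>2 / 2)) * cis ((z \<bullet> b) * (x \<bullet> b))))"
    by simp
  also have "\<dots> = (\<Prod>b\<in>Basis. LINT x|lborel. of_real (exp (- x\<^sup>2 / 2)) * cis ((z \<bullet> b) * x))"
  proof (rule lborel_integral_prod)
    show "integrable lborel (\<lambda>x. complex_of_real (exp (- x\<^sup>2 / 2)) * cis (z \<bullet> b * x))" for b
      by (rule Bochner_Integration.integrable_bound[OF integrable_gaussian_real])
        (auto simp: norm_mult)
  qed
  also have "\<dots> = (\<Prod>b\<in>(Basis::'a set). of_real (sqrt (2 * pi) * exp (- (z \<bullet> b)\<^sup>2 / 2)))"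
    by (simp only: integral_gaussian_cis_real)
  also have "\<dots> = of_real (sqrt (2 * pi) ^ DIM('a) * gaussian z)"
    by (simp add: prod.distrib gaussian_prod)
  finally show ?thesis .
qed

lemma integral_gaussian: "(LINT x|lborel. gaussian (x :: 'a::euclidean_space)) = sqrt (2 * pi) ^ DIM('a)"
proof -
  have "complex_of_real (LINT x|lborel. gaussian (x :: 'a)) = of_real (sqrt (2 * pi) ^ DIM('a))"
    using integral_gaussian_cis[of "0 :: 'a"] by (simp add: gaussian_def)
  then show ?thesis by (simp only: of_real_eq_iff)
qed

lemma integrable_pair_bound:
  fixes f :: "'a::euclidean_space \<Rightarrow> real" and g :: "'b::euclidean_space \<Rightarrow> real"
    and h :: "'a \<Rightarrow> 'b \<Rightarrow> 'c::{banach, second_countable_topology}"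
  assumes f: "integrable lborel f" and g: "integrable lborel g"
    and h: "case_prod h \<in> borel_measurable (lborel \<Otimes>\<^sub>M lborel)"
    and le: "\<And>x y. norm (h x y) \<le> \<bar>f x\<bar> * \<bar>g y\<bar>"
  shows "integrable (lborel \<Otimes>\<^sub>M lborel) (case_prod h)"
proof -
  have [measurable]: "f \<in> borel_measurable borel" "g \<in> borel_measurable borel"
    using borel_measurable_integrable[OF f] borel_measurable_integrable[OF g] by auto
  have "integrable (lborel \<Otimes>\<^sub>M lborel) (\<lambda>(x, y). f x * g y)"
  proof (rule lborel_pair.Fubini_integrable)
    show "integrable lborel (\<lambda>x. LINT y|lborel. norm (case (x, y) of (x, y) \<Rightarrow> f x * g y))"
      using f by (simp add: abs_mult)
    show "AE x in lborel. integrable lborel (\<lambda>y. case (x, y) of (x, y) \<Rightarrow> f x * g y)"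
      using g by simp
  qed measurable
  then show ?thesis
    by (rule Bochner_Integration.integrable_bound[OF _ h]) (auto simp: abs_mult le)
qed

text \<open>No normalising factor and a positive sign in the exponent: hence
  \<open>(2 * pi) ^ n\<close> in Plancherel's theorem and the factor \<open>- \<i>\<close> for
  derivatives.\<close>

definition fourier :: "('a::euclidean_space \<Rightarrow> real) \<Rightarrow> 'a \<Rightarrow> complex" where
  "fourier f \<xi> = (LINT x|lborel. of_real (f x) * cis (x \<bullet> \<xi>))"

text \<open>A factor \<open>gaussian (t *\<^sub>R \<xi>)\<close> makes every exchange of integrals
  legitimate and turns the left side into the pairing of \<open>\<phi>\<close> with its Gaussian
  average at scale \<open>t\<close>. As \<open>t\<close> tends to 0, that pairing converges by
  dominated convergence and the damped integral by monotone convergence, which also yields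
  integrability.\<close>

lemma
  fixes \<phi> :: "'a::euclidean_space \<Rightarrow> real"
  assumes c: "continuous_on UNIV \<phi>" and K: "compact K" "\<And>x. x \<notin> K \<Longrightarrow> \<phi> x = 0"
  shows Plancherel_integrable: "integrable lborel (\<lambda>\<xi>. (cmod (fourier \<phi> \<xi>))\<^sup>2)"
    and Plancherel: "(LINT \<xi>|lborel. (cmod (fourier \<phi> \<xi>))\<^sup>2) = (2 * pi) ^ DIM('a) * (LINT x|lborel. (\<phi> x)\<^sup>2)"
proof -
  have [measurable]: "\<phi> \<in> borel_measurable borel" using c by (rule borel_measurable_continuous_onI)
  have \<phi>int: "integrable lborel \<phi>" by (rule integrable_lborel_compact_support[OF c K])
  obtain B where B: "0 \<le> B" "\<And>x. norm (\<phi> x) \<le> B"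
    using bounded_compact_support[OF c K] by blast
  have F_meas [measurable]: "fourier \<phi> \<in> borel_measurable borel"
    unfolding fourier_def[abs_def] by measurable
  define A where "A = (LINT x|lborel. \<bar>\<phi> x\<bar>)"
  have A: "cmod (fourier \<phi> \<xi>) \<le> A" for \<xi>
    unfolding fourier_def A_def by (rule integral_norm_bound[THEN order_trans]) (simp add: norm_mult)
  then have A0: "0 \<le> A" using norm_ge_zero order_trans by blast
  define c where "c = sqrt (2 * pi) ^ DIM('a)"
  \<comment> \<open>A function that is not integrable has integral 0 by convention, while the change
    of variables, valid in any case, gives a nonzero value.\<close>
  have scaled_int: "integrable lborel (\<lambda>\<xi>::'a. gaussian (t *\<^sub>R \<xi>))" if "0 < t" for t
  proof (rule ccontr)
    assume "\<not> ?thesis"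
    then have "(LINT \<xi>::'a|lborel. gaussian (t *\<^sub>R \<xi>)) = 0" by (rule not_integrable_integral_eq)
    then have "(LINT \<xi>::'a|lborel. gaussian \<xi>) = 0"
      using lborel_integral_affine[of "gaussian :: 'a \<Rightarrow> real" t 0] that by simp
    then show False by (simp add: integral_gaussian)
  qed
  let ?A = "\<lambda>t y. LINT z|lborel. \<phi> (y + t *\<^sub>R z) * gaussian (z :: 'a)"
  \<comment> \<open>Inversion formula for the damped transform: \<open>?A t y\<close> is, up to the
    factor \<open>c\<close>, the Gaussian average of \<open>\<phi>\<close> around \<open>y\<close>
    at scale \<open>t\<close>.\<close>
  have inner: "(LINT \<xi>|lborel. gaussian (t *\<^sub>R \<xi>) * (fourier \<phi> \<xi> * cis (- (y \<bullet> \<xi>))))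
      = of_real (c * ?A t y)" if t: "0 < t" for t y
  proof -
    let ?h = "\<lambda>x \<xi>. of_real (gaussian (t *\<^sub>R \<xi>) * \<phi> x) * cis ((x - y) \<bullet> \<xi>)"
    have int: "integrable (lborel \<Otimes>\<^sub>M lborel) (\<lambda>(x, \<xi>). ?h x \<xi>)"
    proof (rule integrable_pair_bound[OF \<phi>int scaled_int[OF t]])
      show "norm (?h x \<xi>) \<le> \<bar>\<phi> x\<bar> * \<bar>gaussian (t *\<^sub>R \<xi>)\<bar>" for x \<xi>
        by (simp add: norm_mult)
    qed measurable
    have "(LINT \<xi>|lborel. gaussian (t *\<^sub>R \<xi>) * (fourier \<phi> \<xi> * cis (- (y \<bullet> \<xi>))))
      = (LINT \<xi>|lborel. LINT x|lborel. ?h x \<xi>)"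
    proof (rule Bochner_Integration.integral_cong[OF refl])
      fix \<xi>
      have "?h x \<xi> = (of_real (\<phi> x) * cis (x \<bullet> \<xi>)) * (of_real (gaussian (t *\<^sub>R \<xi>)) * cis (- (y \<bullet> \<xi>)))" for x
        using cis_mult[of "x \<bullet> \<xi>" "- (y \<bullet> \<xi>)"] by (simp add: inner_diff_left mult_ac)
      then have "(LINT x|lborel. ?h x \<xi>) = fourier \<phi> \<xi> * (of_real (gaussian (t *\<^sub>R \<xi>)) * cis (- (y \<bullet> \<xi>)))"
        unfolding fourier_def by (simp only: integral_mult_left_zero)
      then show "gaussian (t *\<^sub>R \<xi>) * (fourier \<phi> \<xi> * cis (- (y \<bullet> \<xi>))) = (LINT x|lborel. ?h x \<xi>)"
        by (simp add: mult_ac)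
    qed
    also have "\<dots> = (LINT x|lborel. LINT \<xi>|lborel. ?h x \<xi>)"
      by (rule lborel_pair.Fubini_integral[OF int])
    \<comment> \<open>Substitution \<open>x = y + t *\<^sub>R z\<close>. The Jacobian is used up
      below by rescaling \<open>\<xi>\<close> in the inner integral, which leaves the transform of
      the undamped Gaussian.\<close>
    also have "\<dots> = \<bar>t\<bar> ^ DIM('a) *\<^sub>R (LINT z|lborel. LINT \<xi>|lborel. ?h (y + t *\<^sub>R z) \<xi>)"
      using t by (intro lborel_integral_affine) auto
    also have "\<dots> = (LINT z|lborel. of_real (\<phi> (y + t *\<^sub>R z)) *
        (\<bar>t\<bar> ^ DIM('a) *\<^sub>R (LINT \<xi>|lborel. of_real (gaussian (t *\<^sub>R \<xi>)) * cis (z \<bullet> (t *\<^sub>R \<xi>)))))"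
      by (simp add: mult_ac flip: integral_scaleR_right integral_mult_right_zero)
    also have "\<dots> = (LINT z|lborel. of_real (\<phi> (y + t *\<^sub>R z)) * (LINT \<xi>|lborel. of_real (gaussian \<xi>) * cis (z \<bullet> \<xi>)))"
      using t by (subst (2) lborel_integral_affine[where c = t and t = 0]) auto
    also have "\<dots> = (LINT z|lborel. of_real (c * (\<phi> (y + t *\<^sub>R z) * gaussian z)))"
      by (simp add: integral_gaussian_cis c_def mult_ac)
    also have "\<dots> = of_real (c * ?A t y)"
      by (simp only: integral_complex_of_real integral_mult_right_zero)
    finally show ?thesis .
  qed
  have outer: "(LINT \<xi>|lborel. gaussian (t *\<^sub>R \<xi>) * (cmod (fourier \<phi> \<xi>))\<^sup>2)
      = c * (LINT y|lborel. \<phi> y * ?A t y)" if t: "0 < t" for t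
  proof -
    let ?h = "\<lambda>y \<xi>. of_real (\<phi> y) * (gaussian (t *\<^sub>R \<xi>) * (fourier \<phi> \<xi> * cis (- (y \<bullet> \<xi>))))"
    have int: "integrable (lborel \<Otimes>\<^sub>M lborel) (\<lambda>(x, \<xi>). ?h x \<xi>)"
    proof (rule integrable_pair_bound[OF \<phi>int])
      show "integrable lborel (\<lambda>\<xi>::'a. A * gaussian (t *\<^sub>R \<xi>))" using scaled_int[OF t] by simp
      show "norm (?h y \<xi>) \<le> \<bar>\<phi> y\<bar> * \<bar>A * gaussian (t *\<^sub>R \<xi>)\<bar>" for y \<xi>
        using mult_right_mono[OF A[of \<xi>], of "\<bar>\<phi> y\<bar> * \<bar>gaussian (t *\<^sub>R \<xi>)\<bar>"] A0
        by (simp add: norm_mult abs_mult mult_ac)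
    qed measurable
    have "complex_of_real (LINT \<xi>|lborel. gaussian (t *\<^sub>R \<xi>) * (cmod (fourier \<phi> \<xi>))\<^sup>2)
      = (LINT \<xi>|lborel. of_real (gaussian (t *\<^sub>R \<xi>)) * (fourier \<phi> \<xi> * cnj (fourier \<phi> \<xi>)))"
      by (simp add: complex_norm_square[symmetric] flip: integral_complex_of_real of_real_mult of_real_power)
    also have "\<dots> = (LINT \<xi>|lborel. LINT y|lborel. ?h y \<xi>)"
    proof (rule Bochner_Integration.integral_cong[OF refl])
      fix \<xi>
      have "(LINT y|lborel. of_real (\<phi> y) * cis (- (y \<bullet> \<xi>))) = (LINT y|lborel. cnj (of_real (\<phi> y) * cis (y \<bullet> \<xi>)))"
        by (simp only: complex_cnj_mult complex_cnj_complex_of_real cis_cnj)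
      also have "\<dots> = cnj (fourier \<phi> \<xi>)" unfolding fourier_def by (rule Bochner_Integration.integral_cnj)
      finally have "cnj (fourier \<phi> \<xi>) = (LINT y|lborel. of_real (\<phi> y) * cis (- (y \<bullet> \<xi>)))" ..
      then show "of_real (gaussian (t *\<^sub>R \<xi>)) * (fourier \<phi> \<xi> * cnj (fourier \<phi> \<xi>)) = (LINT y|lborel. ?h y \<xi>)"
        by (simp add: mult_ac flip: integral_mult_right_zero)
    qed
    also have "\<dots> = (LINT y|lborel. LINT \<xi>|lborel. ?h y \<xi>)"
      by (rule lborel_pair.Fubini_integral[OF int])
    also have "\<dots> = (LINT y|lborel. of_real (\<phi> y * (c * ?A t y)))"
      by (simp add: inner[OF t])
    also have "\<dots> = of_real (c * (LINT y|lborel. \<phi> y * ?A t y))"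
      by (simp only: integral_complex_of_real mult.left_commute[of _ c] integral_mult_right_zero)
    finally show ?thesis by (simp only: of_real_eq_iff)
  qed
  define t :: "nat \<Rightarrow> real" where "t = (\<lambda>m. inverse (real (Suc m)))"
  have t: "0 < t m" for m by (simp add: t_def)
  have t_lim: "t \<longlonglongrightarrow> 0" unfolding t_def by (rule LIMSEQ_inverse_real_of_nat)
  have lim_inner: "(\<lambda>m. ?A (t m) y) \<longlonglongrightarrow> (LINT z|lborel. \<phi> y * gaussian (z :: 'a))" for y
  proof (rule integral_dominated_convergence)
    show "integrable lborel (\<lambda>z::'a. B * gaussian z)" by (intro integrable_mult_right integrable_gaussian)
    show "AE z in lborel. norm (\<phi> (y + t m *\<^sub>R z) * gaussian z) \<le> B * gaussian z" for m
      using B by (intro AE_I2) (auto simp: abs_mult intro!: mult_right_mono)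
    show "AE z in lborel. (\<lambda>m. \<phi> (y + t m *\<^sub>R z) * gaussian z) \<longlonglongrightarrow> \<phi> y * gaussian z"
    proof (rule AE_I2)
      fix z
      have "(\<lambda>m. y + t m *\<^sub>R z) \<longlonglongrightarrow> y + 0 *\<^sub>R z" by (intro tendsto_intros t_lim)
      then have "(\<lambda>m. \<phi> (y + t m *\<^sub>R z)) \<longlonglongrightarrow> \<phi> y"
        using \<open>continuous_on UNIV \<phi>\<close> by (auto simp: continuous_on_eq_continuous_at intro: isCont_tendsto_compose)
      then show "(\<lambda>m. \<phi> (y + t m *\<^sub>R z) * gaussian z) \<longlonglongrightarrow> \<phi> y * gaussian z"
        by (intro tendsto_intros)
    qed
  qed auto
  have inner_bound: "\<bar>?A (t m) y\<bar> \<le> B * c" for y m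
  proof -
    have "\<bar>?A (t m) y\<bar> \<le> (LINT z|lborel. B * gaussian (z :: 'a))"
      by (rule order_trans[OF integral_abs_bound], rule integral_mono')
        (use B in \<open>auto simp: abs_mult intro!: mult_right_mono integrable_gaussian\<close>)
    then show ?thesis by (simp add: integral_gaussian c_def)
  qed
  have "(\<lambda>m. LINT y|lborel. \<phi> y * ?A (t m) y)
      \<longlonglongrightarrow> (LINT y|lborel. \<phi> y * (LINT z|lborel. \<phi> y * gaussian (z :: 'a)))"
  proof (rule integral_dominated_convergence)
    show "integrable lborel (\<lambda>y. \<bar>\<phi> y\<bar> * (B * c))" using \<phi>int by simp
    show "AE y in lborel. norm (\<phi> y * ?A (t m) y) \<le> \<bar>\<phi> y\<bar> * (B * c)" for m
      using inner_bound by (auto simp: abs_mult intro!: mult_left_mono)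
    show "AE y in lborel. (\<lambda>m. \<phi> y * ?A (t m) y)
        \<longlonglongrightarrow> \<phi> y * (LINT z|lborel. \<phi> y * gaussian (z :: 'a))"
      by (intro AE_I2 tendsto_intros lim_inner)
  qed auto
  then have "(\<lambda>m. c * (LINT y|lborel. \<phi> y * ?A (t m) y))
      \<longlonglongrightarrow> c * (LINT y|lborel. \<phi> y * (LINT z|lborel. \<phi> y * gaussian (z :: 'a)))"
    by (intro tendsto_intros)
  moreover have "c * (LINT y|lborel. \<phi> y * (LINT z|lborel. \<phi> y * gaussian (z :: 'a)))
      = (2 * pi) ^ DIM('a) * (LINT x|lborel. (\<phi> x)\<^sup>2)"
  proof -
    have "c * c = (2 * pi) ^ DIM('a)" unfolding c_def power_mult_distrib[symmetric] by (subst real_sqrt_mult_self) simp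
    moreover have "(LINT y|lborel. \<phi> y * (LINT z|lborel. \<phi> y * gaussian (z :: 'a))) = (LINT y|lborel. (\<phi> y)\<^sup>2 * c)"
      by (simp add: integral_gaussian c_def power2_eq_square mult.assoc)
    ultimately show ?thesis by (simp add: mult_ac)
  qed
  ultimately have lim: "(\<lambda>m. LINT \<xi>|lborel. gaussian (t m *\<^sub>R \<xi>) * (cmod (fourier \<phi> \<xi>))\<^sup>2)
      \<longlonglongrightarrow> (2 * pi) ^ DIM('a) * (LINT x|lborel. (\<phi> x)\<^sup>2)"
    by (simp add: outer t)
  have int: "integrable lborel (\<lambda>\<xi>. gaussian (t m *\<^sub>R \<xi>) * (cmod (fourier \<phi> \<xi>))\<^sup>2)" for m
  proof (rule Bochner_Integration.integrable_bound)
    show "integrable lborel (\<lambda>\<xi>::'a. gaussian (t m *\<^sub>R \<xi>) * A\<^sup>2)" using scaled_int[OF t] by simp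
    show "AE \<xi> in lborel. norm (gaussian (t m *\<^sub>R \<xi>) * (cmod (fourier \<phi> \<xi>))\<^sup>2) \<le> norm (gaussian (t m *\<^sub>R \<xi>) * A\<^sup>2)"
      using A by (intro AE_I2) (auto simp: abs_mult intro!: mult_left_mono power_mono)
  qed measurable
  \<comment> \<open>The damping factors increase as the scale \<open>t m\<close> decreases, so no
    bound on the undamped integral has to be known beforehand.\<close>
  have mono: "AE \<xi> in lborel. mono (\<lambda>m. gaussian (t m *\<^sub>R \<xi>) * (cmod (fourier \<phi> \<xi>))\<^sup>2)"
  proof (intro AE_I2 monoI)
    fix \<xi> :: 'a and m l :: nat assume "m \<le> l"
    then have "t l \<le> t m" unfolding t_def by (intro le_imp_inverse_le) auto
    then have "t l * norm \<xi> \<le> t m * norm \<xi>" by (rule mult_right_mono) simp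
    then have "norm (t l *\<^sub>R \<xi>) \<le> norm (t m *\<^sub>R \<xi>)" using t[of m] t[of l] by simp
    then have "(norm (t l *\<^sub>R \<xi>))\<^sup>2 \<le> (norm (t m *\<^sub>R \<xi>))\<^sup>2" by (intro power_mono) auto
    then have "gaussian (t m *\<^sub>R \<xi>) \<le> gaussian (t l *\<^sub>R \<xi>)" unfolding gaussian_def by simp
    then show "gaussian (t m *\<^sub>R \<xi>) * (cmod (fourier \<phi> \<xi>))\<^sup>2 \<le> gaussian (t l *\<^sub>R \<xi>) * (cmod (fourier \<phi> \<xi>))\<^sup>2"
      by (intro mult_right_mono) auto
  qed
  have pw: "AE \<xi> in lborel. (\<lambda>m. gaussian (t m *\<^sub>R \<xi>) * (cmod (fourier \<phi> \<xi>))\<^sup>2) \<longlonglongrightarrow> (cmod (fourier \<phi> \<xi>))\<^sup>2"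
  proof (rule AE_I2)
    fix \<xi>
    have "(\<lambda>m. exp (- (norm (t m *\<^sub>R \<xi>))\<^sup>2 / 2) * (cmod (fourier \<phi> \<xi>))\<^sup>2)
       \<longlonglongrightarrow> exp (- (norm (0 *\<^sub>R \<xi>))\<^sup>2 / 2) * (cmod (fourier \<phi> \<xi>))\<^sup>2"
      by (intro tendsto_intros t_lim) simp
    then show "(\<lambda>m. gaussian (t m *\<^sub>R \<xi>) * (cmod (fourier \<phi> \<xi>))\<^sup>2) \<longlonglongrightarrow> (cmod (fourier \<phi> \<xi>))\<^sup>2"
      by (simp add: gaussian_def)
  qed
  show "integrable lborel (\<lambda>\<xi>. (cmod (fourier \<phi> \<xi>))\<^sup>2)"
    by (rule integrable_monotone_convergence[OF int mono pw lim]) measurable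
  show "(LINT \<xi>|lborel. (cmod (fourier \<phi> \<xi>))\<^sup>2) = (2 * pi) ^ DIM('a) * (LINT x|lborel. (\<phi> x)\<^sup>2)"
    by (rule integral_monotone_convergence[OF int mono pw lim]) measurable
qed

section \<open>Plancherel on \<open>H2_0\<close>; the two bounds on the spectral density\<close>

section \<open>Fourier transforms of functions on a bounded open set\<close>

text \<open>A chord of the unit circle, of length \<open>2 * \<bar>sin ((s - t) / 2)\<bar>\<close>,
  is at most as long as the arc.\<close>

lemma cis_diff_le: "(cos s - cos t)\<^sup>2 + (sin s - sin t)\<^sup>2 \<le> (s - t)\<^sup>2" for s t :: real
proof -
  have "(cos s - cos t)\<^sup>2 + (sin s - sin t)\<^sup>2
      = ((cos s)\<^sup>2 + (sin s)\<^sup>2) + ((cos t)\<^sup>2 + (sin t)\<^sup>2) - 2 * (cos s * cos t + sin s * sin t)"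
    by (simp add: power2_eq_square algebra_simps)
  also have "\<dots> = 2 - 2 * cos (s - t)" by (simp add: cos_diff)
  also have "\<dots> = (2 * sin ((s - t) / 2))\<^sup>2"
  proof -
    have "cos (s - t) = 1 - 2 * (sin ((s - t) / 2))\<^sup>2"
      using cos_double_sin[of "(s - t) / 2"] by (simp only: mult_2 field_sum_of_halves)
    then show ?thesis by (simp add: power_mult_distrib)
  qed
  also have "\<dots> \<le> (s - t)\<^sup>2"
    using abs_sin_x_le_abs_x[of "(s - t) / 2"] by (subst abs_le_square_iff[symmetric]) (simp add: abs_mult)
  finally show ?thesis .
qed

context bounded_open
begin

text \<open>Real and imaginary parts are \<open>L2\<close> inner products, which makes the transform
  continuous in \<open>g\<close> for each fixed \<xi> and lets Bessel's inequality act on the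
  cosines and sines.\<close>

definition Fourier_on :: "('a \<Rightarrow> real) \<Rightarrow> 'a \<Rightarrow> complex" where
  "Fourier_on g \<xi> = Complex (L2_inner \<Omega> g (\<lambda>x. cos (x \<bullet> \<xi>))) (L2_inner \<Omega> g (\<lambda>x. sin (x \<bullet> \<xi>)))"

lemma borel_measurable_on: "f \<in> borel_measurable borel \<Longrightarrow> f \<in> borel_measurable (lebesgue_on \<Omega>)"
  by (intro measurable_restrict_space1 measurable_completion) simp

lemma L2_bounded_borel: "f \<in> borel_measurable borel \<Longrightarrow> (\<And>x. x \<in> \<Omega> \<Longrightarrow> \<bar>f x\<bar> \<le> B) \<Longrightarrow> f \<in> L2 \<Omega>"
  by (rule L2_bounded[OF borel_measurable_on])

lemma L2_cos: "(\<lambda>x. cos ((x - c) \<bullet> \<xi>)) \<in> L2 \<Omega>" and L2_sin: "(\<lambda>x. sin ((x - c) \<bullet> \<xi>)) \<in> L2 \<Omega>"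
  by (rule L2_bounded_borel[of _ 1]; simp)+

lemma L2_cos0: "(\<lambda>x. cos (x \<bullet> \<xi>)) \<in> L2 \<Omega>" and L2_sin0: "(\<lambda>x. sin (x \<bullet> \<xi>)) \<in> L2 \<Omega>"
  using L2_cos[of 0 \<xi>] L2_sin[of 0 \<xi>] by simp_all

lemma Fourier_on_test:
  assumes "\<phi> \<in> test_functions \<Omega>" shows "Fourier_on \<phi> \<xi> = fourier \<phi> \<xi>"
proof -
  have b: "\<phi> \<in> borel_measurable borel" by (rule test_functions_borel[OF assms])
  have int: "integrable lborel (\<lambda>x. of_real (\<phi> x) * cis (x \<bullet> \<xi>))"
  proof -
    obtain K where K: "smooth \<phi>" "compact K" "\<And>x. x \<notin> K \<Longrightarrow> \<phi> x = 0"
      using test_functionsE[OF assms] by metis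
    show ?thesis
      by (rule integrable_lborel_compact_support[OF _ K(2)])
        (use K(3) smooth_continuous[OF K(1)] in \<open>auto intro!: continuous_intros\<close>)
  qed
  have "Re (fourier \<phi> \<xi>) = L2_inner \<Omega> \<phi> (\<lambda>x. cos (x \<bullet> \<xi>))"
    unfolding fourier_def L2_inner_def integral_Re[OF int, symmetric]
    using b test_functions_outside[OF assms] \<Omega>_borel
    by (subst lebesgue_on_lborel) auto
  moreover have "Im (fourier \<phi> \<xi>) = L2_inner \<Omega> \<phi> (\<lambda>x. sin (x \<bullet> \<xi>))"
    unfolding fourier_def L2_inner_def integral_Im[OF int, symmetric]
    using b test_functions_outside[OF assms] \<Omega>_borel
    by (subst lebesgue_on_lborel) auto
  ultimately show ?thesis by (simp add: Fourier_on_def complex_eq_iff)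
qed

lemma Fourier_on_diff:
  "u \<in> L2 \<Omega> \<Longrightarrow> v \<in> L2 \<Omega> \<Longrightarrow> Fourier_on (\<lambda>x. u x - v x) \<xi> = Fourier_on u \<xi> - Fourier_on v \<xi>"
  by (simp add: Fourier_on_def complex_eq_iff L2_inner_diff_left L2_cos0 L2_sin0)

lemma Fourier_on_tendsto:
  assumes "L2_tendsto \<Omega> \<phi> g" shows "(\<lambda>m. Fourier_on (\<phi> m) \<xi>) \<longlonglongrightarrow> Fourier_on g \<xi>"
  unfolding Fourier_on_def
  using L2_tendsto_inner[OF assms L2_cos0] L2_tendsto_inner[OF assms L2_sin0]
  by (auto simp: tendsto_complex_iff)

lemma Plancherel_test:
  assumes "\<phi> \<in> test_functions \<Omega>"
  shows "integrable lborel (\<lambda>\<xi>. (cmod (Fourier_on \<phi> \<xi>))\<^sup>2)"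
    and "(LINT \<xi>|lborel. (cmod (Fourier_on \<phi> \<xi>))\<^sup>2) = (2 * pi) ^ DIM('a) * L2_inner \<Omega> \<phi> \<phi>"
    and "Fourier_on \<phi> \<in> borel_measurable borel"
proof -
  obtain K where K: "smooth \<phi>" "compact K" "\<And>x. x \<notin> K \<Longrightarrow> \<phi> x = 0"
    using test_functionsE[OF assms] by metis
  have eq: "Fourier_on \<phi> = fourier \<phi>" using Fourier_on_test[OF assms] by blast
  note P = Plancherel_integrable[OF smooth_continuous[OF K(1)] K(2,3)] Plancherel[OF smooth_continuous[OF K(1)] K(2,3)]
  show "integrable lborel (\<lambda>\<xi>. (cmod (Fourier_on \<phi> \<xi>))\<^sup>2)" unfolding eq by (rule P)
  have "L2_inner \<Omega> \<phi> \<phi> = (LINT x|lborel. (\<phi> x)\<^sup>2)"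
    unfolding L2_inner_def power2_eq_square[symmetric]
    using test_functions_borel[OF assms] test_functions_outside[OF assms] \<Omega>_borel
    by (intro lebesgue_on_lborel) auto
  then show "(LINT \<xi>|lborel. (cmod (Fourier_on \<phi> \<xi>))\<^sup>2) = (2 * pi) ^ DIM('a) * L2_inner \<Omega> \<phi> \<phi>"
    unfolding eq using P(2) by simp
  have [measurable]: "\<phi> \<in> borel_measurable borel" by (rule test_functions_borel[OF assms])
  show "Fourier_on \<phi> \<in> borel_measurable borel" unfolding eq fourier_def[abs_def] by measurable
qed

text \<open>The transforms converge at every point, so Fatou's lemma applies. It gives only an
  inequality, but one that can be used for differences as well.\<close>

lemma Plancherel_Fatou:
  assumes \<phi>: "\<And>m. \<phi> m \<in> test_functions \<Omega>" and lim: "L2_tendsto \<Omega> \<phi> g"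
  shows "integrable lborel (\<lambda>\<xi>. (cmod (Fourier_on g \<xi>))\<^sup>2)"
    and "(LINT \<xi>|lborel. (cmod (Fourier_on g \<xi>))\<^sup>2) \<le> (2 * pi) ^ DIM('a) * L2_sq \<Omega> g"
proof -
  have [measurable]: "Fourier_on (\<phi> m) \<in> borel_measurable borel" for m
    by (rule Plancherel_test(3)[OF \<phi>])
  have [measurable]: "Fourier_on g \<in> borel_measurable borel"
    by (rule borel_measurable_LIMSEQ_metric[where f = "\<lambda>m. Fourier_on (\<phi> m)"])
      (use Fourier_on_tendsto[OF lim] in auto)
  have L: "L2_sq \<Omega> h \<ge> 0" for h by (rule L2_inner_self_nonneg)
  have nn: "(\<integral>\<^sup>+\<xi>. ennreal ((cmod (Fourier_on (\<phi> m) \<xi>))\<^sup>2) \<partial>lborel)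
      = ennreal ((2 * pi) ^ DIM('a) * L2_sq \<Omega> (\<phi> m))" for m
    using Plancherel_test[OF \<phi>[of m]] by (subst nn_integral_eq_integral) auto
  have "liminf (\<lambda>m. ennreal ((cmod (Fourier_on (\<phi> m) \<xi>))\<^sup>2)) = ennreal ((cmod (Fourier_on g \<xi>))\<^sup>2)" for \<xi>
    by (intro lim_imp_Liminf tendsto_ennrealI tendsto_intros Fourier_on_tendsto[OF lim]) simp
  then have "(\<integral>\<^sup>+\<xi>. ennreal ((cmod (Fourier_on g \<xi>))\<^sup>2) \<partial>lborel)
      = (\<integral>\<^sup>+\<xi>. liminf (\<lambda>m. ennreal ((cmod (Fourier_on (\<phi> m) \<xi>))\<^sup>2)) \<partial>lborel)" by simp
  also have "\<dots> \<le> liminf (\<lambda>m. \<integral>\<^sup>+\<xi>. ennreal ((cmod (Fourier_on (\<phi> m) \<xi>))\<^sup>2) \<partial>lborel)"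
    by (rule nn_integral_liminf) measurable
  also have "\<dots> = ennreal ((2 * pi) ^ DIM('a) * L2_sq \<Omega> g)"
    unfolding nn
    by (intro lim_imp_Liminf tendsto_ennrealI tendsto_intros L2_tendsto_norm[OF lim]) simp
  finally have le: "(\<integral>\<^sup>+\<xi>. ennreal ((cmod (Fourier_on g \<xi>))\<^sup>2) \<partial>lborel) \<le> ennreal ((2 * pi) ^ DIM('a) * L2_sq \<Omega> g)" .
  show int: "integrable lborel (\<lambda>\<xi>. (cmod (Fourier_on g \<xi>))\<^sup>2)"
    unfolding integrable_iff_bounded using le_less_trans[OF le ennreal_less_top] by simp
  show "(LINT \<xi>|lborel. (cmod (Fourier_on g \<xi>))\<^sup>2) \<le> (2 * pi) ^ DIM('a) * L2_sq \<Omega> g"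
    using le L by (subst (asm) nn_integral_eq_integral[OF int]) auto
qed

text \<open>For fixed \<open>m\<close>, the functions \<open>\<phi> m - \<phi> l\<close> are test
  functions tending to \<open>\<phi> m - g\<close>. Fatou's inequality for this limit shows that the
  transforms converge in mean square, which supplies the missing inequality.\<close>

lemma Plancherel_limit:
  assumes \<phi>: "\<And>m. \<phi> m \<in> test_functions \<Omega>" and lim: "L2_tendsto \<Omega> \<phi> g"
  shows "(LINT \<xi>|lborel. (cmod (Fourier_on g \<xi>))\<^sup>2) = (2 * pi) ^ DIM('a) * L2_sq \<Omega> g"
proof (rule antisym)
  show "(LINT \<xi>|lborel. (cmod (Fourier_on g \<xi>))\<^sup>2) \<le> (2 * pi) ^ DIM('a) * L2_sq \<Omega> g"
    by (rule Plancherel_Fatou[OF \<phi> lim])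
  let ?X = "LINT \<xi>|lborel. (cmod (Fourier_on g \<xi>))\<^sup>2"
  have L: "\<phi> m \<in> L2 \<Omega>" "g \<in> L2 \<Omega>" for m using lim by (auto simp: L2_tendsto_def)
  let ?e = "\<lambda>m. L2_sq \<Omega> (\<lambda>x. \<phi> m x - g x)"
  have diff: "integrable lborel (\<lambda>\<xi>. (cmod (Fourier_on (\<phi> m) \<xi> - Fourier_on g \<xi>))\<^sup>2) \<and>
    (LINT \<xi>|lborel. (cmod (Fourier_on (\<phi> m) \<xi> - Fourier_on g \<xi>))\<^sup>2) \<le> (2 * pi) ^ DIM('a) * ?e m" for m
  proof -
    have t: "(\<lambda>x. \<phi> m x - \<phi> l x) \<in> test_functions \<Omega>" for l
      using test_functions_add[OF \<phi>[of m] test_functions_cmult[OF \<phi>[of l], of "-1"]] by simp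
    have "L2_tendsto \<Omega> (\<lambda>l x. \<phi> m x + (-1) * \<phi> l x) (\<lambda>x. \<phi> m x + (-1) * g x)"
      by (intro L2_tendsto_add L2_tendsto_const L2_tendsto_cmult lim L)
    then have "L2_tendsto \<Omega> (\<lambda>l x. \<phi> m x - \<phi> l x) (\<lambda>x. \<phi> m x - g x)" by simp
    from Plancherel_Fatou[OF t this] show ?thesis using L by (simp add: Fourier_on_diff)
  qed
  have main: "(2 * pi) ^ DIM('a) * L2_sq \<Omega> g \<le> (1 + \<delta>) * ?X" if "0 < \<delta>" for \<delta> :: real
  proof -
    \<comment> \<open>Weighted form of the triangle inequality for squares; the weight
      \<open>1 + \<delta>\<close> on the limit tends to 1 only after \<open>m\<close> has gone to
      infinity.\<close>
    have sq: "(cmod z)\<^sup>2 \<le> (1 + \<delta>) * (cmod w)\<^sup>2 + (1 + 1 / \<delta>) * (cmod (z - w))\<^sup>2" for z w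
    proof -
      have tri: "cmod z \<le> cmod w + cmod (z - w)" using norm_triangle_ineq[of w "z - w"] by simp
      have "0 \<le> (\<delta> * cmod w - cmod (z - w))\<^sup>2 / \<delta>" using that by simp
      also have "\<dots> = \<delta> * (cmod w)\<^sup>2 + 1 / \<delta> * (cmod (z - w))\<^sup>2 - 2 * cmod w * cmod (z - w)"
        using that by (simp add: power2_diff power_mult_distrib divide_simps) (simp add: power2_eq_square algebra_simps)
      finally have "(cmod w + cmod (z - w))\<^sup>2 \<le> (1 + \<delta>) * (cmod w)\<^sup>2 + (1 + 1 / \<delta>) * (cmod (z - w))\<^sup>2"
        by (simp add: power2_sum algebra_simps)
      moreover have "(cmod z)\<^sup>2 \<le> (cmod w + cmod (z - w))\<^sup>2" using tri by (intro power_mono) auto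
      ultimately show ?thesis by linarith
    qed
    have "(2 * pi) ^ DIM('a) * L2_sq \<Omega> (\<phi> m) \<le> (1 + \<delta>) * ?X + (1 + 1 / \<delta>) * ((2 * pi) ^ DIM('a) * ?e m)" for m
    proof -
      have "(2 * pi) ^ DIM('a) * L2_sq \<Omega> (\<phi> m) = (LINT \<xi>|lborel. (cmod (Fourier_on (\<phi> m) \<xi>))\<^sup>2)"
        by (rule Plancherel_test(2)[OF \<phi>, symmetric])
      also have "\<dots> \<le> (LINT \<xi>|lborel. (1 + \<delta>) * (cmod (Fourier_on g \<xi>))\<^sup>2
          + (1 + 1 / \<delta>) * (cmod (Fourier_on (\<phi> m) \<xi> - Fourier_on g \<xi>))\<^sup>2)"
        using diff[of m] Plancherel_Fatou(1)[OF \<phi> lim] Plancherel_test(1)[OF \<phi>]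
        by (intro integral_mono sq Bochner_Integration.integrable_add integrable_mult_right) auto
      also have "\<dots> = (1 + \<delta>) * ?X + (1 + 1 / \<delta>) * (LINT \<xi>|lborel. (cmod (Fourier_on (\<phi> m) \<xi> - Fourier_on g \<xi>))\<^sup>2)"
        using diff[of m] Plancherel_Fatou(1)[OF \<phi> lim] by simp
      also have "\<dots> \<le> (1 + \<delta>) * ?X + (1 + 1 / \<delta>) * ((2 * pi) ^ DIM('a) * ?e m)"
        using diff[of m] that by (intro add_left_mono mult_left_mono) auto
      finally show ?thesis .
    qed
    moreover have "(\<lambda>m. (2 * pi) ^ DIM('a) * L2_sq \<Omega> (\<phi> m)) \<longlonglongrightarrow> (2 * pi) ^ DIM('a) * L2_sq \<Omega> g"
      by (intro tendsto_intros L2_tendsto_norm lim)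
    moreover have "(\<lambda>m. (1 + \<delta>) * ?X + (1 + 1 / \<delta>) * ((2 * pi) ^ DIM('a) * ?e m))
        \<longlonglongrightarrow> (1 + \<delta>) * ?X + (1 + 1 / \<delta>) * ((2 * pi) ^ DIM('a) * 0)"
      using lim by (intro tendsto_intros) (simp add: L2_tendsto_def)
    ultimately show ?thesis
      using LIMSEQ_le[of "\<lambda>m. (2 * pi) ^ DIM('a) * L2_sq \<Omega> (\<phi> m)"] by force
  qed
  have "((\<lambda>\<delta>. (1 + \<delta>) * ?X) \<longlongrightarrow> (1 + 0) * ?X) (at_right 0)"
    by (intro tendsto_intros)
  moreover have "\<forall>\<^sub>F \<delta> in at_right 0. (2 * pi) ^ DIM('a) * L2_sq \<Omega> g \<le> (1 + \<delta>) * ?X"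
    using main by (auto simp: eventually_at_right_field intro!: exI[of _ 1])
  ultimately show "(2 * pi) ^ DIM('a) * L2_sq \<Omega> g \<le> ?X"
    using tendsto_lowerbound[of "\<lambda>\<delta>. (1 + \<delta>) * ?X" "(1 + 0) * ?X" "at_right 0"] by simp
qed

lemma trig_has_derivative:
  "((\<lambda>x. cos (x \<bullet> \<xi>)) has_derivative (\<lambda>h. - sin (x \<bullet> \<xi>) * (h \<bullet> \<xi>))) (at x)"
  "((\<lambda>x. sin (x \<bullet> \<xi>)) has_derivative (\<lambda>h. cos (x \<bullet> \<xi>) * (h \<bullet> \<xi>))) (at x)"
  by (auto intro!: derivative_eq_intros)

lemma partial_trig:
  "partial b (\<lambda>x. cos (x \<bullet> \<xi>)) = (\<lambda>x. - (b \<bullet> \<xi>) * sin (x \<bullet> \<xi>))"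
  "partial b (\<lambda>x. sin (x \<bullet> \<xi>)) = (\<lambda>x. (b \<bullet> \<xi>) * cos (x \<bullet> \<xi>))"
  by (rule ext, rule partial_eqI[OF trig_has_derivative(1), THEN trans], simp)
     (rule ext, rule partial_eqI[OF trig_has_derivative(2), THEN trans], simp)

lemma L2_inner_partial_test:
  assumes \<phi>: "\<phi> \<in> test_functions \<Omega>" and b: "b \<in> Basis"
  shows "L2_inner \<Omega> (partial b \<phi>) (\<lambda>x. cos (x \<bullet> \<xi>)) = (b \<bullet> \<xi>) * L2_inner \<Omega> \<phi> (\<lambda>x. sin (x \<bullet> \<xi>))"
    and "L2_inner \<Omega> (partial b \<phi>) (\<lambda>x. sin (x \<bullet> \<xi>)) = - (b \<bullet> \<xi>) * L2_inner \<Omega> \<phi> (\<lambda>x. cos (x \<bullet> \<xi>))"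
proof -
  have eq: "L2_inner \<Omega> \<psi> f = (LINT x|lborel. \<psi> x * f x)"
    if "\<psi> \<in> test_functions \<Omega>" "f \<in> borel_measurable borel" for \<psi> f
    unfolding L2_inner_def using that test_functions_borel[OF that(1)] test_functions_outside[OF that(1)] \<Omega>_borel
    by (intro lebesgue_on_lborel) auto
  have d: "(\<lambda>x. cos (x \<bullet> \<xi>)) differentiable (at x)" "(\<lambda>x. sin (x \<bullet> \<xi>)) differentiable (at x)" for x
    using trig_has_derivative differentiableI by blast+
  have "(LINT x|lborel. partial b \<phi> x * cos (x \<bullet> \<xi>)) = - (LINT x|lborel. \<phi> x * partial b (\<lambda>x. cos (x \<bullet> \<xi>)) x)"
    by (rule integration_by_parts_test[OF \<phi> b d(1)]) (auto simp: partial_trig intro!: continuous_intros)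
  also have "\<dots> = (b \<bullet> \<xi>) * (LINT x|lborel. \<phi> x * sin (x \<bullet> \<xi>))"
    unfolding partial_trig by (simp add: mult.left_commute[of _ "b \<bullet> \<xi>"])
  finally show "L2_inner \<Omega> (partial b \<phi>) (\<lambda>x. cos (x \<bullet> \<xi>)) = (b \<bullet> \<xi>) * L2_inner \<Omega> \<phi> (\<lambda>x. sin (x \<bullet> \<xi>))"
    using \<phi> test_functions_partial[OF \<phi> b] by (simp add: eq)
  have "(LINT x|lborel. partial b \<phi> x * sin (x \<bullet> \<xi>)) = - (LINT x|lborel. \<phi> x * partial b (\<lambda>x. sin (x \<bullet> \<xi>)) x)"
    by (rule integration_by_parts_test[OF \<phi> b d(2)]) (auto simp: partial_trig intro!: continuous_intros)
  also have "\<dots> = - (b \<bullet> \<xi>) * (LINT x|lborel. \<phi> x * cos (x \<bullet> \<xi>))"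
    unfolding partial_trig by (simp add: mult.left_commute[of _ "b \<bullet> \<xi>"])
  finally show "L2_inner \<Omega> (partial b \<phi>) (\<lambda>x. sin (x \<bullet> \<xi>)) = - (b \<bullet> \<xi>) * L2_inner \<Omega> \<phi> (\<lambda>x. cos (x \<bullet> \<xi>))"
    using \<phi> test_functions_partial[OF \<phi> b] by (simp add: eq)
qed

lemma Fourier_on_partial_limit:
  assumes \<phi>: "\<And>m. \<phi> m \<in> test_functions \<Omega>" and "L2_tendsto \<Omega> \<phi> u"
    and "L2_tendsto \<Omega> (\<lambda>m. partial b (\<phi> m)) g" and b: "b \<in> Basis"
  shows "Fourier_on g \<xi> = - \<i> * of_real (b \<bullet> \<xi>) * Fourier_on u \<xi>"
proof (rule LIMSEQ_unique)
  show "(\<lambda>m. Fourier_on (partial b (\<phi> m)) \<xi>) \<longlonglongrightarrow> Fourier_on g \<xi>"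
    by (rule Fourier_on_tendsto) fact
  have "Fourier_on (partial b (\<phi> m)) \<xi> = - \<i> * of_real (b \<bullet> \<xi>) * Fourier_on (\<phi> m) \<xi>" for m
    using L2_inner_partial_test[OF \<phi>[of m] b] by (simp add: Fourier_on_def complex_eq_iff)
  then show "(\<lambda>m. Fourier_on (partial b (\<phi> m)) \<xi>) \<longlonglongrightarrow> - \<i> * of_real (b \<bullet> \<xi>) * Fourier_on u \<xi>"
    using assms by (auto intro!: tendsto_intros Fourier_on_tendsto)
qed

lemma sum_Basis_inner_sq: "(\<Sum>b\<in>Basis. (b \<bullet> \<xi>)\<^sup>2) = (norm (\<xi> :: 'a))\<^sup>2"
  unfolding power2_norm_eq_inner euclidean_inner[of \<xi> \<xi>] by (simp add: power2_eq_square inner_commute)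

lemma Fourier_on_sum:
  "finite J \<Longrightarrow> (\<And>i. i \<in> J \<Longrightarrow> f i \<in> L2 \<Omega>) \<Longrightarrow>
    Fourier_on (\<lambda>x. \<Sum>i\<in>J. f i x) \<xi> = (\<Sum>i\<in>J. Fourier_on (f i) \<xi>)"
  by (simp add: Fourier_on_def complex_eq_iff L2_inner_sum_left L2_cos0 L2_sin0)

text \<open>Differentiation multiplies the transform by \<open>- \<i> * (b \<bullet> \<xi>)\<close>
  and the Laplacian by \<open>- (norm \<xi>)\<^sup>2\<close>. The function, its first derivatives
  and its Laplacian are all \<open>L2\<close> limits of test functions, so Plancherel's theorem
  applies to each.\<close>

lemma H2_0_Plancherel:
  assumes "u \<in> H2_0 \<Omega>"
  shows "integrable lborel (\<lambda>\<xi>. (cmod (Fourier_on u \<xi>))\<^sup>2)"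
    and "(LINT \<xi>|lborel. (cmod (Fourier_on u \<xi>))\<^sup>2) = (2 * pi) ^ DIM('a) * L2_sq \<Omega> u"
    and "integrable lborel (\<lambda>\<xi>. norm \<xi> ^ 2 * (cmod (Fourier_on u \<xi>))\<^sup>2)"
    and "(LINT \<xi>|lborel. norm \<xi> ^ 2 * (cmod (Fourier_on u \<xi>))\<^sup>2)
      = (2 * pi) ^ DIM('a) * (\<Sum>b\<in>Basis. L2_sq \<Omega> (weak_partial \<Omega> b u))"
    and "integrable lborel (\<lambda>\<xi>. norm \<xi> ^ 4 * (cmod (Fourier_on u \<xi>))\<^sup>2)"
    and "(LINT \<xi>|lborel. norm \<xi> ^ 4 * (cmod (Fourier_on u \<xi>))\<^sup>2)
      = (2 * pi) ^ DIM('a) * L2_sq \<Omega> (weak_laplacian \<Omega> u)"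
proof -
  obtain \<phi> where "H2_approximation \<phi> u (\<lambda>b. weak_partial \<Omega> b u) (\<lambda>b c. weak_partial \<Omega> c (weak_partial \<Omega> b u))"
    using H2_0_approximation[OF assms] by blast
  then have \<phi>: "\<And>m. \<phi> m \<in> test_functions \<Omega>" and l0: "L2_tendsto \<Omega> \<phi> u"
    and l1: "\<And>b. b \<in> Basis \<Longrightarrow> L2_tendsto \<Omega> (\<lambda>m. partial b (\<phi> m)) (weak_partial \<Omega> b u)"
    and l2: "\<And>b c. b \<in> Basis \<Longrightarrow> c \<in> Basis \<Longrightarrow>
        L2_tendsto \<Omega> (\<lambda>m. partial c (partial b (\<phi> m))) (weak_partial \<Omega> c (weak_partial \<Omega> b u))"
    by (auto simp: H2_approximation_def)
  show "integrable lborel (\<lambda>\<xi>. (cmod (Fourier_on u \<xi>))\<^sup>2)" by (rule Plancherel_Fatou[OF \<phi> l0])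
  show "(LINT \<xi>|lborel. (cmod (Fourier_on u \<xi>))\<^sup>2) = (2 * pi) ^ DIM('a) * L2_sq \<Omega> u"
    by (rule Plancherel_limit[OF \<phi> l0])
  have t1: "partial b (\<phi> m) \<in> test_functions \<Omega>" if "b \<in> Basis" for b m
    using \<phi> that by (rule test_functions_partial)
  have F1: "Fourier_on (weak_partial \<Omega> b u) \<xi> = - \<i> * of_real (b \<bullet> \<xi>) * Fourier_on u \<xi>" if "b \<in> Basis" for b \<xi>
    by (rule Fourier_on_partial_limit[OF \<phi> l0 l1[OF that] that])
  have F2: "Fourier_on (weak_partial \<Omega> b (weak_partial \<Omega> b u)) \<xi> = - of_real ((b \<bullet> \<xi>)\<^sup>2) * Fourier_on u \<xi>"
    if "b \<in> Basis" for b \<xi>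
    using Fourier_on_partial_limit[OF t1[OF that] l1[OF that] l2[OF that that] that, of \<xi>]
    by (simp add: F1[OF that] power2_eq_square algebra_simps)
  have norm2: "norm \<xi> ^ 2 * (cmod (Fourier_on u \<xi>))\<^sup>2 = (\<Sum>b\<in>Basis. (cmod (Fourier_on (weak_partial \<Omega> b u) \<xi>))\<^sup>2)" for \<xi>
  proof -
    have "(\<Sum>b\<in>Basis. (cmod (Fourier_on (weak_partial \<Omega> b u) \<xi>))\<^sup>2)
        = (\<Sum>b\<in>Basis. (b \<bullet> \<xi>)\<^sup>2 * (cmod (Fourier_on u \<xi>))\<^sup>2)"
      by (intro sum.cong) (auto simp: F1 norm_mult power_mult_distrib)
    then show ?thesis by (simp add: sum_Basis_inner_sq flip: sum_distrib_right)
  qed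
  have I1: "integrable lborel (\<lambda>\<xi>. (cmod (Fourier_on (weak_partial \<Omega> b u) \<xi>))\<^sup>2)" if "b \<in> Basis" for b
    by (rule Plancherel_Fatou[OF t1[OF that] l1[OF that]])
  show "integrable lborel (\<lambda>\<xi>. norm \<xi> ^ 2 * (cmod (Fourier_on u \<xi>))\<^sup>2)"
    unfolding norm2 by (intro Bochner_Integration.integrable_sum I1)
  show "(LINT \<xi>|lborel. norm \<xi> ^ 2 * (cmod (Fourier_on u \<xi>))\<^sup>2)
      = (2 * pi) ^ DIM('a) * (\<Sum>b\<in>Basis. L2_sq \<Omega> (weak_partial \<Omega> b u))"
    unfolding norm2 sum_distrib_left
    by (subst Bochner_Integration.integral_sum[OF I1], assumption) (intro sum.cong refl Plancherel_limit[OF t1 l1])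
  have "Fourier_on (weak_laplacian \<Omega> u) \<xi> = - of_real ((norm \<xi>)\<^sup>2) * Fourier_on u \<xi>" for \<xi>
  proof -
    have "Fourier_on (weak_laplacian \<Omega> u) \<xi> = (\<Sum>b\<in>Basis. Fourier_on (weak_partial \<Omega> b (weak_partial \<Omega> b u)) \<xi>)"
      unfolding weak_laplacian_def using assms by (intro Fourier_on_sum) (auto intro: H2_0_L2(3))
    also have "\<dots> = - of_real (\<Sum>b\<in>Basis. (b \<bullet> \<xi>)\<^sup>2) * Fourier_on u \<xi>"
      by (simp add: F2 sum_distrib_right sum_negf)
    finally show ?thesis by (simp add: sum_Basis_inner_sq)
  qed
  then have norm4: "norm \<xi> ^ 4 * (cmod (Fourier_on u \<xi>))\<^sup>2 = (cmod (Fourier_on (weak_laplacian \<Omega> u) \<xi>))\<^sup>2" for \<xi>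
    by (simp add: norm_mult power_mult_distrib norm_power flip: power_mult)
  have t2: "(\<lambda>x. \<Sum>b\<in>Basis. partial b (partial b (\<phi> m)) x) \<in> test_functions \<Omega>" for m
    by (intro test_functions_sum test_functions_partial \<phi>) auto
  have lL: "L2_tendsto \<Omega> (\<lambda>m x. \<Sum>b\<in>Basis. partial b (partial b (\<phi> m)) x) (weak_laplacian \<Omega> u)"
    unfolding weak_laplacian_def by (intro L2_tendsto_sum l2) auto
  show "integrable lborel (\<lambda>\<xi>. norm \<xi> ^ 4 * (cmod (Fourier_on u \<xi>))\<^sup>2)"
    unfolding norm4 by (rule Plancherel_Fatou[OF t2 lL])
  show "(LINT \<xi>|lborel. norm \<xi> ^ 4 * (cmod (Fourier_on u \<xi>))\<^sup>2)
      = (2 * pi) ^ DIM('a) * L2_sq \<Omega> (weak_laplacian \<Omega> u)"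
    unfolding norm4 by (rule Plancherel_limit[OF t2 lL])
qed

text \<open>The function \<open>F\<close> of the overview, for the family indexed by
  \<open>J\<close>.\<close>

definition spectral_density :: "(nat \<Rightarrow> 'a \<Rightarrow> real) \<Rightarrow> nat set \<Rightarrow> 'a \<Rightarrow> real" where
  "spectral_density u J \<xi> = (\<Sum>j\<in>J. (cmod (Fourier_on (u j) \<xi>))\<^sup>2)"

text \<open>A translation of the domain only multiplies the Fourier transforms by a phase.\<close>

lemma cmod_Fourier_on_translate:
  assumes "u \<in> L2 \<Omega>"
  shows "(cmod (Fourier_on u \<xi>))\<^sup>2
    = (L2_inner \<Omega> u (\<lambda>x. cos ((x - c) \<bullet> \<xi>)))\<^sup>2 + (L2_inner \<Omega> u (\<lambda>x. sin ((x - c) \<bullet> \<xi>)))\<^sup>2"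
proof -
  let ?C = "L2_inner \<Omega> u (\<lambda>x. cos (x \<bullet> \<xi>))" and ?S = "L2_inner \<Omega> u (\<lambda>x. sin (x \<bullet> \<xi>))"
  let ?p = "cos (c \<bullet> \<xi>)" and ?q = "sin (c \<bullet> \<xi>)"
  have "L2_inner \<Omega> u (\<lambda>x. cos ((x - c) \<bullet> \<xi>)) = L2_inner \<Omega> u (\<lambda>x. ?p * cos (x \<bullet> \<xi>) + ?q * sin (x \<bullet> \<xi>))"
    by (simp add: inner_diff_left cos_diff mult.commute)
  also have "\<dots> = ?p * ?C + ?q * ?S"
    using assms by (simp add: L2_inner_add_right L2_cmult L2_cos0 L2_sin0 L2_inner_cmult_right)
  finally have 1: "L2_inner \<Omega> u (\<lambda>x. cos ((x - c) \<bullet> \<xi>)) = ?p * ?C + ?q * ?S" .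
  have "L2_inner \<Omega> u (\<lambda>x. sin ((x - c) \<bullet> \<xi>)) = L2_inner \<Omega> u (\<lambda>x. ?p * sin (x \<bullet> \<xi>) - ?q * cos (x \<bullet> \<xi>))"
    by (simp add: inner_diff_left sin_diff mult.commute)
  also have "\<dots> = ?p * ?S - ?q * ?C"
    using assms by (simp add: L2_inner_diff_right L2_cmult L2_cos0 L2_sin0 L2_inner_cmult_right)
  finally have 2: "L2_inner \<Omega> u (\<lambda>x. sin ((x - c) \<bullet> \<xi>)) = ?p * ?S - ?q * ?C" .
  have "(?p * ?C + ?q * ?S)\<^sup>2 + (?p * ?S - ?q * ?C)\<^sup>2 = (?p\<^sup>2 + ?q\<^sup>2) * (?C\<^sup>2 + ?S\<^sup>2)"
    by algebra
  then show ?thesis unfolding 1 2 by (simp add: Fourier_on_def cmod_power2)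
qed

lemma integral_one: "(LINT x|lebesgue_on \<Omega>. 1) = volume \<Omega>"
  using \<Omega>_borel by (simp add: measure_restrict_space)

lemma norm_diff_le:
  obtains R where "\<And>x. x \<in> \<Omega> \<Longrightarrow> norm (x - c) \<le> R"
proof -
  obtain R where "\<And>x. x \<in> \<Omega> \<Longrightarrow> norm x \<le> R" using bounded_\<Omega> by (auto simp: bounded_iff)
  then have "norm (x - c) \<le> R + norm c" if "x \<in> \<Omega>" for x
    using norm_triangle_ineq4[of x c] that by force
  then show ?thesis by (rule that)
qed

lemma integrable_norm_diff: "integrable (lebesgue_on \<Omega>) (\<lambda>x. (norm (x - c))\<^sup>2)"
proof -
  obtain R where "\<And>x. x \<in> \<Omega> \<Longrightarrow> norm (x - c) \<le> R" using norm_diff_le[of c] by blast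
  then have "(\<lambda>x. norm (x - c)) \<in> L2 \<Omega>" by (intro L2_bounded_borel[of _ R]) auto
  then show ?thesis by (rule L2_square_integrable)
qed

context
  fixes u J
  assumes on: "L2_orthonormal \<Omega> u J" and fin: "finite J"
begin

lemma orthonormal_L2: "j \<in> J \<Longrightarrow> u j \<in> L2 \<Omega>"
  using on by (simp add: L2_orthonormal_def)

text \<open>Bessel's inequality, applied to the cosine and to the sine of frequency \<xi>, whose
  squares add up to 1.\<close>

lemma spectral_density_le: "spectral_density u J \<xi> \<le> volume \<Omega>"
proof -
  have "spectral_density u J \<xi> = (\<Sum>j\<in>J. (L2_inner \<Omega> (u j) (\<lambda>x. cos (x \<bullet> \<xi>)))\<^sup>2)
      + (\<Sum>j\<in>J. (L2_inner \<Omega> (u j) (\<lambda>x. sin (x \<bullet> \<xi>)))\<^sup>2)"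
    by (simp add: spectral_density_def Fourier_on_def cmod_power2 sum.distrib)
  also have "\<dots> \<le> L2_sq \<Omega> (\<lambda>x. cos (x \<bullet> \<xi>))
      + L2_sq \<Omega> (\<lambda>x. sin (x \<bullet> \<xi>))"
    by (intro add_mono L2_Bessel on fin L2_cos0 L2_sin0)
  also have "\<dots> = (LINT x|lebesgue_on \<Omega>. cos (x \<bullet> \<xi>) * cos (x \<bullet> \<xi>) + sin (x \<bullet> \<xi>) * sin (x \<bullet> \<xi>))"
    unfolding L2_inner_def
    by (rule Bochner_Integration.integral_add[symmetric]; rule L2_mult_integrable; rule L2_cos0 L2_sin0)
  also have "\<dots> = volume \<Omega>"
    using integral_one by (simp add: power2_eq_square[symmetric])
  finally show ?thesis .
qed

lemma spectral_density_nonneg: "0 \<le> spectral_density u J \<xi>"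
  by (simp add: spectral_density_def sum_nonneg)

text \<open>The density is the squared length of a real vector \<open>a \<xi>\<close> with two
  entries per function, and a difference of squares is the product of
  \<open>a \<xi> - a \<eta>\<close> and \<open>a \<xi> + a \<eta>\<close>. Bessel and the chord
  bound control the first factor by the inertia about \<open>c\<close>, the upper bound of the
  density controls the second. The centre \<open>c\<close> is free because a translation does not
  change the density.\<close>

lemma spectral_density_Lipschitz:
  "(spectral_density u J \<xi> - spectral_density u J \<eta>)\<^sup>2
    \<le> 4 * volume \<Omega> * (LINT x|lebesgue_on \<Omega>. (norm (x - c))\<^sup>2) * (norm (\<xi> - \<eta>))\<^sup>2"
proof -
  define f where "f = (\<lambda>\<xi> s x. if s then cos ((x - c) \<bullet> \<xi>) else sin ((x - c) \<bullet> \<xi>))"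
  have fL: "f \<xi> s \<in> L2 \<Omega>" for \<xi> s by (cases s) (auto simp: f_def L2_cos L2_sin)
  define a where "a = (\<lambda>\<xi> (j, s). L2_inner \<Omega> (u j) (f \<xi> s))"
  have sd: "spectral_density u J \<xi> = (\<Sum>p\<in>J \<times> UNIV. (a \<xi> p)\<^sup>2)" for \<xi>
  proof -
    have "(\<Sum>p\<in>J \<times> UNIV. (a \<xi> p)\<^sup>2) = (\<Sum>j\<in>J. \<Sum>s\<in>UNIV. (L2_inner \<Omega> (u j) (f \<xi> s))\<^sup>2)"
      by (subst sum.cartesian_product) (auto intro!: sum.cong simp: a_def)
    also have "\<dots> = (\<Sum>j\<in>J. (cmod (Fourier_on (u j) \<xi>))\<^sup>2)"
      by (intro sum.cong) (auto simp: f_def UNIV_bool cmod_Fourier_on_translate[where c = c] orthonormal_L2)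
    finally show ?thesis by (simp add: spectral_density_def)
  qed
  have "spectral_density u J \<xi> - spectral_density u J \<eta> = (\<Sum>p\<in>J \<times> UNIV. (a \<xi> p - a \<eta> p) * (a \<xi> p + a \<eta> p))"
    unfolding sd sum_subtractf[symmetric] by (simp add: power2_eq_square algebra_simps)
  then have "(spectral_density u J \<xi> - spectral_density u J \<eta>)\<^sup>2
      \<le> (\<Sum>p\<in>J \<times> UNIV. (a \<xi> p - a \<eta> p)\<^sup>2) * (\<Sum>p\<in>J \<times> UNIV. (a \<xi> p + a \<eta> p)\<^sup>2)"
    by (simp add: Cauchy_Schwarz_ineq_sum)
  also have "\<dots> \<le> ((LINT x|lebesgue_on \<Omega>. (norm (x - c))\<^sup>2) * (norm (\<xi> - \<eta>))\<^sup>2) * (4 * volume \<Omega>)"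
  proof (rule mult_mono)
    have "(\<Sum>p\<in>J \<times> UNIV. (a \<xi> p - a \<eta> p)\<^sup>2)
        = (\<Sum>s\<in>UNIV. \<Sum>j\<in>J. (L2_inner \<Omega> (u j) (\<lambda>x. f \<xi> s x - f \<eta> s x))\<^sup>2)"
      by (subst sum.swap, subst sum.cartesian_product, intro sum.cong)
        (auto simp: a_def L2_inner_diff_right fL orthonormal_L2)
    also have "\<dots> \<le> (\<Sum>s\<in>UNIV. L2_sq \<Omega> (\<lambda>x. f \<xi> s x - f \<eta> s x))"
      by (intro sum_mono L2_Bessel on fin L2_diff fL)
    also have "\<dots> = (LINT x|lebesgue_on \<Omega>. (\<Sum>s\<in>UNIV. (f \<xi> s x - f \<eta> s x) * (f \<xi> s x - f \<eta> s x)))"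
      unfolding L2_inner_def
      by (rule Bochner_Integration.integral_sum[symmetric]) (intro L2_mult_integrable L2_diff fL)
    also have "\<dots> \<le> (LINT x|lebesgue_on \<Omega>. (norm (x - c))\<^sup>2 * (norm (\<xi> - \<eta>))\<^sup>2)"
    proof (rule integral_mono)
      show "integrable (lebesgue_on \<Omega>) (\<lambda>x. \<Sum>s\<in>UNIV. (f \<xi> s x - f \<eta> s x) * (f \<xi> s x - f \<eta> s x))"
        by (intro Bochner_Integration.integrable_sum L2_mult_integrable L2_diff fL)
      show "integrable (lebesgue_on \<Omega>) (\<lambda>x. (norm (x - c))\<^sup>2 * (norm (\<xi> - \<eta>))\<^sup>2)"
        using integrable_norm_diff by simp
      fix x
      have "(\<Sum>s\<in>UNIV. (f \<xi> s x - f \<eta> s x) * (f \<xi> s x - f \<eta> s x))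
          = (cos ((x - c) \<bullet> \<xi>) - cos ((x - c) \<bullet> \<eta>))\<^sup>2 + (sin ((x - c) \<bullet> \<xi>) - sin ((x - c) \<bullet> \<eta>))\<^sup>2"
        by (simp add: f_def UNIV_bool power2_eq_square)
      also have "\<dots> \<le> ((x - c) \<bullet> \<xi> - (x - c) \<bullet> \<eta>)\<^sup>2" by (rule cis_diff_le)
      also have "\<dots> = ((x - c) \<bullet> (\<xi> - \<eta>))\<^sup>2" by (simp add: inner_diff_right)
      also have "\<dots> \<le> (norm (x - c) * norm (\<xi> - \<eta>))\<^sup>2"
        using Cauchy_Schwarz_ineq2[of "x - c" "\<xi> - \<eta>"] by (metis abs_ge_zero power2_abs power_mono)
      finally show "(\<Sum>s\<in>UNIV. (f \<xi> s x - f \<eta> s x) * (f \<xi> s x - f \<eta> s x)) \<le> (norm (x - c))\<^sup>2 * (norm (\<xi> - \<eta>))\<^sup>2"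
        by (simp add: power_mult_distrib)
    qed
    finally show "(\<Sum>p\<in>J \<times> UNIV. (a \<xi> p - a \<eta> p)\<^sup>2) \<le> (LINT x|lebesgue_on \<Omega>. (norm (x - c))\<^sup>2) * (norm (\<xi> - \<eta>))\<^sup>2"
      by simp
    have "(\<Sum>p\<in>J \<times> UNIV. (a \<xi> p + a \<eta> p)\<^sup>2) \<le> (\<Sum>p\<in>J \<times> UNIV. 2 * (a \<xi> p)\<^sup>2 + 2 * (a \<eta> p)\<^sup>2)"
    proof (rule sum_mono)
      fix p show "(a \<xi> p + a \<eta> p)\<^sup>2 \<le> 2 * (a \<xi> p)\<^sup>2 + 2 * (a \<eta> p)\<^sup>2"
        using zero_le_power2[of "a \<xi> p - a \<eta> p"] by (simp add: power2_diff power2_sum)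
    qed
    also have "\<dots> = 2 * spectral_density u J \<xi> + 2 * spectral_density u J \<eta>"
      by (simp add: sd sum.distrib sum_distrib_left)
    also have "\<dots> \<le> 4 * volume \<Omega>"
      using spectral_density_le[of \<xi>] spectral_density_le[of \<eta>] by simp
    finally show "(\<Sum>p\<in>J \<times> UNIV. (a \<xi> p + a \<eta> p)\<^sup>2) \<le> 4 * volume \<Omega>" .
  qed (auto intro!: sum_nonneg mult_nonneg_nonneg Bochner_Integration.integral_nonneg)
  finally show ?thesis by (simp add: mult_ac)
qed

end

end

section \<open>Moments over balls of functions constant along rays\<close>

section \<open>Radial integrals\<close>

abbreviation unit_ball_volume :: "'a::euclidean_space itself \<Rightarrow> real" where
  "unit_ball_volume _ \<equiv> measure lborel (cball (0::'a) 1)"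

lemma cball_borel [measurable]: "cball c R \<in> sets borel"
  by simp

text \<open>The weight \<open>\<Psi>\<close> will be constant along rays, that is, a function of the
  direction alone.\<close>

definition ball_moment :: "('a::euclidean_space \<Rightarrow> real) \<Rightarrow> nat \<Rightarrow> real \<Rightarrow> real" where
  "ball_moment \<Psi> p R = (LINT x|lborel. indicator (cball 0 R) x * (norm x ^ p * \<Psi> x))"

lemma ball_moment_integrable:
  fixes \<Psi> :: "'a::euclidean_space \<Rightarrow> real"
  assumes [measurable]: "\<Psi> \<in> borel_measurable borel" and B: "\<And>x. \<bar>\<Psi> x\<bar> \<le> B"
  shows "integrable lborel (\<lambda>x. indicator (cball 0 R) x * (norm x ^ p * \<Psi> x))"
proof (rule Bochner_Integration.integrable_bound)
  show "integrable lborel (\<lambda>x::'a. indicator (cball 0 R) x *\<^sub>R (R ^ p * B))"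
    by (rule borel_integrable_compact) auto
  show "AE x in lborel. norm (indicator (cball 0 R) x * (norm x ^ p * \<Psi> x)) \<le> norm (indicator (cball 0 R) x *\<^sub>R (R ^ p * B))"
  proof (rule AE_I2)
    fix x :: 'a
    have "norm x ^ p * \<bar>\<Psi> x\<bar> \<le> \<bar>R ^ p * B\<bar>" if "norm x \<le> R"
    proof -
      have "norm x ^ p * \<bar>\<Psi> x\<bar> \<le> R ^ p * B"
        using that B order_trans[OF norm_ge_zero that] by (intro mult_mono power_mono) auto
      then show ?thesis by linarith
    qed
    then show "norm (indicator (cball 0 R) x * (norm x ^ p * \<Psi> x)) \<le> norm (indicator (cball 0 R) x *\<^sub>R (R ^ p * B))"
      by (auto simp: indicator_def abs_mult)
  qed
qed measurable

lemma ball_moment_scale: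
  fixes \<Psi> :: "'a::euclidean_space \<Rightarrow> real"
  assumes [measurable]: "\<Psi> \<in> borel_measurable borel"
    and hom: "\<And>t x. 0 < t \<Longrightarrow> \<Psi> (t *\<^sub>R x) = \<Psi> x" and "0 \<le> R"
  shows "ball_moment \<Psi> p R = R ^ (DIM('a) + p) * ball_moment \<Psi> p 1"
proof (cases "R = 0")
  case True
  have "ball_moment \<Psi> p R = (LINT x|(lborel :: 'a measure). 0)"
    unfolding ball_moment_def
  proof (rule integral_cong_AE)
    show "AE x in lborel. indicator (cball 0 R) x * (norm x ^ p * \<Psi> x) = 0"
      using AE_lborel_singleton[of "0 :: 'a"] by eventually_elim (simp add: True)
  qed (auto simp: True)
  then show ?thesis by (simp add: True)
next
  case False
  then have R: "0 < R" using \<open>0 \<le> R\<close> by simp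
  have ind: "indicator (cball 0 R) (R *\<^sub>R x) = (indicator (cball 0 1) x :: real)" for x :: 'a
    using R by (auto simp: indicator_def)
  have "ball_moment \<Psi> p R = R ^ DIM('a) *
      (LINT x|lborel. indicator (cball 0 R) (R *\<^sub>R x) * (norm (R *\<^sub>R x) ^ p * \<Psi> (R *\<^sub>R x)))"
    unfolding ball_moment_def using R by (subst lborel_integral_affine[where c = R and t = 0]) auto
  also have "(LINT x|lborel. indicator (cball 0 R) (R *\<^sub>R x) * (norm (R *\<^sub>R x) ^ p * \<Psi> (R *\<^sub>R x)))
      = (LINT x|lborel. R ^ p * (indicator (cball 0 1) x * (norm x ^ p * \<Psi> x)))"
    unfolding ind using R by (simp add: hom power_mult_distrib mult_ac)
  finally show ?thesis by (simp add: ball_moment_def power_add)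
qed

lemma power_quotient_tendsto: "((\<lambda>R::real. (1 - R ^ m) / (1 - R)) \<longlongrightarrow> real m) (at_left 1)"
proof -
  have "((\<lambda>R::real. R ^ m) has_real_derivative real m * 1 ^ (m - 1)) (at 1)"
    by (auto intro!: derivative_eq_intros)
  then have "((\<lambda>R::real. (R ^ m - 1 ^ m) / (R - 1)) \<longlongrightarrow> real m) (at 1)"
    by (simp add: has_field_derivative_iff)
  then have "((\<lambda>R::real. (R ^ m - 1 ^ m) / (R - 1)) \<longlongrightarrow> real m) (at_left 1)"
    by (rule tendsto_mono[OF at_le, rotated]) simp
  moreover have "(R ^ m - 1 ^ m) / (R - 1) = (1 - R ^ m) / (1 - R)" for R :: real
    by (metis minus_diff_eq minus_divide_divide power_one)
  ultimately show ?thesis by simp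
qed

text \<open>Comparing the shell between the radii \<open>R\<close> and \<open>1\<close> with the solid ball and letting \<open>R\<close>
  tend to \<open>1\<close> plays the role of polar coordinates.\<close>

lemma ball_moment_unit_nonneg:
  fixes \<Psi> :: "'a::euclidean_space \<Rightarrow> real"
  assumes [measurable]: "\<Psi> \<in> borel_measurable borel" and B: "\<And>x. \<bar>\<Psi> x\<bar> \<le> B"
    and hom: "\<And>t x. 0 < t \<Longrightarrow> \<Psi> (t *\<^sub>R x) = \<Psi> x" and nn: "\<And>x. 0 \<le> \<Psi> x"
  shows "(real DIM('a) + real p) * ball_moment \<Psi> p 1 = real DIM('a) * ball_moment \<Psi> 0 1"
proof -
  let ?n = "DIM('a)"
  let ?s = "\<lambda>R x. indicator (cball 0 1) x - indicator (cball 0 R) x :: real"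
  note int = ball_moment_integrable[OF assms(1) B]
  have scale: "ball_moment \<Psi> q R = R ^ (?n + q) * ball_moment \<Psi> q 1" if "0 \<le> R" for q R
    using assms(1) hom that by (rule ball_moment_scale)
  have shell: "(LINT x|lborel. ?s R x * (norm x ^ q * \<Psi> x)) = (1 - R ^ (?n + q)) * ball_moment \<Psi> q 1"
    if "0 \<le> R" for q R
    using scale[OF that, of q] int by (simp add: left_diff_distrib flip: ball_moment_def)
  have shell_int: "integrable lborel (\<lambda>x. ?s R x * (norm x ^ q * \<Psi> x))" for q R
    using int[of 1 q] int[of R q] by (simp add: left_diff_distrib)
  have le1: "(1 - R ^ (?n + p)) * ball_moment \<Psi> p 1 \<le> (1 - R ^ ?n) * ball_moment \<Psi> 0 1"
    and le2: "R ^ p * ((1 - R ^ ?n) * ball_moment \<Psi> 0 1) \<le> (1 - R ^ (?n + p)) * ball_moment \<Psi> p 1"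
    if R: "0 < R" "R < 1" for R
  proof -
    \<comment> \<open>On the shell \<open>R ^ p \<le> norm x ^ p \<le> 1\<close>. Integration
      squeezes the shell moment of order \<open>p\<close> against that of order 0, and division by
      \<open>1 - R\<close> turns the scaling factors into \<open>n + p\<close> and \<open>n\<close>
      in the limit.\<close>
    have s: "?s R x * (norm x ^ p * \<Psi> x) \<le> ?s R x * (norm x ^ 0 * \<Psi> x)"
      "R ^ p * (?s R x * (norm x ^ 0 * \<Psi> x)) \<le> ?s R x * (norm x ^ p * \<Psi> x)" for x
    proof -
      have "R ^ p \<le> norm x ^ p" if "R < norm x" using R that by (intro power_mono) auto
      moreover have "norm x ^ p \<le> 1" if "norm x \<le> 1" using that by (simp add: power_le_one)
      ultimately show "?s R x * (norm x ^ p * \<Psi> x) \<le> ?s R x * (norm x ^ 0 * \<Psi> x)"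
        "R ^ p * (?s R x * (norm x ^ 0 * \<Psi> x)) \<le> ?s R x * (norm x ^ p * \<Psi> x)"
        using R nn[of x] by (auto simp: indicator_def mult_right_mono mult_left_le_one_le)
    qed
    have "(LINT x|lborel. ?s R x * (norm x ^ p * \<Psi> x)) \<le> (LINT x|lborel. ?s R x * (norm x ^ 0 * \<Psi> x))"
      by (rule integral_mono[OF shell_int shell_int s(1)])
    then show "(1 - R ^ (?n + p)) * ball_moment \<Psi> p 1 \<le> (1 - R ^ ?n) * ball_moment \<Psi> 0 1"
      using shell[of R p] shell[of R 0] R by simp
    have "(LINT x|lborel. R ^ p * (?s R x * (norm x ^ 0 * \<Psi> x))) \<le> (LINT x|lborel. ?s R x * (norm x ^ p * \<Psi> x))"
      by (rule integral_mono[OF integrable_mult_right[OF shell_int] shell_int s(2)])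
    then show "R ^ p * ((1 - R ^ ?n) * ball_moment \<Psi> 0 1) \<le> (1 - R ^ (?n + p)) * ball_moment \<Psi> p 1"
      unfolding integral_mult_right_zero using shell[of R p] shell[of R 0] R by simp
  qed
  let ?q = "\<lambda>m R. (1 - R ^ m) / (1 - R) :: real"
  have ev: "\<forall>\<^sub>F R in at_left 1. 0 < R \<and> R < (1::real)"
    by (auto simp: eventually_at_left_field intro!: exI[of _ 0])
  have A: "((\<lambda>R. ?q (?n + p) R * ball_moment \<Psi> p 1) \<longlongrightarrow> real (?n + p) * ball_moment \<Psi> p 1) (at_left 1)"
    by (intro tendsto_mult power_quotient_tendsto tendsto_const)
  have C: "((\<lambda>R. ?q ?n R * ball_moment \<Psi> 0 1) \<longlongrightarrow> real ?n * ball_moment \<Psi> 0 1) (at_left 1)"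
    by (intro tendsto_mult power_quotient_tendsto tendsto_const)
  have D: "((\<lambda>R. R ^ p * (?q ?n R * ball_moment \<Psi> 0 1)) \<longlongrightarrow> 1 ^ p * (real ?n * ball_moment \<Psi> 0 1)) (at_left 1)"
    by (intro tendsto_mult[OF _ C] tendsto_power tendsto_ident_at)
  have "real (?n + p) * ball_moment \<Psi> p 1 \<le> real ?n * ball_moment \<Psi> 0 1"
  proof (rule tendsto_le[OF _ C A])
    show "\<forall>\<^sub>F R in at_left 1. ?q (?n + p) R * ball_moment \<Psi> p 1 \<le> ?q ?n R * ball_moment \<Psi> 0 1"
      using ev
    proof eventually_elim
      case (elim R)
      then show ?case using divide_right_mono[OF le1[of R], of "1 - R"] by simp
    qed
  qed simp
  moreover have "1 ^ p * (real ?n * ball_moment \<Psi> 0 1) \<le> real (?n + p) * ball_moment \<Psi> p 1"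
  proof (rule tendsto_le[OF _ A D])
    show "\<forall>\<^sub>F R in at_left 1. R ^ p * (?q ?n R * ball_moment \<Psi> 0 1) \<le> ?q (?n + p) R * ball_moment \<Psi> p 1"
      using ev
    proof eventually_elim
      case (elim R)
      then show ?case using divide_right_mono[OF le2[of R], of "1 - R"] by simp
    qed
  qed simp
  ultimately show ?thesis by simp
qed

text \<open>The claim is linear in \<open>\<Psi>\<close>, so the nonnegative case, applied to
  \<open>\<Psi> + B\<close> and to the constant \<open>B\<close>, settles bounded weights of any
  sign.\<close>

lemma ball_moment_eq:
  fixes \<Psi> :: "'a::euclidean_space \<Rightarrow> real"
  assumes [measurable]: "\<Psi> \<in> borel_measurable borel" and B: "\<And>x. \<bar>\<Psi> x\<bar> \<le> B"
    and hom: "\<And>t x. 0 < t \<Longrightarrow> \<Psi> (t *\<^sub>R x) = \<Psi> x" and R: "0 \<le> R"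
  shows "ball_moment \<Psi> p R = real DIM('a) / (real DIM('a) + real p) * R ^ (DIM('a) + p) * ball_moment \<Psi> 0 1"
proof -
  have n: "0 < real DIM('a)" by simp
  have int: "integrable lborel (\<lambda>x. indicator (cball 0 1) x * (norm x ^ q * \<Psi> x))" for q
    by (rule ball_moment_integrable[OF assms(1) B])
  have int1: "integrable lborel (\<lambda>x::'a. indicator (cball 0 1) x * (norm x ^ q * B))" for q
    by (rule ball_moment_integrable[of "\<lambda>_. B" "\<bar>B\<bar>"]) auto
  have add: "ball_moment (\<lambda>x. \<Psi> x + B) q 1 = ball_moment \<Psi> q 1 + ball_moment (\<lambda>_::'a. B) q 1" for q
    unfolding ball_moment_def using int int1 by (simp add: distrib_left)
  have "(real DIM('a) + real p) * ball_moment (\<lambda>x. \<Psi> x + B) p 1 = real DIM('a) * ball_moment (\<lambda>x. \<Psi> x + B) 0 1"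
  proof (rule ball_moment_unit_nonneg)
    show "\<bar>\<Psi> x + B\<bar> \<le> 2 * B" "0 \<le> \<Psi> x + B" for x using B[of x] by auto
  qed (auto simp: hom)
  moreover have "(real DIM('a) + real p) * ball_moment (\<lambda>_::'a. B) p 1 = real DIM('a) * ball_moment (\<lambda>_::'a. B) 0 1"
    using order_trans[OF abs_ge_zero B] by (intro ball_moment_unit_nonneg[where B = B]) auto
  ultimately have "(real DIM('a) + real p) * ball_moment \<Psi> p 1 = real DIM('a) * ball_moment \<Psi> 0 1"
    unfolding add by (simp add: algebra_simps)
  then have "ball_moment \<Psi> p 1 = real DIM('a) / (real DIM('a) + real p) * ball_moment \<Psi> 0 1"
    using n by (subst times_divide_eq_left, subst nonzero_eq_divide_eq) (linarith, simp only: mult.commute)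
  then show ?thesis using ball_moment_scale[OF assms(1) hom R, of p] by simp
qed

lemma ball_moment_one:
  assumes "0 \<le> R"
  shows "ball_moment (\<lambda>_::'a::euclidean_space. 1) p R
    = real DIM('a) / (real DIM('a) + real p) * R ^ (DIM('a) + p) * unit_ball_volume TYPE('a)"
proof -
  have "ball_moment (\<lambda>_::'a. 1) 0 1 = unit_ball_volume TYPE('a)"
    by (simp add: ball_moment_def)
  then show ?thesis using ball_moment_eq[of "\<lambda>_::'a. 1" 1 R p] assms by simp
qed

lemma unit_ball_volume_pos: "0 < unit_ball_volume TYPE('a::euclidean_space)"
  using content_cball_pos[of 1 "0 :: 'a"] by simp

section \<open>The truncated cone has the least moments for its mass\<close>

section \<open>Comparison with a truncated cone\<close>

text \<open>\<open>A\<close> is the radius of the plateau and \<open>B\<close> that of the support;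
  \<open>B_def\<close> says that slope \<open>\<rho>\<close> leads from height \<open>M\<close> down
  to 0 between them.\<close>

locale truncated_cone =
  fixes F :: "'a::euclidean_space \<Rightarrow> real" and M \<rho> A B :: real
  assumes F_nonneg: "\<And>\<xi>. 0 \<le> F \<xi>" and F_le: "\<And>\<xi>. F \<xi> \<le> M"
    and F_Lipschitz: "\<And>\<xi> \<eta>. \<bar>F \<xi> - F \<eta>\<bar> \<le> \<rho> * norm (\<xi> - \<eta>)"
    and F_integrable: "integrable lborel F"
    and A_nonneg: "0 \<le> A" and M_pos: "0 < M" and \<rho>_pos: "0 < \<rho>" and B_def: "B = A + M / \<rho>"
begin

definition profile :: "real \<Rightarrow> real" where
  "profile s = (if s \<le> A then M else if s \<le> B then \<rho> * (B - s) else 0)"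

lemma AB: "A < B" "\<rho> * (B - A) = M"
  using M_pos \<rho>_pos by (auto simp: B_def)

lemma profile_between: "A \<le> s \<Longrightarrow> s \<le> B \<Longrightarrow> profile s = \<rho> * (B - s)"
  using AB by (auto simp: profile_def)

lemma profile_moment:
  "integrable lborel (\<lambda>\<xi>::'a. norm \<xi> ^ p * profile (norm \<xi>))"
  "(LINT \<xi>|lborel. norm (\<xi>::'a) ^ p * profile (norm \<xi>)) = real DIM('a) * unit_ball_volume TYPE('a) * \<rho>
     * (B ^ (DIM('a) + p + 1) - A ^ (DIM('a) + p + 1)) / ((real DIM('a) + real p) * (real DIM('a) + real p + 1))"
proof -
  let ?I = "\<lambda>q R (\<xi>::'a). indicator (cball 0 R) \<xi> * (norm \<xi> ^ q * 1) :: real"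
  have B0: "0 \<le> B" using AB A_nonneg by simp
  \<comment> \<open>The truncated cone is the difference of two full cones of slope
    \<open>\<rho>\<close>, with radii \<open>B\<close> and \<open>A\<close>, so its moments are
    combinations of ball moments.\<close>
  have eq: "norm \<xi> ^ p * profile (norm \<xi>)
      = \<rho> * (?I (p + 1) A \<xi> - A * ?I p A \<xi> + B * ?I p B \<xi> - ?I (p + 1) B \<xi>)" for \<xi> :: 'a
  proof -
    have pr: "profile s = (if s \<le> A then \<rho> * (B - A) else if s \<le> B then \<rho> * (B - s) else 0)" for s
      by (simp add: profile_def AB)
    show ?thesis unfolding pr using AB(1) by (auto simp: indicator_def algebra_simps)
  qed
  have int: "integrable lborel (?I q R)" for q R
    by (rule ball_moment_integrable[of "\<lambda>_. 1" 1]) auto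
  show "integrable lborel (\<lambda>\<xi>::'a. norm \<xi> ^ p * profile (norm \<xi>))"
    unfolding eq using int
    by (intro integrable_mult_right Bochner_Integration.integrable_add Bochner_Integration.integrable_diff)
  let ?n = "DIM('a)" and ?\<omega> = "unit_ball_volume TYPE('a)"
  have "(LINT \<xi>|lborel. norm (\<xi>::'a) ^ p * profile (norm \<xi>))
      = \<rho> * (ball_moment (\<lambda>_::'a. 1) (p + 1) A - A * ball_moment (\<lambda>_::'a. 1) p A
        + B * ball_moment (\<lambda>_::'a. 1) p B - ball_moment (\<lambda>_::'a. 1) (p + 1) B)"
    unfolding eq ball_moment_def
    by (subst integral_mult_right_zero, subst Bochner_Integration.integral_diff,
      (intro int integrable_mult_right Bochner_Integration.integrable_add Bochner_Integration.integrable_diff)+,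
      subst Bochner_Integration.integral_add,
      (intro int integrable_mult_right Bochner_Integration.integrable_add Bochner_Integration.integrable_diff)+,
      subst Bochner_Integration.integral_diff,
      (intro int integrable_mult_right Bochner_Integration.integrable_add Bochner_Integration.integrable_diff)+,
      simp only: integral_mult_right_zero)
  also have "\<dots> = \<rho> * (real ?n * ?\<omega>) * ((B ^ (?n + p + 1) - A ^ (?n + p + 1)) * (1 / (real ?n + real p) - 1 / (real ?n + real p + 1)))"
    using A_nonneg B0 by (simp add: ball_moment_one algebra_simps)
  also have "1 / (real ?n + real p) - 1 / (real ?n + real p + 1) = 1 / ((real ?n + real p) * (real ?n + real p + 1))"
  proof -
    have "real ?n + real p \<noteq> 0" "real ?n + real p + 1 \<noteq> 0" using DIM_positive[where 'a='a] by linarith+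
    then show ?thesis by (simp add: field_simps)
  qed
  finally show "(LINT \<xi>|lborel. norm (\<xi>::'a) ^ p * profile (norm \<xi>)) = real ?n * ?\<omega> * \<rho>
     * (B ^ (?n + p + 1) - A ^ (?n + p + 1)) / ((real ?n + real p) * (real ?n + real p + 1))"
    by simp
qed

text \<open>\<open>s\<^sub>0\<close> is chosen so that \<open>s ^ p - s\<^sub>0 ^ p\<close> has mean zero over the shell on which the cone
  has its slope. There \<open>F - profile\<close> grows along every ray, hence
  \<open>(F - profile) * (s ^ p - s\<^sub>0 ^ p)\<close> is at least its value with \<open>F - profile\<close>
  frozen at radius \<open>s\<^sub>0\<close>, which integrates to zero.\<close>

lemma moment_comparison:
  assumes p: "0 < p" and Fp: "integrable lborel (\<lambda>\<xi>. norm \<xi> ^ p * F \<xi>)"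
    and mass: "(LINT \<xi>|lborel. F \<xi>) = (LINT \<xi>|lborel. profile (norm (\<xi>::'a)))"
  shows "(LINT \<xi>|lborel. norm \<xi> ^ p * F \<xi>) \<ge> (LINT \<xi>|lborel. norm (\<xi>::'a) ^ p * profile (norm \<xi>))"
proof -
  let ?n = "DIM('a)" and ?\<omega> = "unit_ball_volume TYPE('a)"
  have B0: "0 < B" using AB A_nonneg by simp
  have [measurable]: "F \<in> borel_measurable borel" using F_integrable by auto
  define sh :: "'a \<Rightarrow> real" where "sh = (\<lambda>\<xi>. indicator (cball 0 B) \<xi> - indicator (cball 0 A) \<xi>)"
  have sh: "sh \<xi> = (if A < norm \<xi> \<and> norm \<xi> \<le> B then 1 else 0)" for \<xi>
    using AB by (auto simp: sh_def indicator_def)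
  have [measurable]: "sh \<in> borel_measurable borel" unfolding sh_def
    by (intro borel_measurable_diff borel_measurable_indicator) auto
  have shell_int: "integrable lborel (\<lambda>x. sh x * (norm x ^ q * \<Psi> x))"
    if "\<Psi> \<in> borel_measurable borel" "\<And>x. \<bar>\<Psi> x\<bar> \<le> C" for q \<Psi> C
    using ball_moment_integrable[OF that, of B q] ball_moment_integrable[OF that, of A q]
    by (simp add: sh_def left_diff_distrib)
  have shell: "(LINT x|lborel. sh x * (norm x ^ q * \<Psi> x))
      = real ?n / (real ?n + real q) * (B ^ (?n + q) - A ^ (?n + q)) * ball_moment \<Psi> 0 1"
    if "\<Psi> \<in> borel_measurable borel" "\<And>x. \<bar>\<Psi> x\<bar> \<le> C" "\<And>t x. 0 < t \<Longrightarrow> \<Psi> (t *\<^sub>R x) = \<Psi> x" for q \<Psi> C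
  proof -
    have "(LINT x|lborel. sh x * (norm x ^ q * \<Psi> x)) = ball_moment \<Psi> q B - ball_moment \<Psi> q A"
      using ball_moment_integrable[OF that(1,2), of B q] ball_moment_integrable[OF that(1,2), of A q]
      by (simp add: sh_def left_diff_distrib ball_moment_def)
    also have "\<dots> = real ?n / (real ?n + real q) * (B ^ (?n + q) - A ^ (?n + q)) * ball_moment \<Psi> 0 1"
    proof -
      have *: "ball_moment \<Psi> q R = real ?n / (real ?n + real q) * R ^ (?n + q) * ball_moment \<Psi> 0 1"
        if "0 \<le> R" for R
        using \<open>\<Psi> \<in> _\<close> \<open>\<And>x. \<bar>\<Psi> x\<bar> \<le> C\<close> \<open>\<And>t x. 0 < t \<Longrightarrow> \<Psi> (t *\<^sub>R x) = \<Psi> x\<close> that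
        by (rule ball_moment_eq)
      show ?thesis unfolding *[OF less_imp_le[OF B0]] *[OF A_nonneg] by (simp add: algebra_simps)
    qed
    finally show ?thesis .
  qed
  define a0 where "a0 = B ^ ?n - A ^ ?n"
  define ap where "ap = real ?n / (real ?n + real p) * (B ^ (?n + p) - A ^ (?n + p))"
  have a0: "0 < a0" unfolding a0_def using AB A_nonneg by (simp add: power_strict_mono)
  \<comment> \<open>The mean of \<open>norm x ^ p\<close> over the shell. It lies between
    \<open>A ^ p\<close> and \<open>B ^ p\<close>, which puts its root \<open>s0\<close> between
    \<open>A\<close> and \<open>B\<close>.\<close>
  define \<sigma> where "\<sigma> = ap / a0"
  have one0: "(LINT x|lborel. sh x) = a0 * ?\<omega>"
    using shell[of "\<lambda>_. 1" 1 0] by (simp add: ball_moment_one a0_def)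
  have onep: "(LINT x|lborel. sh x * norm x ^ p) = ap * ?\<omega>"
    using shell[of "\<lambda>_. 1" 1 p] by (simp add: ball_moment_one ap_def)
  have int0: "integrable lborel sh" using shell_int[of "\<lambda>_. 1" 1 0] by simp
  have intp: "integrable lborel (\<lambda>x. sh x * norm x ^ p)" using shell_int[of "\<lambda>_. 1" 1 p] by simp
  have "(LINT x|lborel. A ^ p * sh x) \<le> (LINT x|lborel. sh x * norm x ^ p)"
  proof (rule integral_mono[OF integrable_mult_right[OF int0] intp])
    show "A ^ p * sh x \<le> sh x * norm x ^ p" for x
      using A_nonneg by (auto simp: sh intro!: power_mono)
  qed
  then have "A ^ p * (a0 * ?\<omega>) \<le> ap * ?\<omega>" by (simp add: one0 onep)
  then have \<sigma>A: "A ^ p \<le> \<sigma>"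
    using unit_ball_volume_pos[where 'a='a] a0 by (simp add: \<sigma>_def field_simps)
  have "(LINT x|lborel. sh x * norm x ^ p) \<le> (LINT x|lborel. B ^ p * sh x)"
  proof (rule integral_mono[OF intp integrable_mult_right[OF int0]])
    show "sh x * norm x ^ p \<le> B ^ p * sh x" for x
      by (auto simp: sh intro!: power_mono)
  qed
  then have "ap * ?\<omega> \<le> B ^ p * (a0 * ?\<omega>)" by (simp add: one0 onep)
  then have \<sigma>B: "\<sigma> \<le> B ^ p"
    using unit_ball_volume_pos[where 'a='a] a0 by (simp add: \<sigma>_def field_simps)
  define s0 where "s0 = root p \<sigma>"
  have \<sigma>0: "0 \<le> \<sigma>" using \<sigma>A A_nonneg by (meson order_trans zero_le_power)
  have s0: "s0 ^ p = \<sigma>" "0 \<le> s0" using p \<sigma>0 by (auto simp: s0_def)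
  have s0A: "A \<le> s0" using p A_nonneg \<sigma>A unfolding s0_def by (metis real_root_le_iff real_root_power_cancel)
  have s0B: "s0 \<le> B" using p B0 \<sigma>B unfolding s0_def by (metis less_imp_le real_root_le_iff real_root_power_cancel)
  \<comment> \<open>\<open>D\<close> is constant along rays, so its integral against
    \<open>norm x ^ p - \<sigma>\<close> over the shell is an angular factor times a radial one, and
    the radial one vanishes by the choice of \<open>\<sigma>\<close>.\<close>
  define D where "D = (\<lambda>\<xi>. F ((s0 / norm \<xi>) *\<^sub>R \<xi>) - profile s0)"
  have [measurable]: "D \<in> borel_measurable borel" unfolding D_def by measurable
  have D_hom: "D (t *\<^sub>R x) = D x" if "0 < t" for t x using that by (simp add: D_def)
  have D_bound: "\<bar>D x\<bar> \<le> 2 * M" for x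
  proof -
    have "0 \<le> \<rho> * (B - s0)" "\<rho> * (B - s0) \<le> \<rho> * (B - A)"
      using s0A s0B \<rho>_pos by (auto intro: mult_left_mono)
    then show ?thesis
      using F_nonneg[of "(s0 / norm x) *\<^sub>R x"] F_le[of "(s0 / norm x) *\<^sub>R x"] M_pos
      unfolding D_def profile_between[OF s0A s0B] AB(2) abs_le_iff by linarith
  qed
  have zero: "(LINT x|lborel. sh x * (norm x ^ p * D x) - \<sigma> * (sh x * (norm x ^ 0 * D x))) = 0"
  proof -
    have "(LINT x|lborel. sh x * (norm x ^ p * D x) - \<sigma> * (sh x * (norm x ^ 0 * D x)))
      = ap * ball_moment D 0 1 - \<sigma> * (a0 * ball_moment D 0 1)"
      by (subst Bochner_Integration.integral_diff)
        (simp_all only: integrable_mult_right shell_int[OF \<open>D \<in> _\<close> D_bound] integral_mult_right_zero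
          shell[OF \<open>D \<in> _\<close> D_bound D_hom], simp_all add: ap_def a0_def)
    then show ?thesis using a0 by (simp add: \<sigma>_def)
  qed
  have pw: "sh x * (norm x ^ p * D x) - \<sigma> * (sh x * (norm x ^ 0 * D x))
      \<le> (norm x ^ p * F x - norm x ^ p * profile (norm x)) - \<sigma> * (F x - norm x ^ 0 * profile (norm x))"
    if "x \<noteq> 0" for x
  proof -
    let ?s = "norm x"
    have "x - (s0 / ?s) *\<^sub>R x = (1 - s0 / ?s) *\<^sub>R x" by (simp add: algebra_simps)
    then have "norm (x - (s0 / ?s) *\<^sub>R x) = \<bar>1 - s0 / ?s\<bar> * \<bar>?s\<bar>" by simp
    also have "\<dots> = \<bar>(1 - s0 / ?s) * ?s\<bar>" by (rule abs_mult[symmetric])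
    also have "(1 - s0 / ?s) * ?s = ?s - s0" using that by (simp add: left_diff_distrib)
    finally have dist: "norm (x - (s0 / ?s) *\<^sub>R x) = \<bar>?s - s0\<bar>" .
    have goal: "sh x * D x * (?s ^ p - \<sigma>) \<le> (F x - profile ?s) * (?s ^ p - \<sigma>)"
    proof -
      \<comment> \<open>On the plateau \<open>F \<le> M\<close> and
        \<open>?s ^ p \<le> \<sigma>\<close>; beyond \<open>B\<close>, \<open>F \<ge> 0\<close> and
        \<open>?s ^ p \<ge> \<sigma>\<close>: both times the product has the right sign. On the
        slope, \<open>F\<close> falls along the ray no faster than the cone, so
        \<open>F - profile\<close> is at most \<open>D\<close> before \<open>s0\<close> and at least
        \<open>D\<close> after it.\<close>
      consider "?s \<le> A" | "A < ?s" "?s \<le> B" "?s \<le> s0" | "A < ?s" "?s \<le> B" "s0 \<le> ?s" | "B < ?s" by linarith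
      then show ?thesis
      proof cases
        case 1
        then have "?s ^ p \<le> A ^ p" by (intro power_mono) auto
        then have "0 \<le> (M - F x) * (\<sigma> - ?s ^ p)" using F_le[of x] \<sigma>A by (intro mult_nonneg_nonneg) auto
        then show ?thesis using 1 by (simp add: sh profile_def algebra_simps)
      next
        case 4
        then have "B ^ p \<le> ?s ^ p" using B0 by (intro power_mono) auto
        then have "0 \<le> F x * (?s ^ p - \<sigma>)" using F_nonneg[of x] \<sigma>B by (intro mult_nonneg_nonneg) auto
        then show ?thesis using 4 AB by (simp add: sh profile_def)
      next
        case 2
        have "norm (x - (s0 / ?s) *\<^sub>R x) = s0 - ?s" using dist 2 by simp
        then have "\<bar>F x - F ((s0 / ?s) *\<^sub>R x)\<bar> \<le> \<rho> * (s0 - ?s)"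
          using F_Lipschitz[of x "(s0 / ?s) *\<^sub>R x"] by simp
        moreover have "profile ?s - profile s0 = \<rho> * (s0 - ?s)"
          using profile_between[of ?s] profile_between[OF s0A s0B] 2 by (simp add: right_diff_distrib)
        ultimately have "F x - profile ?s \<le> D x"
          unfolding D_def right_diff_distrib abs_le_iff by linarith
        moreover have "?s ^ p \<le> \<sigma>" using 2 s0 by (metis norm_ge_zero power_mono)
        ultimately show ?thesis using 2 by (simp add: sh mult_right_mono_neg)
      next
        case 3
        have "norm (x - (s0 / ?s) *\<^sub>R x) = ?s - s0" using dist 3 by simp
        then have "\<bar>F x - F ((s0 / ?s) *\<^sub>R x)\<bar> \<le> \<rho> * (?s - s0)"
          using F_Lipschitz[of x "(s0 / ?s) *\<^sub>R x"] by simp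
        moreover have "profile ?s - profile s0 = \<rho> * (s0 - ?s)"
          using profile_between[of ?s] profile_between[OF s0A s0B] 3 by (simp add: right_diff_distrib)
        ultimately have "D x \<le> F x - profile ?s"
          unfolding D_def right_diff_distrib abs_le_iff by linarith
        moreover have "\<sigma> \<le> ?s ^ p" using 3 s0 by (metis power_mono)
        ultimately show ?thesis using 3 by (simp add: sh mult_right_mono)
      qed
    qed
    then show ?thesis by (simp add: algebra_simps)
  qed
  note P = profile_moment(1)[of p] profile_moment(1)[of 0]
  have "0 \<le> (LINT x|lborel. (norm x ^ p * F x - norm x ^ p * profile (norm x)) - \<sigma> * (F x - norm x ^ 0 * profile (norm x)))"
    unfolding zero[symmetric]
  proof (rule integral_mono_AE)
    show "integrable lborel (\<lambda>x. sh x * (norm x ^ p * D x) - \<sigma> * (sh x * (norm x ^ 0 * D x)))"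
      by (intro Bochner_Integration.integrable_diff integrable_mult_right shell_int[OF \<open>D \<in> _\<close> D_bound])
    show "integrable lborel (\<lambda>x. (norm x ^ p * F x - norm x ^ p * profile (norm x)) - \<sigma> * (F x - norm x ^ 0 * profile (norm x)))"
      by (intro Bochner_Integration.integrable_diff integrable_mult_right P Fp F_integrable)
    show "AE x in lborel. sh x * (norm x ^ p * D x) - \<sigma> * (sh x * (norm x ^ 0 * D x))
      \<le> (norm x ^ p * F x - norm x ^ p * profile (norm x)) - \<sigma> * (F x - norm x ^ 0 * profile (norm x))"
      using AE_lborel_singleton[of "0 :: 'a"] by eventually_elim (rule pw)
  qed
  also have "\<dots> = (LINT x|lborel. norm x ^ p * F x) - (LINT x|lborel. norm (x::'a) ^ p * profile (norm x))
      - \<sigma> * ((LINT x|lborel. F x) - (LINT x|lborel. norm (x::'a) ^ 0 * profile (norm x)))"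
    using P Fp F_integrable by simp
  finally show ?thesis using mass by simp
qed

end

section \<open>Among sets of given volume the ball has the least inertia\<close>

section \<open>The moment of inertia\<close>

text \<open>Bathtub principle: \<open>norm y ^ 2 - R\<^sup>2\<close> is nonpositive on the ball of
  radius \<open>R\<close> and nonnegative off it, so replacing the translated set by the ball of
  equal volume cannot raise the integral.\<close>

lemma inertia_lower_bound:
  fixes \<Omega> :: "'a::euclidean_space set"
  assumes "open \<Omega>" "bounded \<Omega>" and R: "0 \<le> R" "unit_ball_volume TYPE('a) * R ^ DIM('a) = volume \<Omega>"
  shows "(LINT x|lebesgue_on \<Omega>. (norm (x - c))\<^sup>2) \<ge> real DIM('a) / (real DIM('a) + 2) * volume \<Omega> * R\<^sup>2"
proof -
  interpret bounded_open \<Omega> by standard (use assms in auto)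
  define \<kappa> :: "'a \<Rightarrow> real" where "\<kappa> = (\<lambda>y. indicator \<Omega> (c + y))"
  have [measurable]: "\<Omega> \<in> sets borel" by (rule \<Omega>_borel)
  have \<kappa>_eq: "(\<lambda>x. indicator \<Omega> x * (norm (x - c)) ^ q) \<in> borel_measurable borel" for q by measurable
  have tr: "(LINT y|lborel. \<kappa> y * norm y ^ q) = (LINT x|lborel. indicator \<Omega> x * (norm (x - c)) ^ q)"
    "integrable lborel (\<lambda>y. \<kappa> y * norm y ^ q) \<longleftrightarrow> integrable lborel (\<lambda>x. indicator \<Omega> x * (norm (x - c)) ^ q)" for q
    using lborel_integral_translate[OF \<kappa>_eq, of c q] by (simp_all add: \<kappa>_def)
  have leb: "(LINT x|lebesgue_on \<Omega>. (norm (x - c)) ^ q) = (LINT x|lborel. indicator \<Omega> x * (norm (x - c)) ^ q)"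
    "integrable (lebesgue_on \<Omega>) (\<lambda>x. (norm (x - c)) ^ q) \<longleftrightarrow> integrable lborel (\<lambda>x. indicator \<Omega> x * (norm (x - c)) ^ q)" for q
  proof -
    have "integral\<^sup>L (lebesgue_on \<Omega>) (\<lambda>x. (norm (x - c)) ^ q) = integral\<^sup>L (lebesgue_on \<Omega>) (\<lambda>x. indicator \<Omega> x * (norm (x - c)) ^ q)"
      by (rule Bochner_Integration.integral_cong) auto
    also have "\<dots> = (LINT x|lborel. indicator \<Omega> x * (norm (x - c)) ^ q)"
      by (rule lebesgue_on_lborel) auto
    finally show "(LINT x|lebesgue_on \<Omega>. (norm (x - c)) ^ q) = (LINT x|lborel. indicator \<Omega> x * (norm (x - c)) ^ q)" .
    have "integrable (lebesgue_on \<Omega>) (\<lambda>x. (norm (x - c)) ^ q) \<longleftrightarrow> integrable (lebesgue_on \<Omega>) (\<lambda>x. indicator \<Omega> x * (norm (x - c)) ^ q)"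
      by (rule Bochner_Integration.integrable_cong) auto
    also have "\<dots> \<longleftrightarrow> integrable lborel (\<lambda>x. indicator \<Omega> x * (norm (x - c)) ^ q)"
      by (rule lebesgue_on_lborel) auto
    finally show "integrable (lebesgue_on \<Omega>) (\<lambda>x. (norm (x - c)) ^ q) \<longleftrightarrow> integrable lborel (\<lambda>x. indicator \<Omega> x * (norm (x - c)) ^ q)" .
  qed
  have i2: "integrable lborel (\<lambda>y. \<kappa> y * norm y ^ 2)"
    unfolding tr leb(2)[symmetric] by (rule integrable_norm_diff)
  have "integrable (lebesgue_on \<Omega>) (\<lambda>x. 1 :: real)" by (intro L2_integrable L2_bounded[of _ 1]) auto
  then have i0: "integrable lborel (\<lambda>y. \<kappa> y * norm y ^ 0)" unfolding tr leb(2)[symmetric] by simp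
  have v0: "(LINT y|lborel. \<kappa> y * norm y ^ 0) = volume \<Omega>"
    unfolding tr leb(1)[symmetric] using integral_one by simp
  let ?I = "\<lambda>q (y::'a). indicator (cball 0 R) y * (norm y ^ q * 1) :: real"
  have I: "integrable lborel (?I q)" for q by (rule ball_moment_integrable[of "\<lambda>_. 1" 1]) auto
  have pw: "0 \<le> (\<kappa> y * norm y ^ 2 - ?I 2 y) - R\<^sup>2 * (\<kappa> y * norm y ^ 0 - ?I 0 y)" for y
  proof -
    have "norm y \<le> R \<Longrightarrow> (norm y)\<^sup>2 \<le> R\<^sup>2" by (intro power_mono) auto
    moreover have "\<not> norm y \<le> R \<Longrightarrow> R\<^sup>2 \<le> (norm y)\<^sup>2" using R(1) by (intro power_mono) auto
    ultimately show ?thesis by (auto simp: \<kappa>_def indicator_def)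
  qed
  have "0 \<le> (LINT y|lborel. (\<kappa> y * norm y ^ 2 - ?I 2 y) - R\<^sup>2 * (\<kappa> y * norm y ^ 0 - ?I 0 y))"
    by (rule Bochner_Integration.integral_nonneg) (rule pw)
  also have "\<dots> = (LINT y|lborel. \<kappa> y * norm y ^ 2) - ball_moment (\<lambda>_::'a. 1) 2 R
      - R\<^sup>2 * ((LINT y|lborel. \<kappa> y * norm y ^ 0) - ball_moment (\<lambda>_::'a. 1) 0 R)"
    unfolding ball_moment_def
    by (subst Bochner_Integration.integral_diff;
        (intro Bochner_Integration.integrable_diff integrable_mult_right i0 i2 I)?)
       (simp only: integral_mult_right_zero Bochner_Integration.integral_diff[OF i2 I] Bochner_Integration.integral_diff[OF i0 I])
  also have "ball_moment (\<lambda>_::'a. 1) 0 R = volume \<Omega>" using R by (simp add: ball_moment_one mult.commute)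
  also have "ball_moment (\<lambda>_::'a. 1) 2 R = real DIM('a) / (real DIM('a) + 2) * volume \<Omega> * R\<^sup>2"
    using R by (simp add: ball_moment_one power_add power2_eq_square mult_ac flip: R(2))
  finally show ?thesis unfolding v0 unfolding tr leb(1)[symmetric] by simp
qed

section \<open>The polynomial inequalities that determine \<alpha> and \<beta>\<close>

section \<open>Moments of the uniform distribution\<close>

text \<open>The mean of \<open>t ^ q\<close> for \<open>t\<close> uniform on
  \<open>{y - 1/2..y + 1/2}\<close>: radii are measured in units of \<open>w\<close>, and
  \<open>y\<close> is the midpoint of the slope region.\<close>

definition shell_mean :: "nat \<Rightarrow> real \<Rightarrow> real" where
  "shell_mean q y = ((y + 1/2) ^ (q + 1) - (y - 1/2) ^ (q + 1)) / (real q + 1)"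

lemma power_sum_diff:
  fixes y h :: real
  shows "(y + h) ^ 3 - (y - h) ^ 3 = 2 * h * (3 * y ^ 2 + h ^ 2)"
    "(y + h) ^ 4 - (y - h) ^ 4 = 2 * h * (4 * y ^ 3 + 4 * y * h ^ 2)"
    "(y + h) ^ 5 - (y - h) ^ 5 = 2 * h * (5 * y ^ 4 + 10 * y ^ 2 * h ^ 2 + h ^ 4)"
    "(y + h) ^ 6 - (y - h) ^ 6 = 2 * h * (6 * y ^ 5 + 20 * y ^ 3 * h ^ 2 + 6 * y * h ^ 4)"
    "(y + h) ^ 7 - (y - h) ^ 7 = 2 * h * (7 * y ^ 6 + 35 * y ^ 4 * h ^ 2 + 21 * y ^ 2 * h ^ 4 + h ^ 6)"
    "(y + h) ^ 8 - (y - h) ^ 8 = 2 * h * (8 * y ^ 7 + 56 * y ^ 5 * h ^ 2 + 56 * y ^ 3 * h ^ 4 + 8 * y * h ^ 6)"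
    "(y + h) ^ 9 - (y - h) ^ 9 = 2 * h * (9 * y ^ 8 + 84 * y ^ 6 * h ^ 2 + 126 * y ^ 4 * h ^ 4 + 36 * y ^ 2 * h ^ 6 + h ^ 8)"
  by algebra+

lemma shell_mean_eqs:
  "shell_mean 2 y = y ^ 2 + 1/12"
  "shell_mean 3 y = y ^ 3 + y / 4"
  "shell_mean 4 y = y ^ 4 + y ^ 2 / 2 + 1/80"
  "shell_mean 5 y = y ^ 5 + 5/6 * y ^ 3 + y / 16"
  "shell_mean 6 y = y ^ 6 + 5/4 * y ^ 4 + 3/16 * y ^ 2 + 1/448"
  "shell_mean 7 y = y ^ 7 + 7/4 * y ^ 5 + 7/16 * y ^ 3 + y / 64"
  "shell_mean 8 y = y ^ 8 + 7/3 * y ^ 6 + 7/8 * y ^ 4 + y ^ 2 / 16 + 1/2304"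
  by (simp_all add: shell_mean_def power_sum_diff power_divide add_divide_distrib)

text \<open>At \<open>y = 1/2\<close> the mean is at most 1, at \<open>y = x\<close> it is at least
  \<open>x ^ n\<close> by convexity; an intermediate value does the rest. The condition
  \<open>1/2 \<le> y\<close> makes the plateau radius of the cone nonnegative.\<close>

lemma shell_mean_solution:
  assumes "n \<in> {2, 3, 4}" "1 \<le> x"
  obtains y where "1/2 \<le> y" "shell_mean n y = x ^ n"
proof -
  have "\<exists>y\<ge>1/2. y \<le> x \<and> shell_mean n y = x ^ n"
  proof (rule IVT')
    have "1 \<le> x ^ n" using assms by simp
    moreover have "shell_mean n (1/2) \<le> 1"
      using assms(1) by (auto simp: shell_mean_eqs power_divide)
    ultimately show "shell_mean n (1/2) \<le> x ^ n" by linarith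
    show "x ^ n \<le> shell_mean n x" using assms by (auto simp: shell_mean_eqs)
    show "1/2 \<le> x" using assms by simp
    show "continuous_on {1/2..x} (shell_mean n)"
      unfolding shell_mean_def by (intro continuous_intros) auto
  qed
  then show ?thesis using that by blast
qed

lemma alpha_beta_values:
  "alpha 2 = 12095/12096" "alpha 3 = 991/1000" "alpha 4 = 985/1000"
  "beta 2 = 119/120" "beta 3 = 986/1000" "beta 4 = 983/1000"
  by (simp_all add: alpha_def beta_def)

text \<open>Here the mass equation is solved exactly by \<open>y\<^sup>2 = q - 1/12\<close>, and the
  two means become \<open>q ^ 3 + q\<^sup>2 - 1/189\<close> and
  \<open>q\<^sup>2 + q / 3 - 1/45\<close>. The constants \<open>12095/12096\<close> and
  \<open>119/120\<close> turn both bounds into equalities at \<open>q = 8\<close>.\<close>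

lemma shell_mean_bounds_2:
  assumes "shell_mean 2 y = x ^ 2" "8 \<le> x\<^sup>2"
  shows "shell_mean 6 y \<ge> x ^ 6 + alpha 2 * x ^ 4"
    and "shell_mean 4 y \<ge> x ^ 4 + beta 2 / 3 * x ^ 2"
proof -
  define q where "q = x\<^sup>2"
  have y: "y\<^sup>2 = q - 1/12" and q: "8 \<le> q" using assms by (auto simp: shell_mean_eqs q_def)
  have x: "x ^ 4 = q\<^sup>2" "x ^ 6 = q ^ 3" by (simp_all add: q_def flip: power_mult)
  have y': "y ^ 4 = (q - 1/12)\<^sup>2" "y ^ 6 = (q - 1/12) ^ 3" by (simp_all flip: y power_mult)
  have "8 * 8 \<le> q * q" using q by (intro mult_mono) auto
  then show "shell_mean 6 y \<ge> x ^ 6 + alpha 2 * x ^ 4"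
    unfolding shell_mean_eqs x y y' alpha_beta_values by (simp add: power2_eq_square power3_eq_cube field_simps)
  show "shell_mean 4 y \<ge> x ^ 4 + beta 2 / 3 * x ^ 2"
    using q unfolding shell_mean_eqs x y y' q_def[symmetric] alpha_beta_values by (simp add: power2_eq_square field_simps)
qed

text \<open>The mass equation is a cubic in \<open>y\<close>. Squared and written in
  \<open>t = y\<^sup>2 + 1/6\<close>, a shift that removes the quadratic term, it reads
  \<open>q ^ 3 = t ^ 3 - t / 48 - 1/864\<close>. With
  \<open>t ^ 3 - q ^ 3 \<le> 3 * t\<^sup>2 * (t - q)\<close> this gives \<open>q \<le> t - d\<close>
  for \<open>d = 1 / (144 * t)\<close>, which is sharp enough for both bounds.\<close>

lemma shell_mean_bounds_3:
  assumes y: "1/2 \<le> y" and x: "0 < x" and eq: "shell_mean 3 y = x ^ 3" and x14: "14 \<le> x\<^sup>2"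
  shows "shell_mean 7 y \<ge> x ^ 7 + 7/6 * alpha 3 * x ^ 5"
    and "shell_mean 5 y \<ge> x ^ 5 + 5/12 * beta 3 * x ^ 3"
proof -
  define q where "q = x\<^sup>2"
  define t where "t = y\<^sup>2 + 1/6"
  have q: "14 \<le> q" using x14 by (simp add: q_def)
  have x3: "x ^ 3 = y * (t + 1/12)"
    using eq by (simp add: shell_mean_eqs t_def power2_eq_square power3_eq_cube algebra_simps)
  have "q ^ 3 = (x ^ 3)\<^sup>2" by (simp add: q_def flip: power_mult)
  also have "\<dots> = (t - 1/6) * (t + 1/12)\<^sup>2" unfolding x3 power_mult_distrib by (simp add: t_def)
  also have "\<dots> = t ^ 3 - t / 48 - 1/864" by (simp add: power2_eq_square power3_eq_cube field_simps)
  finally have q3: "t ^ 3 - q ^ 3 = t / 48 + 1/864" by simp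
  have t0: "0 < t" by (simp add: t_def add_nonneg_pos)
  have "q ^ 3 \<le> t ^ 3" using q3 t0 by simp
  then have qt: "q \<le> t" using power_strict_mono[of t q 3] t0 by (cases "q \<le> t") auto
  define d where "d = 1 / (144 * t)"
  have td: "t * d = 1/144" using t0 by (simp add: d_def)
  have "t / 48 < (t - q) * (t\<^sup>2 + t * q + q\<^sup>2)"
    using q3 by (simp add: power2_eq_square power3_eq_cube algebra_simps)
  also have "\<dots> \<le> (t - q) * (3 * t\<^sup>2)"
  proof (rule mult_left_mono)
    have "t * q \<le> t * t" "q * q \<le> t * t" using qt q t0 by (auto intro: mult_mono)
    then show "t\<^sup>2 + t * q + q\<^sup>2 \<le> 3 * t\<^sup>2" by (simp add: power2_eq_square)
  qed (use qt in simp)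
  finally have "d * (3 * t\<^sup>2) < (t - q) * (3 * t\<^sup>2)"
    using t0 by (simp add: d_def power2_eq_square)
  then have "d < t - q" using mult_less_cancel_right_pos[of "3 * t\<^sup>2" d "t - q"] t0 by simp
  then have qd: "q \<le> t - d" by simp
  have d: "0 < d" "d \<le> 1" using t0 qt q by (auto simp: d_def)
  have "q * q \<le> (t - d) * (t - d)" using qd q by (intro mult_mono) auto
  also have "\<dots> = t * t - 2 * (t * d) + d * d" by (simp add: algebra_simps)
  also have "\<dots> \<le> t * t - 1/72 + d" using d by (simp add: td mult_left_le)
  finally have q2: "q\<^sup>2 \<le> t\<^sup>2 - 1/72 + d" by (simp add: power2_eq_square)
  have t14: "14 \<le> t" using q qt by simp
  have "q\<^sup>2 + 7/6 * alpha 3 * q \<le> t\<^sup>2 - 1/72 + d + 7/6 * alpha 3 * (t - d)"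
    by (rule add_mono[OF q2 mult_left_mono[OF qd]]) (simp add: alpha_beta_values)
  \<comment> \<open>This decides \<open>alpha 3\<close>: the gain
    \<open>7/6 * (1 - alpha 3) * t\<close> is at least 0.147 for \<open>t \<ge> 14\<close> and has
    to cover \<open>21/144\<close>, about 0.1458.\<close>
  also have "\<dots> \<le> t\<^sup>2 + 7/6 * t - 23/144"
  proof -
    have c: "7/6 * alpha 3 = 6937/6000" by (simp add: alpha_beta_values)
    show ?thesis using t14 d unfolding c right_diff_distrib by linarith
  qed
  finally have 1: "q\<^sup>2 + 7/6 * alpha 3 * q \<le> t\<^sup>2 + 7/6 * t - 23/144" .
  have "x ^ 7 + 7/6 * alpha 3 * x ^ 5 = x ^ 3 * (q\<^sup>2 + 7/6 * alpha 3 * q)"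
    by (simp add: q_def eval_nat_numeral algebra_simps)
  also have "\<dots> \<le> x ^ 3 * (t\<^sup>2 + 7/6 * t - 23/144)" using 1 x by (intro mult_left_mono) auto
  \<comment> \<open>As a polynomial in \<open>y\<close>, \<open>shell_mean 7 y\<close> is divisible
    by \<open>shell_mean 3 y\<close>, which is \<open>x ^ 3\<close>.\<close>
  also have "\<dots> = shell_mean 7 y"
    unfolding x3 shell_mean_eqs t_def by (simp add: eval_nat_numeral algebra_simps)
  finally show "shell_mean 7 y \<ge> x ^ 7 + 7/6 * alpha 3 * x ^ 5" .
  have "(t + 1/12) * (q + 5/12 * beta 3) \<le> (t + 1/12) * (t - d + 5/12 * beta 3)"
    using qd t0 by (intro mult_left_mono) auto
  also have "\<dots> = t * t + t * (1/12 + 5/12 * beta 3) + 5/144 * beta 3 - t * d - d / 12"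
    by (simp add: algebra_simps)
  \<comment> \<open>The gain \<open>5/12 * (1 - beta 3) * t\<close> is at least 0.081 for
    \<open>t \<ge> 14\<close> and covers \<open>(6 + 5 * beta 3) / 144\<close>, about 0.076.\<close>
  also have "\<dots> \<le> t * t + t / 2 - 7/144"
  proof -
    have c: "5/12 * beta 3 = 493/1200" "5/144 * beta 3 = 493/14400" by (simp_all add: alpha_beta_values)
    have "t * (1/12 + 493/1200) = 593/1200 * t" by simp
    then show ?thesis using t14 d unfolding td c by linarith
  qed
  finally have 2: "(t + 1/12) * (q + 5/12 * beta 3) \<le> t * t + t / 2 - 7/144" .
  have "x ^ 5 + 5/12 * beta 3 * x ^ 3 = x ^ 3 * (q + 5/12 * beta 3)"
    by (simp add: q_def eval_nat_numeral algebra_simps)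
  also have "\<dots> = y * ((t + 1/12) * (q + 5/12 * beta 3))" unfolding x3 by simp
  also have "\<dots> \<le> y * (t * t + t / 2 - 7/144)" using 2 y by (intro mult_left_mono) auto
  also have "\<dots> = shell_mean 5 y"
    unfolding shell_mean_eqs t_def by (simp add: eval_nat_numeral field_simps)
  finally show "shell_mean 5 y \<ge> x ^ 5 + 5/12 * beta 3 * x ^ 3" .
qed

text \<open>The shift \<open>s = y\<^sup>2 + 1/4\<close> completes the square in the mass equation:
  \<open>q\<^sup>2 = s\<^sup>2 - 1/20\<close>, hence \<open>q \<le> s - 1 / (40 * s)\<close>. Both
  bounds become polynomial inequalities for \<open>s \<ge> 64/3\<close>. The decisive margins are
  \<open>4/3 * (1 - alpha 4) * 64/3 > 2/5\<close>, against the coefficient of \<open>s * s\<close>,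
  and \<open>(1 - beta 4) / 2 * 64/3 > 7/40\<close>, against that of \<open>s\<close>.\<close>

lemma shell_mean_bounds_4:
  assumes eq: "shell_mean 4 y = x ^ 4" and x21: "64/3 \<le> x\<^sup>2"
  shows "shell_mean 8 y \<ge> x ^ 8 + 4/3 * alpha 4 * x ^ 6"
    and "shell_mean 6 y \<ge> x ^ 6 + beta 4 / 2 * x ^ 4"
proof -
  define q where "q = x\<^sup>2"
  define s where "s = y\<^sup>2 + 1/4"
  have q: "64/3 \<le> q" using x21 by (simp add: q_def)
  have q2: "q\<^sup>2 = s\<^sup>2 - 1/20"
  proof -
    have "q\<^sup>2 = y ^ 4 + y ^ 2 / 2 + 1/80" using eq by (simp add: shell_mean_eqs q_def flip: power_mult)
    moreover have "s\<^sup>2 - 1/20 = y ^ 4 + y ^ 2 / 2 + 1/80" unfolding s_def by (simp add: power2_sum power_divide flip: power_mult)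
    ultimately show ?thesis by simp
  qed
  have s0: "0 < s" by (simp add: s_def add_nonneg_pos)
  have "q\<^sup>2 \<le> s\<^sup>2" using q2 by simp
  then have qs: "q \<le> s" using power_strict_mono[of s q 2] s0 by (cases "q \<le> s") auto
  have s21: "64/3 \<le> s" using q qs by simp
  define d where "d = 1 / (40 * s)"
  have sd: "s * d = 1/40" using s0 by (simp add: d_def)
  have "1/20 \<le> (s - q) * (2 * s)"
  proof -
    have "1/20 = s\<^sup>2 - q\<^sup>2" using q2 by simp
    also have "\<dots> = (s - q) * (s + q)" by (simp add: power2_eq_square algebra_simps)
    also have "\<dots> \<le> (s - q) * (2 * s)" using qs by (intro mult_left_mono) auto
    finally show ?thesis .
  qed
  then have qd: "q \<le> s - d" using s0 by (simp add: d_def field_simps)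
  have d: "0 < d" "d \<le> 1" using s21 by (auto simp: d_def)
  have "q ^ 3 = q\<^sup>2 * q" by (simp add: eval_nat_numeral)
  also have "\<dots> \<le> (s\<^sup>2 - 1/20) * (s - d)" unfolding q2[symmetric] using qd by (intro mult_left_mono) auto
  also have "\<dots> = s * s * s - s * (s * d) - s / 20 + d / 20" by (simp add: power2_eq_square field_simps)
  also have "\<dots> \<le> s * s * s - 3/40 * s + 1/20" unfolding sd using d by simp
  finally have q3: "q ^ 3 \<le> s * s * s - 3/40 * s + 1/20" .
  have ss: "64/3 * s \<le> s * s" using s21 by (intro mult_right_mono) auto
  have sss: "64/3 * (s * s) \<le> s * s * s" using s21 by (simp add: mult_right_mono mult.assoc)
  have y: "y\<^sup>2 = s - 1/4" by (simp add: s_def)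
  have y': "y ^ 4 = (s - 1/4)\<^sup>2" "y ^ 6 = (s - 1/4) ^ 3" "y ^ 8 = (s - 1/4) ^ 4"
    by (simp_all flip: y power_mult)
  have "x ^ 4 = q\<^sup>2" by (simp add: q_def flip: power_mult)
  then have x: "x ^ 4 = s * s - 1/20" unfolding q2 by (simp add: power2_eq_square)
  have x6: "x ^ 6 = q ^ 3" by (simp add: q_def flip: power_mult)
  have "x ^ 8 = (q\<^sup>2)\<^sup>2" by (simp add: q_def flip: power_mult)
  then have x8: "x ^ 8 = s * s * s * s - s * s / 10 + 1/400"
    unfolding q2 by (simp add: power2_eq_square algebra_simps)
  have e8: "shell_mean 8 y \<ge> s * s * s * s + 4/3 * (s * s * s) - s * s / 2"
    using s21 unfolding shell_mean_eqs y y' by (simp add: eval_nat_numeral field_simps)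
  show "shell_mean 8 y \<ge> x ^ 8 + 4/3 * alpha 4 * x ^ 6"
    using e8 q3 ss sss s21 unfolding x8 x6 alpha_beta_values by linarith
  have e6: "shell_mean 6 y \<ge> s * s * s + s * s / 2 - s / 4"
    unfolding shell_mean_eqs y y' by (simp add: eval_nat_numeral field_simps)
  show "shell_mean 6 y \<ge> x ^ 6 + beta 4 / 2 * x ^ 4"
  proof -
    have c: "beta 4 / 2 = 983/2000" by (simp add: alpha_beta_values)
    show ?thesis using e6 q3 ss s21 unfolding x x6 c right_diff_distrib by linarith
  qed
qed

lemma shell_mean_bounds:
  assumes "n \<in> {2, 3, 4}" "1/2 \<le> y" "0 < x" "shell_mean n y = x ^ n"
    and "n = 2 \<Longrightarrow> 8 \<le> x\<^sup>2" "n = 3 \<Longrightarrow> 14 \<le> x\<^sup>2" "n = 4 \<Longrightarrow> 64/3 \<le> x\<^sup>2"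
  shows "shell_mean (n + 4) y \<ge> x ^ (n + 4) + (real n + 4) / 6 * alpha n * x ^ (n + 2)"
    and "shell_mean (n + 2) y \<ge> x ^ (n + 2) + (real n + 2) / 12 * beta n * x ^ n"
proof -
  consider "n = 2" | "n = 3" | "n = 4" using assms(1) by auto
  then have "shell_mean (n + 4) y \<ge> x ^ (n + 4) + (real n + 4) / 6 * alpha n * x ^ (n + 2) \<and>
    shell_mean (n + 2) y \<ge> x ^ (n + 2) + (real n + 2) / 12 * beta n * x ^ n"
  proof cases
    case 1
    then show ?thesis using shell_mean_bounds_2[of y x] assms(4,5) by simp
  next
    case 2
    then show ?thesis using shell_mean_bounds_3[of y x] assms(2,3,4,6) by simp
  next
    case 3
    then show ?thesis using shell_mean_bounds_4[of y x] assms(4,7) by simp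
  qed
  then show "shell_mean (n + 4) y \<ge> x ^ (n + 4) + (real n + 4) / 6 * alpha n * x ^ (n + 2)"
    and "shell_mean (n + 2) y \<ge> x ^ (n + 2) + (real n + 2) / 12 * beta n * x ^ n" by auto
qed

section \<open>From the moments of the cone to the eigenvalue sum\<close>

section \<open>The eigenvalue sum\<close>

context bounded_open
begin

lemma volume_pos:
  assumes "\<Omega> \<noteq> {}" shows "0 < volume \<Omega>"
proof -
  obtain z e where e: "0 < e" "ball z e \<subseteq> \<Omega>" using assms open_\<Omega> open_contains_ball by blast
  have "measure lebesgue (ball z e) \<le> volume \<Omega>"
    by (rule measure_mono_fmeasurable[OF e(2)]) (auto intro: lmeasurable_open open_\<Omega> bounded_\<Omega>)
  moreover have "0 < measure lebesgue (ball z e)" using content_ball_pos[OF e(1), of z] by simp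
  ultimately show ?thesis by linarith
qed

lemma moment_of_inertia_lower_bound:
  assumes "0 \<le> R" "unit_ball_volume TYPE('a) * R ^ DIM('a) = volume \<Omega>"
  shows "moment_of_inertia \<Omega> \<ge> real DIM('a) / (real DIM('a) + 2) * volume \<Omega> * R\<^sup>2"
  unfolding moment_of_inertia_def
  by (rule cINF_greatest) (simp, rule inertia_lower_bound[OF open_\<Omega> bounded_\<Omega> assms])

text \<open>Testing the equation of \<open>u j\<close> with \<open>u j\<close> itself expresses
  \<open>\<Gamma> j\<close> by the two energies, so the sum is a fourth moment of \<open>F\<close>
  plus \<open>a\<close> times a second moment, and the cone bounds each from below. The inequalities
  special to a dimension enter only as \<open>b4\<close> and \<open>b2\<close>, where
  \<open>x\<close> stands for \<open>r / w\<close>.\<close>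

lemma eigenvalue_sum_bound:
  fixes a w x y al be :: real
  assumes \<Gamma>: "eigenvalue_sequence \<Omega> a \<Gamma>" and a: "0 \<le> a" and k: "1 \<le> k"
    and V: "0 < volume \<Omega>" and w: "0 < w" "4 * w\<^sup>2 * moment_of_inertia \<Omega> = volume \<Omega>"
    and y: "1/2 \<le> y" "shell_mean DIM('a) y = x ^ DIM('a)" and x: "0 < x"
    and r: "(w * x) ^ DIM('a) * (unit_ball_volume TYPE('a) * volume \<Omega>) = (2 * pi) ^ DIM('a) * real k"
    and b4: "shell_mean (DIM('a) + 4) y \<ge> x ^ (DIM('a) + 4) + (real DIM('a) + 4) / 6 * al * x ^ (DIM('a) + 2)"
    and b2: "shell_mean (DIM('a) + 2) y \<ge> x ^ (DIM('a) + 2) + (real DIM('a) + 2) / 12 * be * x ^ DIM('a)"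
  shows "1 / real k * (\<Sum>j = 1..k. \<Gamma> j) \<ge> real DIM('a) / (real DIM('a) + 4) * (w * x) ^ 4
    + (real DIM('a) / 6 * al * w\<^sup>2 + real DIM('a) * a / (real DIM('a) + 2)) * (w * x) ^ 2
    + real DIM('a) * a / 12 * be * w\<^sup>2"
proof -
  let ?n = "DIM('a)" and ?\<omega> = "unit_ball_volume TYPE('a)" and ?V = "volume \<Omega>"
  obtain u where on: "L2_orthonormal \<Omega> u {1..}" and ue: "\<And>j. 1 \<le> j \<Longrightarrow> u j \<in> eigenspace \<Omega> a (\<Gamma> j)"
    using orthonormal_eigenfunctions[OF \<Gamma>] by metis
  have onk: "L2_orthonormal \<Omega> u {1..k}" using on by (auto simp: L2_orthonormal_def)
  have uH: "u j \<in> H2_0 \<Omega>" if "j \<in> {1..k}" for j using ue[of j] that by (simp add: eigenspace_def)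
  have u1: "L2_sq \<Omega> (u j) = 1" if "j \<in> {1..k}" for j using on that by (simp add: L2_orthonormal_def)
  define F where "F = spectral_density u {1..k}"
  have F: "F \<xi> = (\<Sum>j=1..k. (cmod (Fourier_on (u j) \<xi>))\<^sup>2)" for \<xi> by (simp add: F_def spectral_density_def)
  have F_int: "integrable lborel F"
    unfolding F by (intro Bochner_Integration.integrable_sum H2_0_Plancherel uH)
  have F_mass: "(LINT \<xi>|lborel. F \<xi>) = (2 * pi) ^ ?n * real k"
    unfolding F by (subst Bochner_Integration.integral_sum) (auto simp: H2_0_Plancherel uH u1)
  have F2: "norm \<xi> ^ p * F \<xi> = (\<Sum>j=1..k. norm \<xi> ^ p * (cmod (Fourier_on (u j) \<xi>))\<^sup>2)" for p \<xi>
    by (simp add: F sum_distrib_left)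
  have F2_int: "integrable lborel (\<lambda>\<xi>. norm \<xi> ^ 2 * F \<xi>)" and F4_int: "integrable lborel (\<lambda>\<xi>. norm \<xi> ^ 4 * F \<xi>)"
    unfolding F2 by (intro Bochner_Integration.integrable_sum H2_0_Plancherel uH; assumption)+
  have m2: "(LINT \<xi>|lborel. norm \<xi> ^ 2 * F \<xi>) = (2 * pi) ^ ?n *
      (\<Sum>j=1..k. \<Sum>b\<in>Basis. L2_sq \<Omega> (weak_partial \<Omega> b (u j)))"
    unfolding F2 by (subst Bochner_Integration.integral_sum) (auto simp: H2_0_Plancherel uH sum_distrib_left)
  have m4: "(LINT \<xi>|lborel. norm \<xi> ^ 4 * F \<xi>) = (2 * pi) ^ ?n *
      (\<Sum>j=1..k. L2_sq \<Omega> (weak_laplacian \<Omega> (u j)))"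
    unfolding F2 by (subst Bochner_Integration.integral_sum) (auto simp: H2_0_Plancherel uH sum_distrib_left)
  have "\<Gamma> j = plate_form \<Omega> a (u j) (u j)" if "j \<in> {1..k}" for j
    using ue[of j] uH[OF that] u1[OF that] that by (simp add: eigenspace_def)
  then have "(\<Sum>j=1..k. \<Gamma> j) = (\<Sum>j=1..k. plate_form \<Omega> a (u j) (u j))" by (intro sum.cong) auto
  then have sum_\<Gamma>: "(2 * pi) ^ ?n * (\<Sum>j=1..k. \<Gamma> j)
      = (LINT \<xi>|lborel. norm \<xi> ^ 4 * F \<xi>) + a * (LINT \<xi>|lborel. norm \<xi> ^ 2 * F \<xi>)"
    unfolding m2 m4 by (simp add: plate_form_def sum.distrib distrib_left sum_distrib_left mult.left_commute)
  define A where "A = w * (y - 1/2)"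
  define B where "B = w * (y + 1/2)"
  note AB_eqs = A_def B_def
  interpret truncated_cone F ?V "?V / w" A B
  proof
    show "0 \<le> F \<xi>" for \<xi> unfolding F_def by (rule spectral_density_nonneg[OF onk]) simp
    show "F \<xi> \<le> ?V" for \<xi> unfolding F_def by (rule spectral_density_le[OF onk]) simp
    show "\<bar>F \<xi> - F \<eta>\<bar> \<le> ?V / w * norm (\<xi> - \<eta>)" for \<xi> \<eta>
    proof (cases "\<xi> = \<eta>")
      case False
      let ?d = "4 * ?V * (norm (\<xi> - \<eta>))\<^sup>2"
      have d: "0 < ?d" using V False by simp
      \<comment> \<open>The Lipschitz estimate holds for every centre \<open>c\<close>. Dividing by
        \<open>?d\<close> isolates the inertia about \<open>c\<close>, so that the infimum over
        \<open>c\<close> can be taken.\<close>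
      have "(F \<xi> - F \<eta>)\<^sup>2 / ?d \<le> moment_of_inertia \<Omega>"
        unfolding moment_of_inertia_def
      proof (rule cINF_greatest)
        show "(F \<xi> - F \<eta>)\<^sup>2 / ?d \<le> (LINT x|lebesgue_on \<Omega>. (norm (x - c))\<^sup>2)" for c
          using spectral_density_Lipschitz[OF onk, of \<xi> \<eta> c] d by (simp add: F_def divide_le_eq mult_ac)
      qed simp
      then have "(F \<xi> - F \<eta>)\<^sup>2 \<le> moment_of_inertia \<Omega> * ?d" using d by (simp add: divide_le_eq)
      also have "\<dots> = (?V / w * norm (\<xi> - \<eta>))\<^sup>2"
      proof -
        have "moment_of_inertia \<Omega> = ?V / (4 * w\<^sup>2)" using w by (simp add: field_simps)
        then show ?thesis by (simp add: power_mult_distrib power_divide power2_eq_square)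
      qed
      finally have "\<bar>F \<xi> - F \<eta>\<bar> \<le> \<bar>?V / w * norm (\<xi> - \<eta>)\<bar>" unfolding abs_le_square_iff .
      moreover have "0 \<le> ?V / w * norm (\<xi> - \<eta>)" using V w by simp
      ultimately show ?thesis by linarith
    qed simp
    show "integrable lborel F" by (rule F_int)
    show "0 \<le> A" using w y by (simp add: A_def)
    show "0 < ?V" by (rule V)
    show "0 < ?V / w" using V w by simp
    show "B = A + ?V / (?V / w)" using V by (simp add: A_def B_def algebra_simps)
  qed
  have P: "(LINT \<xi>|lborel. norm (\<xi>::'a) ^ p * profile (norm \<xi>))
      = real ?n / (real ?n + real p) * (?\<omega> * ?V) * (w ^ (?n + p) * shell_mean (?n + p) y)" for p
  proof -
    have *: "c * (v / w) * (w ^ (q + 1) * d - w ^ (q + 1) * e) / (N * (N + 1))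
        = c / N * v * (w ^ q * ((d - e) / (N + 1)))" if "0 < N" for c v d e N :: real and q
    proof -
      have "N * (N + 1) \<noteq> 0" using that by simp
      then show ?thesis using w(1) that by (simp add: divide_simps) (simp add: algebra_simps)
    qed
    have "0 < real ?n + real p" using DIM_positive[where 'a='a] by linarith
    from *[OF this, of "real ?n * ?\<omega>" ?V "?n + p" "(y + 1/2) ^ (?n + p + 1)" "(y - 1/2) ^ (?n + p + 1)"]
    show ?thesis
      unfolding profile_moment(2) unfolding AB_eqs power_mult_distrib shell_mean_def by (simp add: mult.assoc)
  qed
  have n0: "0 < real ?n" by simp
  \<comment> \<open>This is what \<open>y\<close> solves: the mean of \<open>t ^ n\<close> over the
    slope region is \<open>(w * x) ^ n\<close>.\<close>
  have mass: "(LINT \<xi>|lborel. F \<xi>) = (LINT \<xi>|lborel. profile (norm (\<xi>::'a)))"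
    using P[of 0] y(2) r by (simp add: F_mass power_mult_distrib mult_ac)
  let ?c = "real ?n * (?\<omega> * ?V)"
  have c: "0 < ?c" using V unit_ball_volume_pos[where 'a='a] by simp
  have k0: "0 < real k" using k by simp
  have r': "?\<omega> * ?V * (w * x) ^ ?n = (2 * pi) ^ ?n * real k" using r by (simp add: mult.commute)
  have scale: "g * (K * (w * x) ^ ?n) * ((w * x) ^ p + b * w\<^sup>2 * (w * x) ^ q)
      = g * K * (w ^ (?n + p) * (x ^ (?n + p) + b * x ^ (?n + q)))" if "p = q + 2" for g K b p q
    using that by (simp add: power_mult_distrib power_add power2_eq_square algebra_simps)
  have l4: "real ?n / (real ?n + 4) * (?\<omega> * ?V * (w * x) ^ ?n) * ((w * x) ^ 4 + (real ?n + 4) / 6 * al * w\<^sup>2 * (w * x)\<^sup>2)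
      \<le> (LINT \<xi>|lborel. norm \<xi> ^ 4 * F \<xi>)"
  proof -
    have "real ?n / (real ?n + 4) * (?\<omega> * ?V * (w * x) ^ ?n) * ((w * x) ^ 4 + (real ?n + 4) / 6 * al * w\<^sup>2 * (w * x)\<^sup>2)
      = real ?n / (real ?n + 4) * (?\<omega> * ?V) * (w ^ (?n + 4) * (x ^ (?n + 4) + (real ?n + 4) / 6 * al * x ^ (?n + 2)))"
      by (rule scale) simp
    also have "\<dots> \<le> real ?n / (real ?n + 4) * (?\<omega> * ?V) * (w ^ (?n + 4) * shell_mean (?n + 4) y)"
      using b4 w c by (intro mult_left_mono) auto
    also have "\<dots> \<le> (LINT \<xi>|lborel. norm \<xi> ^ 4 * F \<xi>)"
      using moment_comparison[OF _ F4_int mass] P[of 4] by simp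
    finally show ?thesis .
  qed
  have l2: "real ?n / (real ?n + 2) * (?\<omega> * ?V * (w * x) ^ ?n) * ((w * x) ^ 2 + (real ?n + 2) / 12 * be * w\<^sup>2)
      \<le> (LINT \<xi>|lborel. norm \<xi> ^ 2 * F \<xi>)"
  proof -
    have "real ?n / (real ?n + 2) * (?\<omega> * ?V * (w * x) ^ ?n) * ((w * x) ^ 2 + (real ?n + 2) / 12 * be * w\<^sup>2)
      = real ?n / (real ?n + 2) * (?\<omega> * ?V) * (w ^ (?n + 2) * (x ^ (?n + 2) + (real ?n + 2) / 12 * be * x ^ ?n))"
      using scale[of 2 0 "real ?n / (real ?n + 2)" "?\<omega> * ?V" "(real ?n + 2) / 12 * be"]
      by (simp only: power_0 mult_1_right add_0_right add_0)
    also have "\<dots> \<le> real ?n / (real ?n + 2) * (?\<omega> * ?V) * (w ^ (?n + 2) * shell_mean (?n + 2) y)"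
      using b2 w c by (intro mult_left_mono) auto
    also have "\<dots> \<le> (LINT \<xi>|lborel. norm \<xi> ^ 2 * F \<xi>)"
      using moment_comparison[OF _ F2_int mass] P[of 2] by simp
    finally show ?thesis .
  qed
  define lo4 where "lo4 = real ?n / (real ?n + 4) * ((w * x) ^ 4 + (real ?n + 4) / 6 * al * w\<^sup>2 * (w * x)\<^sup>2)"
  define lo2 where "lo2 = real ?n / (real ?n + 2) * ((w * x) ^ 2 + (real ?n + 2) / 12 * be * w\<^sup>2)"
  have "(2 * pi) ^ ?n * (real k * (lo4 + a * lo2)) \<le> (2 * pi) ^ ?n * (\<Sum>j=1..k. \<Gamma> j)"
  proof -
    have "(2 * pi) ^ ?n * (real k * lo4) \<le> (LINT \<xi>|lborel. norm \<xi> ^ 4 * F \<xi>)"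
      using l4 unfolding r' lo4_def by (simp only: mult_ac)
    moreover have "(2 * pi) ^ ?n * (real k * lo2) \<le> (LINT \<xi>|lborel. norm \<xi> ^ 2 * F \<xi>)"
      using l2 unfolding r' lo2_def by (simp only: mult_ac)
    then have "a * ((2 * pi) ^ ?n * (real k * lo2)) \<le> a * (LINT \<xi>|lborel. norm \<xi> ^ 2 * F \<xi>)"
      using a by (rule mult_left_mono)
    ultimately show ?thesis unfolding sum_\<Gamma> by (simp only: distrib_left mult_ac)
  qed
  then have "real k * (lo4 + a * lo2) \<le> (\<Sum>j=1..k. \<Gamma> j)" by simp
  then have "lo4 + a * lo2 \<le> 1 / real k * (\<Sum>j=1..k. \<Gamma> j)" using k0 by (simp add: field_simps)
  moreover have "lo4 = real ?n / (real ?n + 4) * (w * x) ^ 4 + real ?n / 6 * al * w\<^sup>2 * (w * x)\<^sup>2"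
    unfolding lo4_def distrib_left using n0 by simp
  moreover have "lo2 = real ?n / (real ?n + 2) * (w * x)\<^sup>2 + real ?n / 12 * be * w\<^sup>2"
    unfolding lo2_def distrib_left using n0 by simp
  ultimately show ?thesis by (simp add: algebra_simps)
qed

end

text \<open>Let \<open>R\<close> be the radius of the ball of volume \<open>V\<close>. The inertia
  bound gives \<open>4 * I / V \<ge> 4 * n / (n + 2) * R\<^sup>2\<close>, and
  \<open>k \<ge> 1\<close> gives \<open>(r * R) ^ n * \<omega>\<^sup>2 \<ge> (2 * pi) ^ n\<close>.
  For \<open>\<omega>\<close> equal to \<open>pi\<close>, \<open>4/3 * pi\<close> and
  \<open>pi\<^sup>2 / 2\<close> the latter means \<open>(r * R)\<^sup>2 \<ge> 4\<close>,
  \<open>(r * R) ^ 3 \<ge> 9/2 * pi\<close> and \<open>(r * R)\<^sup>2 \<ge> 8\<close>. The quantity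
  bounded is \<open>(r / w)\<^sup>2\<close>.\<close>

lemma (in bounded_open) inner_radius_lower_bound:
  assumes n: "n = DIM('a)" "n \<in> {2, 3, 4}" and r: "0 < r" and k: "1 \<le> k" and V: "0 < volume \<Omega>"
    and r_eq: "r ^ n * (unit_ball_volume TYPE('a) * volume \<Omega>) = (2 * pi) ^ n * k"
  shows "n = 2 \<Longrightarrow> r\<^sup>2 * (4 * moment_of_inertia \<Omega> / volume \<Omega>) \<ge> 8"
    and "n = 3 \<Longrightarrow> r\<^sup>2 * (4 * moment_of_inertia \<Omega> / volume \<Omega>) \<ge> 14"
    and "n = 4 \<Longrightarrow> r\<^sup>2 * (4 * moment_of_inertia \<Omega> / volume \<Omega>) \<ge> 64/3"
    and "0 < moment_of_inertia \<Omega>"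
proof -
  let ?\<omega> = "unit_ball_volume TYPE('a)" and ?V = "volume \<Omega>"
  have \<omega>: "0 < ?\<omega>" by (rule unit_ball_volume_pos)
  have n0: "0 < real n" "0 < n" using n(2) by auto
  define R where "R = (?V / ?\<omega>) powr (1 / real n)"
  have R: "0 < R" using V \<omega> by (simp add: R_def)
  have "R ^ n = ?V / ?\<omega>" using V \<omega> n0 by (simp add: R_def powr_power)
  then have RV: "?\<omega> * R ^ n = ?V" using \<omega> by simp
  have I: "moment_of_inertia \<Omega> \<ge> real n / (real n + 2) * ?V * R\<^sup>2"
    using moment_of_inertia_lower_bound[of R] R RV n(1) by simp
  have "0 < real n / (real n + 2) * ?V * R\<^sup>2" using n0 V R by simp
  with I show I0: "0 < moment_of_inertia \<Omega>" by linarith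
  have "4 * (real n / (real n + 2)) * (r * R)\<^sup>2 = r\<^sup>2 * (4 * (real n / (real n + 2) * ?V * R\<^sup>2) / ?V)"
    using V by (simp add: power_mult_distrib)
  also have "\<dots> \<le> r\<^sup>2 * (4 * moment_of_inertia \<Omega> / ?V)"
    using I V by (intro mult_left_mono divide_right_mono) auto
  finally have main: "4 * (real n / (real n + 2)) * (r * R)\<^sup>2 \<le> r\<^sup>2 * (4 * moment_of_inertia \<Omega> / ?V)" .
  have "(r * R) ^ n * ?\<omega>\<^sup>2 = (2 * pi) ^ n * k"
  proof -
    have "(r * R) ^ n * ?\<omega>\<^sup>2 = r ^ n * (?\<omega> * (?\<omega> * R ^ n))"
      by (simp add: power_mult_distrib power2_eq_square)
    then show ?thesis using r_eq RV by simp
  qed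
  also have "\<dots> \<ge> (2 * pi) ^ n" using k by simp
  finally have rR: "(2 * pi) ^ n \<le> (r * R) ^ n * ?\<omega>\<^sup>2" .
  have \<omega>_eq: "?\<omega> = unit_ball_vol (real n)" unfolding n(1) by (simp add: content_cball)
  have rR0: "0 < r * R" using r R by simp
  show "r\<^sup>2 * (4 * moment_of_inertia \<Omega> / ?V) \<ge> 8" if "n = 2"
  proof -
    have "4 * pi\<^sup>2 \<le> (r * R)\<^sup>2 * pi\<^sup>2"
      using rR that by (simp add: \<omega>_eq unit_ball_vol_2 power_mult_distrib)
    then have "4 \<le> (r * R)\<^sup>2" by simp
    then show ?thesis using main that by simp
  qed
  show "r\<^sup>2 * (4 * moment_of_inertia \<Omega> / ?V) \<ge> 14" if "n = 3"
  proof -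
    have "pi\<^sup>2 * (9/2 * pi) \<le> pi\<^sup>2 * (r * R) ^ 3"
      using rR that by (simp add: \<omega>_eq unit_ball_vol_3 power_mult_distrib power2_eq_square power3_eq_cube field_simps)
    then have "9/2 * pi \<le> (r * R) ^ 3" by simp
    moreover have "14.1 \<le> 9/2 * pi" using pi_approx(1) by simp
    ultimately have "14.1 \<le> (r * R) ^ 3" by linarith
    then have "14.1\<^sup>2 \<le> ((r * R) ^ 3)\<^sup>2" by (intro power_mono) auto
    then have *: "14.1\<^sup>2 \<le> ((r * R)\<^sup>2) ^ 3" by (simp flip: power_mult)
    \<comment> \<open>\<open>35/6\<close> is chosen because \<open>12/5 * (35/6) = 14\<close>; its
      cube, about 198.5, is just below \<open>14.1\<^sup>2 = 198.81\<close>.\<close>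
    have "35/6 \<le> (r * R)\<^sup>2"
    proof (rule ccontr)
      assume "\<not> ?thesis"
      then have "((r * R)\<^sup>2) ^ 3 < (35/6) ^ 3" by (intro power_strict_mono) auto
      with * show False by (simp add: power2_eq_square power3_eq_cube)
    qed
    then show ?thesis using main that by simp
  qed
  show "r\<^sup>2 * (4 * moment_of_inertia \<Omega> / ?V) \<ge> 64/3" if "n = 4"
  proof -
    have "pi ^ 4 * 64 \<le> pi ^ 4 * (r * R) ^ 4"
      using rR that by (simp add: \<omega>_eq unit_ball_vol_4 power_mult_distrib power_divide field_simps flip: power_mult)
    then have "8\<^sup>2 \<le> ((r * R)\<^sup>2)\<^sup>2" by (simp flip: power_mult)
    then have "8 \<le> (r * R)\<^sup>2" by (rule power2_le_imp_le) simp
    then show ?thesis using main that by simp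
  qed
qed

theorem theorem3:
  fixes \<Omega> :: "(real ^ 'n) set" and a :: real and \<Gamma> :: "nat \<Rightarrow> real" and n k :: nat
    and \<omega> V I :: real
  defines "n \<equiv> CARD('n)"
    and "\<omega> \<equiv> volume (ball (0 :: real ^ 'n) 1)"
    and "V \<equiv> volume \<Omega>"
    and "I \<equiv> moment_of_inertia \<Omega>"
  assumes "n \<in> {2, 3, 4}"
    and "a \<ge> 0"
    and "open \<Omega>" "connected \<Omega>" "\<Omega> \<noteq> {}" "bounded \<Omega>"
    and "eigenvalue_sequence \<Omega> a \<Gamma>"
    and "k \<ge> 1"
  shows "1 / real k * (\<Sum>j = 1..k. \<Gamma> j) \<ge>
      real n / (real n + 4) * ((2 * pi) ^ 4 / (\<omega> * V) powr (4 / real n)) * real k powr (4 / real n)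
    + (real n / 24 * alpha n * (V / I) + real n * a / (real n + 2))
        * ((2 * pi) ^ 2 / (\<omega> * V) powr (2 / real n)) * real k powr (2 / real n)
    + real n * a / 48 * beta n * (V / I)"
proof -
  interpret bounded_open \<Omega> by standard fact+
  have nD: "n = DIM(real ^ 'n)" by (simp add: n_def)
  have n0: "0 < n" using assms(5) by auto
  have \<omega>: "unit_ball_volume TYPE(real ^ 'n) = \<omega>"
    unfolding \<omega>_def by (simp add: content_cball_conv_ball)
  have \<omega>0: "0 < \<omega>" using unit_ball_volume_pos[where 'a = "real ^ 'n"] by (simp only: \<omega>)
  have V0: "0 < V" unfolding V_def by (rule volume_pos) fact
  define s where "s = real k / (\<omega> * V)"
  have s0: "0 < s" using \<open>k \<ge> 1\<close> \<omega>0 V0 by (simp add: s_def)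
  \<comment> \<open>The cylinder of height \<open>V\<close> over the ball of radius \<open>r\<close>
    has the same mass \<open>(2 * pi) ^ n * k\<close> as \<open>F\<close>. Without the Lipschitz
    bound it would be the minimiser and give only the terms free of \<open>V / I\<close>.\<close>
  define r where "r = 2 * pi * s powr (1 / real n)"
  have r0: "0 < r" using s0 by (simp add: r_def)
  have r_pow: "r ^ p = (2 * pi) ^ p / (\<omega> * V) powr (real p / real n) * real k powr (real p / real n)" if "0 < p" for p
  proof -
    have "r ^ p = (2 * pi) ^ p * s powr (real p / real n)"
      using s0 that by (simp add: r_def power_mult_distrib powr_power)
    also have "s powr (real p / real n) = real k powr (real p / real n) / (\<omega> * V) powr (real p / real n)"
      using \<omega>0 V0 by (simp add: s_def powr_divide)
    finally show ?thesis by simp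
  qed
  have r_eq: "r ^ n * (\<omega> * V) = (2 * pi) ^ n * real k"
    using r_pow[OF n0] n0 \<omega>0 V0 \<open>k \<ge> 1\<close> by simp
  note Q = inner_radius_lower_bound[OF nD assms(5) r0, of "real k", unfolded \<omega>, folded V_def I_def]
  have I0: "0 < I" using Q(4) \<open>k \<ge> 1\<close> V0 r_eq by simp
  define w where "w = sqrt (V / (4 * I))"
  have w0: "0 < w" using V0 I0 by (simp add: w_def)
  have w2: "w\<^sup>2 = V / (4 * I)" using V0 I0 by (simp add: w_def)
  define x where "x = r / w"
  have x0: "0 < x" using r0 w0 by (simp add: x_def)
  have x2: "x\<^sup>2 = r\<^sup>2 * (4 * I / V)" by (simp add: x_def power_divide w2)
  have wx: "w * x = r" using w0 by (simp add: x_def)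
  have X: "n = 2 \<Longrightarrow> 8 \<le> x\<^sup>2" "n = 3 \<Longrightarrow> 14 \<le> x\<^sup>2" "n = 4 \<Longrightarrow> 64/3 \<le> x\<^sup>2"
    unfolding x2 using Q(1-3) \<open>k \<ge> 1\<close> V0 r_eq by auto
  \<comment> \<open>A mass this large leaves room for the whole slope region:
    \<open>1 \<le> x\<close> is what provides a midpoint \<open>y \<ge> 1/2\<close>.\<close>
  then have "1\<^sup>2 \<le> x\<^sup>2" using assms(5) by auto
  then have "1 \<le> x" by (rule power2_le_imp_le) (use x0 in simp)
  then obtain y where y: "1/2 \<le> y" "shell_mean n y = x ^ n"
    using shell_mean_solution[OF assms(5)] by metis
  note B = shell_mean_bounds[OF assms(5) y(1) x0 y(2) X]
  have "1 / real k * (\<Sum>j = 1..k. \<Gamma> j) \<ge> real n / (real n + 4) * r ^ 4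
    + (real n / 6 * alpha n * w\<^sup>2 + real n * a / (real n + 2)) * r ^ 2
    + real n * a / 12 * beta n * w\<^sup>2"
    using eigenvalue_sum_bound[OF assms(11,6,12), folded nD, of w y x "alpha n" "beta n"]
      V0 w0 y x0 B I0 r_eq unfolding wx \<omega> by (simp add: V_def[symmetric] I_def[symmetric] w2)
  also have "real n / 6 * alpha n * w\<^sup>2 = real n / 24 * alpha n * (V / I)" by (simp add: w2)
  also have "real n * a / 12 * beta n * w\<^sup>2 = real n * a / 48 * beta n * (V / I)" by (simp add: w2)
  finally show ?thesis using r_pow[of 4] r_pow[of 2] by (simp add: mult.assoc)
qed

end
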